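(* Let $n>4$ and let $M_0\subset\mathbb{C}^{n+1}$ be the hypersurface $$M_0=\Bigl\{u=\sum_{0<j<j+k\leq n}x_jx_ks^{n-j-k}\Bigr\}.$$ Then the infinitesimal symmetry algebra of $M_0$ at the origin is $$\mathfrak{hol}(M_0,0)=\mathrm{span}_{\mathbb{R}}\{Y_{-n},X_{-j},Y_{-j},X'_{-1},Y'_{-1},U_0,V_0,V_{2-n}\ |\ j=1,\dots,n-1\},$$ where the vector fields are those listed in the context.
   Context: Coordinates on $\mathbb{C}^{n+1}$ are $(w,z_1,\dots,z_{n-1},\zeta)$ with $w=u+iv$, $z_j=x_j+iy_j$, $\zeta=s+it$. The sum runs over all ordered pairs of positive integers $(j,k)$ with $j+k\le n$. For a real hypersurface $M\ni0$, $\mathfrak{hol}(M,0)$ is the real Lie algebra of germs at $0$ of holomorphic vector fields whose real part is tangent to $M$. The vector fields are: $$Y_{-n}=i\frac{\partial}{\partial w},\quad Y'_{-1}=i\frac{\partial}{\partial\zeta},\quad Y_{-j}=i\frac{\partial}{\partial z_j}\ (j=1,\dots,n-1),$$ $$X_{1-n}=\frac{\partial}{\partial z_{n-1}}+2z_1\frac{\partial}{\partial w},\quad X_{-j}=\frac{\partial}{\partial z_j}-\zeta\frac{\partial}{\partial z_{j+1}}+2z_{n-j}\frac{\partial}{\partial w}\ (j=1,\dots,n-2),$$ $$X'_{-1}=2\frac{\partial}{\partial\zeta}+\sum_{j=2}^{n-1}(2j-2-n)z_{j-1}\frac{\partial}{\partial z_j},\quad V_{2-n}=iz_1^2\frac{\partial}{\partial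 w}+iz_1\frac{\partial}{\partial z_{n-1}},$$ $$U_0=\sum_{j=1}^{n-1}jz_j\frac{\partial}{\partial z_j}+\zeta\frac{\partial}{\partial\zeta}+nw\frac{\partial}{\partial w},\quad V_0=\sum_{j=1}^{n-1}z_j\frac{\partial}{\partial z_j}+2w\frac{\partial}{\partial w}.$$ *)

theory Defs
  imports "HOL-Analysis.Analysis"
begin

section \<open>The ambient space\<close>

text \<open>
  A point \<open>(w, z, \<zeta>)\<close> of \<open>'m cspace\<close> has \<open>CARD('m) + 2\<close> complex coordinates, so
  \<open>\<complex>\<^sup>n\<^sup>+\<^sup>1\<close> is \<open>'m cspace\<close> with \<open>CARD('m) = n - 1\<close>.  The numbering
  \<open>z\<^sub>1, \<dots>, z\<^sub>n\<^sub>-\<^sub>1\<close> is given by a bijection \<open>e\<close> from \<open>{1..n - 1}\<close> onto \<open>'m\<close>,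
  with \<open>z\<^sub>j = z $ e j\<close>.
\<close>

type_synonym 'm cspace = "complex \<times> (complex ^ 'm) \<times> complex"

definition cscale :: "complex \<Rightarrow> 'm::finite cspace \<Rightarrow> 'm cspace" where
  "cscale c = (\<lambda>(w, z, \<zeta>). (c * w, c *s z, c * \<zeta>))"

text \<open>
  The holomorphic vector field \<open>a \<partial>/\<partial>w + \<Sum>\<^sub>j b\<^sub>j \<partial>/\<partial>z\<^sub>j + c \<partial>/\<partial>\<zeta>\<close> is represented by the
  map with components \<open>(a, b, c)\<close>.
\<close>

definition holomorphic_vf_on :: "('m::finite cspace \<Rightarrow> 'm cspace) \<Rightarrow> 'm cspace set \<Rightarrow> bool" where
  "holomorphic_vf_on X U \<longleftrightarrow>
     (\<forall>p\<in>U. \<exists>D. (X has_derivative D) (at p) \<and> (\<forall>c v. D (cscale c v) = cscale c (D v)))"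


section \<open>Germs at the origin\<close>

quotient_type (overloaded) ('a, 'b) germ =
  "'a::{topological_space, zero} \<Rightarrow> 'b" / "\<lambda>f g. \<forall>\<^sub>F p in nhds 0. f p = g p"
  morphisms rep_germ germ
proof (rule equivpI)
  show "reflp (\<lambda>f g :: 'a \<Rightarrow> 'b. \<forall>\<^sub>F p in nhds 0. f p = g p)"
    by (simp add: reflp_def)
  show "symp (\<lambda>f g :: 'a \<Rightarrow> 'b. \<forall>\<^sub>F p in nhds 0. f p = g p)"
    by (auto simp: symp_def elim: eventually_mono)
  show "transp (\<lambda>f g :: 'a \<Rightarrow> 'b. \<forall>\<^sub>F p in nhds 0. f p = g p)"
    by (auto simp: transp_def elim: eventually_elim2)
qed

instantiation germ :: ("{topological_space, zero}", real_vector) real_vector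
begin

lift_definition zero_germ :: "('a, 'b) germ" is "\<lambda>_. 0" .

lift_definition plus_germ :: "('a, 'b) germ \<Rightarrow> ('a, 'b) germ \<Rightarrow> ('a, 'b) germ"
  is "\<lambda>f g p. f p + g p"
  by (auto elim: eventually_elim2)

lift_definition minus_germ :: "('a, 'b) germ \<Rightarrow> ('a, 'b) germ \<Rightarrow> ('a, 'b) germ"
  is "\<lambda>f g p. f p - g p"
  by (auto elim: eventually_elim2)

lift_definition uminus_germ :: "('a, 'b) germ \<Rightarrow> ('a, 'b) germ"
  is "\<lambda>f p. - f p"
  by (auto elim: eventually_mono)

lift_definition scaleR_germ :: "real \<Rightarrow> ('a, 'b) germ \<Rightarrow> ('a, 'b) germ"
  is "\<lambda>r f p. r *\<^sub>R f p"
  by (auto elim: eventually_mono)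

instance
  by standard (transfer; simp add: algebra_simps)+

end


section \<open>Infinitesimal symmetries of a real hypersurface\<close>

text \<open>Real tangent vectors, as velocities of curves lying in the hypersurface.\<close>

definition tangent_at :: "'a::real_normed_vector set \<Rightarrow> 'a \<Rightarrow> 'a set" where
  "tangent_at M p =
     {v. \<exists>\<gamma>. \<gamma> (0::real) = p \<and> (\<forall>\<^sub>F t in nhds 0. \<gamma> t \<in> M) \<and> (\<gamma> has_vector_derivative v) (at 0)}"

text \<open>
  As a real vector field, the real part of a holomorphic vector field with components \<open>X\<close>
  is at \<open>p\<close> the vector \<open>X p\<close> itself (up to a factor 1/2, depending on conventions),
  where \<open>\<partial>/\<partial>z\<close> corresponds to \<open>\<partial>/\<partial>x\<close> and \<open>i \<partial>/\<partial>z\<close> to \<open>\<partial>/\<partial>y\<close>.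
\<close>

definition hol :: "'m::finite cspace set \<Rightarrow> ('m cspace, 'm cspace) germ set" where
  "hol M = {germ X |X. \<exists>U. open U \<and> 0 \<in> U \<and> holomorphic_vf_on X U \<and>
                          (\<forall>p\<in>M \<inter> U. X p \<in> tangent_at M p)}"


section \<open>The hypersurface and its vector fields\<close>

definition M\<^sub>0 :: "nat \<Rightarrow> (nat \<Rightarrow> 'm::finite) \<Rightarrow> 'm cspace set" where
  "M\<^sub>0 n e = {(w, z, \<zeta>). Re w =
     (\<Sum>(j, k) | 0 < j \<and> j < j + k \<and> j + k \<le> n.
        Re (z $ e j) * Re (z $ e k) * Re \<zeta> ^ (n - j - k))}"

lemma finite_M\<^sub>0_index: "finite {(j, k). 0 < j \<and> j < j + k \<and> j + k \<le> (n::nat)}"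
  by (rule finite_subset[of _ "{..n} \<times> {..n}"]) auto

text \<open>
  In the following, \<open>axis (e j) b\<close> is \<open>b \<partial>/\<partial>z\<^sub>j\<close>.  A negative index is
  turned into its absolute value: \<open>Y_z e j\<close> is \<open>Y\<^sub>-\<^sub>j\<close>, \<open>X_z n e j\<close> is \<open>X\<^sub>-\<^sub>j\<close>;
  \<open>Y_w\<close> is \<open>Y\<^sub>-\<^sub>n\<close>, and \<open>X_\<zeta>\<close>, \<open>Y_\<zeta>\<close> are \<open>X'\<^sub>-\<^sub>1\<close>, \<open>Y'\<^sub>-\<^sub>1\<close>.
\<close>

definition Y_w :: "'m::finite cspace \<Rightarrow> 'm cspace" where
  "Y_w = (\<lambda>(w, z, \<zeta>). (\<i>, 0, 0))"

definition Y_\<zeta> :: "'m::finite cspace \<Rightarrow> 'm cspace" where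
  "Y_\<zeta> = (\<lambda>(w, z, \<zeta>). (0, 0, \<i>))"

definition Y_z :: "(nat \<Rightarrow> 'm) \<Rightarrow> nat \<Rightarrow> 'm::finite cspace \<Rightarrow> 'm cspace" where
  "Y_z e j = (\<lambda>(w, z, \<zeta>). (0, axis (e j) \<i>, 0))"

definition X_z :: "nat \<Rightarrow> (nat \<Rightarrow> 'm) \<Rightarrow> nat \<Rightarrow> 'm::finite cspace \<Rightarrow> 'm cspace" where
  "X_z n e j = (\<lambda>(w, z, \<zeta>).
     if j = n - 1 then (2 * z $ e 1, axis (e (n - 1)) 1, 0)
     else (2 * z $ e (n - j), axis (e j) 1 - axis (e (j + 1)) \<zeta>, 0))"

definition X_\<zeta> :: "nat \<Rightarrow> (nat \<Rightarrow> 'm) \<Rightarrow> 'm::finite cspace \<Rightarrow> 'm cspace" where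
  "X_\<zeta> n e = (\<lambda>(w, z, \<zeta>).
     (0, \<Sum>j = 2..n - 1. axis (e j) (of_int (2 * int j - 2 - int n) * z $ e (j - 1)), 2))"

definition V_neg :: "nat \<Rightarrow> (nat \<Rightarrow> 'm) \<Rightarrow> 'm::finite cspace \<Rightarrow> 'm cspace"
  \<comment> \<open>the field \<open>V\<close> of index \<open>2 - n\<close>\<close> where
  "V_neg n e = (\<lambda>(w, z, \<zeta>). (\<i> * (z $ e 1)\<^sup>2, axis (e (n - 1)) (\<i> * z $ e 1), 0))"

definition U\<^sub>0 :: "nat \<Rightarrow> (nat \<Rightarrow> 'm) \<Rightarrow> 'm::finite cspace \<Rightarrow> 'm cspace" where
  "U\<^sub>0 n e = (\<lambda>(w, z, \<zeta>).
     (of_nat n * w, \<Sum>j = 1..n - 1. axis (e j) (of_nat j * z $ e j), \<zeta>))"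

definition V\<^sub>0 :: "nat \<Rightarrow> (nat \<Rightarrow> 'm) \<Rightarrow> 'm::finite cspace \<Rightarrow> 'm cspace" where
  "V\<^sub>0 n e = (\<lambda>(w, z, \<zeta>). (2 * w, \<Sum>j = 1..n - 1. axis (e j) (z $ e j), 0))"

end

theory Submission
  imports Defs "HOL-Complex_Analysis.Complex_Analysis"
begin

text \<open>
  The symmetry \<open>V\<^sub>0\<close> grades \<open>hol(M\<^sub>0, 0)\<close>: give \<open>w\<close>, \<open>z\<^sub>j\<close>, \<open>\<zeta>\<close> the weights 2, 1, 0.  The real dilations
  \<open>(w, z, \<zeta>) \<mapsto> (t\<^sup>2 w, t z, \<zeta>)\<close> preserve \<open>M\<^sub>0\<close>, so the weighted homogeneous components of a symmetry
  are again symmetries, of weights \<open>k \<ge> -2\<close>.  Differentiation along \<open>i \<partial>/\<partial>z\<^sub>j\<close> or \<open>i \<partial>/\<partial>w\<close>, i.e. bracketing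
  with \<open>Y\<^sub>-\<^sub>j\<close> or \<open>Y\<^sub>-\<^sub>n\<close>, maps symmetries of weight \<open>k\<close> to symmetries of weight \<open>k - 1\<close> or \<open>k - 2\<close>, and a
  field of weight \<open>k\<close> is recovered from these derivatives by Euler's identity, up to coefficients
  that depend on \<open>\<zeta>\<close> alone.  Those are determined by the tangency condition.  Weight -2 gives \<open>Y\<^sub>-\<^sub>n\<close>,
  weight -1 the \<open>X\<^sub>-\<^sub>j\<close> and \<open>Y\<^sub>-\<^sub>j\<close>, weight 0 the remaining five fields, and
  in weights 1 and 2 nothing survives, hence nothing in any higher weight.
\<close>

section \<open>Derivatives of holomorphic functions of several variables\<close>

text \<open>The dilations fix \<open>\<zeta>\<close>, so a component of given weight is polynomial
  in \<open>w\<close> and the \<open>z_j\<close>, with holomorphic functions of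
  \<open>\<zeta>\<close> as coefficients; it lives on a whole \<open>tube\<close> although the field
  is only a germ. The grading puts no bound on the degree in \<open>\<zeta>\<close>. The bound comes
  from the fact that \<open>M\<^sub>0\<close> involves real parts only: for a component that depends
  on \<open>\<zeta>\<close> alone, tangency prescribes the real part as an affine function of
  \<open>Re \<zeta>\<close>, and a holomorphic function with such a real part is affine, with one
  imaginary constant left free. These constants produce the fields \<open>Y_w\<close>,
  \<open>Y_z\<close>, \<open>Y_\<zeta>\<close>. Tangency couples the unknowns through the matrix
  with entries s^(n-j-k). Its rows are geometric sequences, so subtracting s times the neighbouring
  equation inverts it; for the s-derivative of the matrix the same is done in both indices. The
  bound n > 4 enters where a second pair on the antidiagonal j + k = n - 1 is compared with (1, n -
  2), where two indices outside {k, k + 1} are picked, and through the factor 4 - n.\<close>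

locale complex_scaling =
  fixes cs :: "complex \<Rightarrow> 'a::euclidean_space \<Rightarrow> 'a"
  assumes bilinear: "bounded_bilinear cs"
    and one: "cs 1 v = v"
    and assoc: "cs a (cs b v) = cs (a * b) v"
begin

text \<open>The action \<open>cs\<close> is a parameter because two spaces occur: the ambient space,
  and its product with a complex line that carries the dilation parameter. No continuity of the
  derivative is assumed; it comes out of Cauchy's formula.\<close>

definition chol :: "('a \<Rightarrow> complex) \<Rightarrow> 'a set \<Rightarrow> bool" where
  "chol f U \<longleftrightarrow> (\<forall>p\<in>U. \<exists>D. (f has_derivative D) (at p) \<and> (\<forall>c v. D (cs c v) = c * D v))"

text \<open>The one-variable \<open>deriv\<close> gives a total function of \<open>p\<close> without
  a choice of derivative; for holomorphic \<open>f\<close> it is the value of the derivative on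
  \<open>v\<close>.\<close>

definition dd :: "'a \<Rightarrow> ('a \<Rightarrow> complex) \<Rightarrow> 'a \<Rightarrow> complex" where
  "dd v f p = deriv (\<lambda>\<tau>. f (p + cs \<tau> v)) 0"

lemma cs_zero_left [simp]: "cs 0 v = 0"
  by (rule bounded_bilinear.zero_left[OF bilinear])

lemma cs_zero_right [simp]: "cs c 0 = 0"
  by (rule bounded_bilinear.zero_right[OF bilinear])

lemma has_derivative_line: "((\<lambda>\<tau>. p + cs \<tau> v) has_derivative (\<lambda>\<tau>. cs \<tau> v)) (at x within S)"
  by (auto intro!: derivative_eq_intros bounded_linear_imp_has_derivative
      bounded_bilinear.bounded_linear_left[OF bilinear])

lemma continuous_on_compose_line:
  assumes "continuous_on U h" "continuous_on S g" "continuous_on S c"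
    and "\<And>x. x \<in> S \<Longrightarrow> g x + cs (c x) v \<in> U"
  shows "continuous_on S (\<lambda>x. h (g x + cs (c x) v))"
proof (rule continuous_on_compose2[OF assms(1)])
  show "continuous_on S (\<lambda>x. g x + cs (c x) v)"
    using bounded_bilinear.continuous_on[OF bilinear assms(3) continuous_on_const] assms(2)
    by (intro continuous_on_add)
qed (use assms(4) in auto)

lemma chol_line:
  assumes "(f has_derivative D) (at (p + cs \<tau> v))" "\<And>c v. D (cs c v) = c * D v"
  shows "((\<lambda>\<tau>. f (p + cs \<tau> v)) has_field_derivative D v) (at \<tau>)"
proof -
  have "((\<lambda>\<tau>. f (p + cs \<tau> v)) has_derivative (\<lambda>\<sigma>. D (cs \<sigma> v))) (at \<tau>)"
    using has_derivative_compose[OF has_derivative_line assms(1)] .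
  then show ?thesis
    by (simp add: has_field_derivative_def assms(2) mult.commute[of _ "D v"])
qed

lemma dd_eq:
  assumes "(f has_derivative D) (at p)" "\<And>c v. D (cs c v) = c * D v"
  shows "dd v f p = D v"
  unfolding dd_def using chol_line[of f D p 0 v] assms by (auto intro!: DERIV_imp_deriv)

lemma chol_has_derivative:
  assumes "chol f U" "p \<in> U"
  shows "(f has_derivative (\<lambda>v. dd v f p)) (at p)" "dd (cs c v) f p = c * dd v f p"
proof -
  obtain D where D: "(f has_derivative D) (at p)" "\<And>c v. D (cs c v) = c * D v"
    using assms unfolding chol_def by blast
  have "D = (\<lambda>v. dd v f p)" using dd_eq[OF D] by auto
  then show "(f has_derivative (\<lambda>v. dd v f p)) (at p)" "dd (cs c v) f p = c * dd v f p"
    using D by auto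
qed

lemma cholI:
  assumes "\<And>p. p \<in> U \<Longrightarrow> (f has_derivative D p) (at p)" "\<And>p c v. p \<in> U \<Longrightarrow> D p (cs c v) = c * D p v"
  shows "chol f U"
  using assms unfolding chol_def by blast

lemma chol_has_field_derivative:
  assumes "chol f U" "p + cs \<tau> v \<in> U"
  shows "((\<lambda>\<tau>. f (p + cs \<tau> v)) has_field_derivative dd v f (p + cs \<tau> v)) (at \<tau>)"
  using chol_line[OF chol_has_derivative(1)[OF assms]] chol_has_derivative(2)[OF assms] by blast

lemma chol_continuous_on: "chol f U \<Longrightarrow> continuous_on U f"
  using chol_has_derivative(1) has_derivative_continuous
  by (metis continuous_at_imp_continuous_on)

lemma chol_subset: "chol f U \<Longrightarrow> V \<subseteq> U \<Longrightarrow> chol f V"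
  unfolding chol_def by blast

section \<open>Cauchy's formula on complex lines and holomorphy of directional derivatives\<close>

definition cauchy_kernel :: "real \<Rightarrow> real \<Rightarrow> complex" where
  "cauchy_kernel \<rho> x = vector_derivative (circlepath 0 \<rho>) (at x) / (2 * pi * \<i> * (circlepath 0 \<rho> x)\<^sup>2)"

text \<open>The point \<open>p\<close> enters the integrand through \<open>f\<close> alone, not
  through a derivative of \<open>f\<close>. Regularity of \<open>dd v f\<close> can therefore be
  obtained by differentiating under the integral.\<close>

lemma dd_as_integral:
  assumes f: "chol f U" and "\<rho> > 0" and inU: "\<And>\<tau>. norm \<tau> \<le> \<rho> \<Longrightarrow> p + cs \<tau> v \<in> U"
  shows "dd v f p = integral (cbox 0 1)
     (\<lambda>x::real. f (p + cs (circlepath 0 \<rho> x) v) * cauchy_kernel \<rho> x)"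
proof -
  let ?h = "\<lambda>\<tau>. f (p + cs \<tau> v)"
  have der: "(?h has_field_derivative dd v f (p + cs \<tau> v)) (at \<tau>)" if "norm \<tau> \<le> \<rho>" for \<tau>
    using chol_has_field_derivative[OF f inU[OF that]] .
  have "continuous_on (cball 0 \<rho>) ?h"
    by (intro continuous_at_imp_continuous_on ballI DERIV_isCont[OF der]) simp
  moreover have "?h holomorphic_on ball 0 \<rho>"
    unfolding holomorphic_on_open[OF open_ball] by (intro ballI exI, rule der) simp
  ultimately have "contour_integral (circlepath 0 \<rho>) (\<lambda>u. ?h u / (u - 0)\<^sup>2) = 2 * pi * \<i> * deriv ?h 0"
    using \<open>\<rho> > 0\<close> by (intro Cauchy_contour_integral_circlepath_2) auto
  then have "dd v f p = contour_integral (circlepath 0 \<rho>) (\<lambda>u. ?h u / u\<^sup>2) / (2 * pi * \<i>)"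
    by (simp add: dd_def)
  also have "\<dots> = integral {0..1} (\<lambda>x. ?h (circlepath 0 \<rho> x) / (circlepath 0 \<rho> x)\<^sup>2 *
      vector_derivative (circlepath 0 \<rho>) (at x) / (2 * pi * \<i>))"
    unfolding contour_integral_integral by (subst integral_divide) (rule refl)
  also have "\<dots> = integral {0..1} (\<lambda>x. ?h (circlepath 0 \<rho> x) * cauchy_kernel \<rho> x)"
    unfolding cauchy_kernel_def by (intro arg_cong[where f = "integral {0..1}"] ext) (simp add: ac_simps)
  finally show ?thesis by (simp add: cbox_interval)
qed

lemma continuous_on_circle:
  "continuous_on S u \<Longrightarrow> continuous_on S (\<lambda>x. circlepath 0 \<rho> (u x))"
  unfolding circlepath by (intro continuous_intros)

lemma continuous_on_cauchy_kernel:
  assumes "\<rho> > 0" "continuous_on S u"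
  shows "continuous_on S (\<lambda>x. cauchy_kernel \<rho> (u x))"
  unfolding cauchy_kernel_def vector_derivative_circlepath unfolding circlepath using assms
  by (intro continuous_intros) auto

text \<open>The circle must have one radius for all points near \<open>p\<close>; otherwise the
  integral formula could not be differentiated in \<open>p\<close>.\<close>

lemma locally_radius:
  assumes "open U" "p \<in> U"
  obtains d \<rho> where "d > 0" "\<rho> > 0" "\<And>q \<tau>. q \<in> ball p d \<Longrightarrow> norm \<tau> \<le> \<rho> \<Longrightarrow> q + cs \<tau> v \<in> U"
proof -
  obtain d0 where d0: "d0 > 0" "ball p d0 \<subseteq> U"
    using assms by (auto simp: open_contains_ball)
  define d where "d = d0 / 2"
  have d: "d > 0" "ball p (2 * d) \<subseteq> U"
    using d0 by (auto simp: d_def)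
  obtain K where K: "K > 0" "\<And>a b. norm (cs a b) \<le> norm a * norm b * K"
    using bounded_bilinear.pos_bounded[OF bilinear] by blast
  \<comment> \<open>Adding 1 to the norm covers \<open>v = 0\<close>; the factor 2 keeps the
    displacement at most \<open>d / 2\<close>.\<close>
  define \<rho> where "\<rho> = d / (2 * (norm v + 1) * K)"
  have "\<rho> > 0" unfolding \<rho>_def using d K by (auto intro!: divide_pos_pos mult_pos_pos add_nonneg_pos)
  moreover have "q + cs \<tau> v \<in> U" if "q \<in> ball p d" "norm \<tau> \<le> \<rho>" for q \<tau>
  proof -
    have "norm (cs \<tau> v) \<le> norm \<tau> * norm v * K" by (rule K)
    also have "\<dots> \<le> \<rho> * (norm v + 1) * K"
      using that K \<open>\<rho> > 0\<close> by (intro mult_mono) auto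
    also have "\<dots> = d / 2"
    proof -
      have "norm v + 1 \<noteq> 0" using norm_ge_zero[of v] by linarith
      moreover have "d / (2 * a * K) * a * K = d / 2" if "a \<noteq> 0" for a
        using that K(1) by simp
      ultimately show ?thesis unfolding \<rho>_def by blast
    qed
    finally have "norm (cs \<tau> v) < d" using d by simp
    then have "dist p (q + cs \<tau> v) < 2 * d"
      using that(1) dist_triangle[of p "q + cs \<tau> v" q] by (simp add: dist_norm)
    then show ?thesis using d by auto
  qed
  ultimately show ?thesis using d that by blast
qed

text \<open>A preliminary to \<open>chol_dd\<close>: the Leibniz rule asks for a derivative of the
  integrand that is jointly continuous in the point and the circle parameter.\<close>

lemma dd_continuous_on:
  assumes f: "chol f U" and U: "open U"
  shows "continuous_on U (dd v f)"
proof (rule continuous_at_imp_continuous_on, rule ballI)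
  fix p assume "p \<in> U"
  then obtain d \<rho> where d: "d > 0" "\<rho> > 0" "\<And>q \<tau>. q \<in> ball p d \<Longrightarrow> norm \<tau> \<le> \<rho> \<Longrightarrow> q + cs \<tau> v \<in> U"
    using locally_radius[OF U] by metis
  have inU: "q + cs (circlepath 0 \<rho> x) v \<in> U" if "q \<in> ball p d" for q x
    using d that by (intro d(3)) (auto simp: circlepath norm_mult)
  have "continuous_on (ball p d \<times> cbox 0 1) (\<lambda>z. f (fst z + cs (circlepath 0 \<rho> (snd z)) v) *
cauchy_kernel \<rho> (snd z))"
    by (intro continuous_on_mult continuous_on_compose_line[OF chol_continuous_on[OF f]]
        continuous_on_cauchy_kernel[OF d(2)] continuous_on_circle continuous_on_fst continuous_on_snd
        continuous_on_id) (use inU in auto)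
  then have "continuous_on (ball p d) (\<lambda>q. integral (cbox 0 1) (\<lambda>x::real. f (q + cs (circlepath 0 \<rho> x) v) *
cauchy_kernel \<rho> x))"
    by (intro integral_continuous_on_param) (simp add: case_prod_unfold)
  then have "continuous_on (ball p d) (dd v f)"
    by (rule continuous_on_eq) (rule dd_as_integral[symmetric, OF f d(2) d(3)])
  then show "isCont (dd v f) p"
    using d(1) by (simp add: continuous_on_eq_continuous_at)
qed

lemma chol_dd:
  assumes f: "chol f U" and U: "open U"
  shows "chol (dd v f) U"
  unfolding chol_def
proof (rule ballI)
  fix p assume "p \<in> U"
  then obtain d \<rho> where d: "d > 0" "\<rho> > 0" "\<And>q \<tau>. q \<in> ball p d \<Longrightarrow> norm \<tau> \<le> \<rho> \<Longrightarrow> q + cs \<tau> v \<in> U"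
    using locally_radius[OF U] by metis
  have inU: "q + cs (circlepath 0 \<rho> x) v \<in> U" if "q \<in> ball p d" for q x
    using d that by (intro d(3)) (auto simp: circlepath norm_mult)
  define F where "F = (\<lambda>q x. f (q + cs (circlepath 0 \<rho> x) v) * cauchy_kernel \<rho> x)"
  \<comment> \<open>The Leibniz rule takes derivatives in the normed space of bounded linear maps,
    hence \<open>Blinfun\<close>; continuity in that space is tested on basis vectors.\<close>
  define F' where "F' = (\<lambda>q x. Blinfun (\<lambda>u. dd u f (q + cs (circlepath 0 \<rho> x) v) * cauchy_kernel \<rho> x))"
  have F'_app: "blinfun_apply (F' q x) = (\<lambda>u. dd u f (q + cs (circlepath 0 \<rho> x) v) * cauchy_kernel \<rho> x)"
    if "q \<in> ball p d" for q x
    unfolding F'_def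
    by (rule bounded_linear_Blinfun_apply, rule bounded_linear_mult_const,
        rule has_derivative_bounded_linear, rule chol_has_derivative(1)[OF f inU[OF that]])
  have shift: "((\<lambda>q. q + cs (circlepath 0 \<rho> x) v) has_derivative (\<lambda>u. u)) (at q within S)" for q x S
    by (auto intro!: derivative_eq_intros)
  have "((\<lambda>q. integral (cbox 0 1) (F q)) has_derivative integral (cbox 0 1) (F' p)) (at p within ball p d)"
  proof (rule leibniz_rule)
    fix q and x :: real assume q: "q \<in> ball p d"
    have "((\<lambda>q. f (q + cs (circlepath 0 \<rho> x) v)) has_derivative
        (\<lambda>u. dd u f (q + cs (circlepath 0 \<rho> x) v))) (at q within ball p d)"
      using has_derivative_compose[OF shift chol_has_derivative(1)[OF f inU[OF q]]] .
    then show "((\<lambda>x'. F x' x) has_derivative blinfun_apply (F' q x)) (at q within ball p d)"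
      unfolding F'_app[OF q] F_def by (rule has_derivative_mult_left)
  next
    fix q assume q: "q \<in> ball p d"
    show "F q integrable_on cbox 0 1" unfolding F_def
      by (intro integrable_continuous continuous_on_mult continuous_on_compose_line[OF chol_continuous_on[OF f]]
          continuous_on_cauchy_kernel[OF d(2)] continuous_on_circle continuous_on_id continuous_on_const) (use inU[OF q] in auto)
  next
    have "continuous_on (ball p d \<times> cbox 0 1) (\<lambda>z. F' (fst z) (snd z))"
    proof (rule continuous_on_blinfun_componentwise)
      fix i :: 'a assume "i \<in> Basis"
      have "continuous_on (ball p d \<times> cbox 0 1) (\<lambda>z. dd i f (fst z + cs (circlepath 0 \<rho> (snd z)) v) * cauchy_kernel \<rho> (snd z))"
        by (intro continuous_on_mult continuous_on_compose_line[OF dd_continuous_on[OF f U]] continuous_on_cauchy_kernel[OF d(2)]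
            continuous_on_circle continuous_on_fst continuous_on_snd continuous_on_id) (use inU in auto)
      then show "continuous_on (ball p d \<times> cbox 0 1) (\<lambda>z. blinfun_apply (F' (fst z) (snd z)) i)"
        by (rule continuous_on_eq) (auto simp: F'_app)
    qed
    then show "continuous_on (ball p d \<times> cbox 0 1) (\<lambda>(q, x). F' q x)"
      by (simp add: case_prod_unfold)
  qed (use d(1) in \<open>simp_all\<close>)
  then have D0: "((\<lambda>q. integral (cbox 0 1) (F q)) has_derivative integral (cbox 0 1) (F' p)) (at p)"
    using at_within_open[OF _ open_ball, of p p d] d(1) by simp
  have eq: "dd v f q = integral (cbox 0 1) (F q)" if "q \<in> ball p d" for q
    unfolding F_def by (rule dd_as_integral[OF f d(2) d(3)[OF that]])
  have p: "p \<in> ball p d" using d by simp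
  have D: "(dd v f has_derivative integral (cbox 0 1) (F' p)) (at p)"
    by (rule has_derivative_transform_within_open[OF D0 open_ball p]) (simp add: eq)
  have "continuous_on (cbox 0 1) (F' p)"
  proof (rule continuous_on_blinfun_componentwise)
    fix i :: 'a
    show "continuous_on (cbox 0 1) (\<lambda>x. blinfun_apply (F' p x) i)"
      unfolding F'_app[OF p]
      by (intro continuous_on_mult continuous_on_compose_line[OF dd_continuous_on[OF f U]] continuous_on_cauchy_kernel[OF d(2)]
          continuous_on_circle continuous_on_id continuous_on_const) (use inU[OF p] in auto)
  qed
  then have int: "F' p integrable_on cbox 0 1" by (rule integrable_continuous)
  \<comment> \<open>Evaluation at a fixed vector is bounded linear, so it passes through the
    integral and complex linearity can be checked pointwise in \<open>x\<close>.\<close>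
  have app: "blinfun_apply (integral (cbox 0 1) (F' p)) u = integral (cbox 0 1) (\<lambda>x. F' p x u)" for u
    using integral_linear[OF int, of "\<lambda>B. blinfun_apply B u"]
    by (simp add: o_def bounded_bilinear.bounded_linear_left[OF bounded_bilinear_blinfun_apply])
  have "blinfun_apply (integral (cbox 0 1) (F' p)) (cs c u) = c * blinfun_apply (integral (cbox 0 1) (F' p)) u" for c u
    unfolding app F'_app[OF p] using chol_has_derivative(2)[OF f inU[OF p]] by (simp add: mult.assoc)
  with D show "\<exists>D. (dd v f has_derivative D) (at p) \<and> (\<forall>c v. D (cs c v) = c * D v)"
    by blast
qed

section \<open>Arithmetic of holomorphic functions\<close>

lemma chol_const: "chol (\<lambda>_. k) U"
  by (rule cholI[where D = "\<lambda>_ _. 0"]) (auto intro!: derivative_eq_intros)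

lemma chol_add:
  assumes "chol f U" "chol g U" shows "chol (\<lambda>p. f p + g p) U"
proof (rule cholI)
  fix p assume p: "p \<in> U"
  show "((\<lambda>p. f p + g p) has_derivative (\<lambda>v. dd v f p + dd v g p)) (at p)"
    by (rule has_derivative_add[OF chol_has_derivative(1)[OF assms(1) p] chol_has_derivative(1)[OF assms(2) p]])
  show "dd (cs c v) f p + dd (cs c v) g p = c * (dd v f p + dd v g p)" for c v
    using chol_has_derivative(2)[OF assms(1) p] chol_has_derivative(2)[OF assms(2) p] by (simp add: distrib_left)
qed

lemma chol_mult:
  assumes "chol f U" "chol g U" shows "chol (\<lambda>p. f p * g p) U"
proof (rule cholI)
  fix p assume p: "p \<in> U"
  show "((\<lambda>p. f p * g p) has_derivative (\<lambda>v. f p * dd v g p + dd v f p * g p)) (at p)"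
    by (rule has_derivative_mult[OF chol_has_derivative(1)[OF assms(1) p] chol_has_derivative(1)[OF assms(2) p]])
  show "f p * dd (cs c v) g p + dd (cs c v) f p * g p = c * (f p * dd v g p + dd v f p * g p)" for c v
    using chol_has_derivative(2)[OF assms(1) p] chol_has_derivative(2)[OF assms(2) p] by (simp add: algebra_simps)
qed

lemma chol_minus:
  assumes "chol f U" shows "chol (\<lambda>p. - f p) U"
  using chol_mult[OF chol_const[of "-1"] assms] by simp

lemma chol_diff:
  assumes "chol f U" "chol g U" shows "chol (\<lambda>p. f p - g p) U"
  using chol_add[OF assms(1) chol_minus[OF assms(2)]] by simp

end

section \<open>Weighted homogeneous components\<close>

lemma bounded_bilinear_vector_smult: "bounded_bilinear ((*s) :: complex \<Rightarrow> complex ^ 'm::finite \<Rightarrow> _)"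
  unfolding bilinear_conv_bounded_bilinear[symmetric] bilinear_def
  by (auto intro!: linearI simp: vec_eq_iff algebra_simps)

lemma cscale_apply: "cscale c p = (c * fst p, c *s fst (snd p), c * snd (snd p))"
  by (simp add: cscale_def case_prod_unfold)

lemma complex_scaling_cscale: "complex_scaling (cscale :: complex \<Rightarrow> 'm::finite cspace \<Rightarrow> _)"
  unfolding complex_scaling_def
proof (intro conjI allI)
  show "bounded_bilinear (cscale :: complex \<Rightarrow> 'm cspace \<Rightarrow> 'm cspace)"
    unfolding bilinear_conv_bounded_bilinear[symmetric] bilinear_def cscale_apply
    by (auto intro!: linearI simp: vec_eq_iff algebra_simps)
qed (auto simp: cscale_apply vec_eq_iff)

interpretation cspace: complex_scaling "cscale :: complex \<Rightarrow> 'm::finite cspace \<Rightarrow> 'm cspace"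
  by (rule complex_scaling_cscale)

definition cscale2 :: "complex \<Rightarrow> complex \<times> 'm::finite cspace \<Rightarrow> complex \<times> 'm cspace" where
  "cscale2 c q = (c * fst q, cscale c (snd q))"

lemma complex_scaling_cscale2:
  "complex_scaling (cscale2 :: complex \<Rightarrow> complex \<times> 'm::finite cspace \<Rightarrow> _)"
  unfolding complex_scaling_def
proof (intro conjI allI)
  show "bounded_bilinear (cscale2 :: complex \<Rightarrow> complex \<times> 'm cspace \<Rightarrow> _)"
    unfolding bilinear_conv_bounded_bilinear[symmetric] bilinear_def cscale_apply cscale2_def
    by (auto intro!: linearI simp: vec_eq_iff algebra_simps)
qed (auto simp: cscale_apply cscale2_def vec_eq_iff)

interpretation cspace2: complex_scaling "cscale2 :: complex \<Rightarrow> complex \<times> 'm::finite cspace \<Rightarrow> _"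
  by (rule complex_scaling_cscale2)

lemma cscale2_fst: "cscale2 \<tau> (1, 0) = (\<tau>, 0)"
  by (simp add: cscale2_def)

section \<open>Weighted dilations and Taylor expansion along their orbits\<close>

definition dil :: "complex \<Rightarrow> 'm::finite cspace \<Rightarrow> 'm cspace" where
  "dil t p = (t\<^sup>2 * fst p, t *s fst (snd p), snd (snd p))"

lemma dil_dil: "dil t (dil s p) = dil (t * s) p"
  by (simp add: dil_def vec_eq_iff power_mult_distrib mult.assoc)

lemma dil_one [simp]: "dil 1 p = p"
  by (simp add: dil_def)

lemma dil_has_derivative:
  "((\<lambda>q. dil (fst q) (snd q)) has_derivative
    (\<lambda>v. (2 * fst q * fst v * fst (snd q) + (fst q)\<^sup>2 * fst (snd v),
         fst q *s fst (snd (snd v)) + fst v *s fst (snd (snd q)), snd (snd (snd v))))) (at q)"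
  unfolding dil_def
proof (intro has_derivative_Pair)
  show "((\<lambda>q. (fst q)\<^sup>2 * fst (snd q)) has_derivative
      (\<lambda>v. 2 * fst q * fst v * fst (snd q) + (fst q)\<^sup>2 * fst (snd v))) (at q)"
    by (auto intro!: derivative_eq_intros simp: algebra_simps)
  show "((\<lambda>q. fst q *s fst (snd (snd q))) has_derivative
      (\<lambda>v. fst q *s fst (snd (snd v)) + fst v *s fst (snd (snd q)))) (at q)"
    by (rule bounded_bilinear.FDERIV[OF bounded_bilinear_vector_smult]) (auto intro!: derivative_eq_intros)
qed (auto intro!: derivative_eq_intros)

lemma open_dil_vimage:
  assumes "open U"
  shows "open {q :: complex \<times> 'm::finite cspace. dil (fst q) (snd q) \<in> U}"
proof -
  have "continuous_on UNIV (\<lambda>q :: complex \<times> 'm cspace. dil (fst q) (snd q))"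
    by (intro continuous_at_imp_continuous_on ballI has_derivative_continuous[OF dil_has_derivative])
  then show ?thesis using assms open_vimage by (fastforce simp: vimage_def)
qed

lemma open_dil_param: "open U \<Longrightarrow> open {t. dil t p \<in> U}"
proof -
  assume "open U"
  have "continuous_on UNIV (\<lambda>t. dil t p)"
    unfolding dil_def
    by (intro continuous_intros bounded_bilinear.continuous_on[OF bounded_bilinear_vector_smult])
  then show ?thesis using \<open>open U\<close> using open_vimage by (fastforce simp: vimage_def)
qed

text \<open>The dilation parameter and the point are kept together: holomorphy in the point at
  parameter 0, which is what \<open>wpart\<close> needs, is a special case of joint
  holomorphy.\<close>

definition taylor_fn :: "('m::finite cspace \<Rightarrow> complex) \<Rightarrow> nat \<Rightarrow> complex \<times> 'm cspace \<Rightarrow> complex" where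
  "taylor_fn f m q = (deriv ^^ m) (\<lambda>t. f (dil t (snd q))) (fst q)"

lemma chol_taylor_fn:
  assumes f: "cspace.chol f U" and U: "open U"
  shows "cspace2.chol (taylor_fn f m) {q. dil (fst q) (snd q) \<in> U}"
proof (induction m)
  case 0
  show ?case
  proof (rule cspace2.cholI)
    fix q :: "complex \<times> 'a cspace" assume q: "q \<in> {q. dil (fst q) (snd q) \<in> U}"
    let ?D = "\<lambda>v. cspace.dd (2 * fst q * fst v * fst (snd q) + (fst q)\<^sup>2 * fst (snd v),
         fst q *s fst (snd (snd v)) + fst v *s fst (snd (snd q)), snd (snd (snd v))) f (dil (fst q) (snd q))"
    show "(taylor_fn f 0 has_derivative ?D) (at q)"
      using has_derivative_compose[OF dil_has_derivative cspace.chol_has_derivative(1)[OF f]] q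
      by (simp add: taylor_fn_def[abs_def])
    show "?D (cscale2 c v) = c * ?D v" for c v
    proof -
      have "(2 * fst q * fst (cscale2 c v) * fst (snd q) + (fst q)\<^sup>2 * fst (snd (cscale2 c v)),
         fst q *s fst (snd (snd (cscale2 c v))) + fst (cscale2 c v) *s fst (snd (snd q)), snd (snd (snd (cscale2 c v))))
        = cscale c (2 * fst q * fst v * fst (snd q) + (fst q)\<^sup>2 * fst (snd v),
         fst q *s fst (snd (snd v)) + fst v *s fst (snd (snd q)), snd (snd (snd v)))"
        by (simp add: cscale2_def cscale_apply vec_eq_iff algebra_simps)
      then show ?thesis using cspace.chol_has_derivative(2)[OF f] q by simp
    qed
  qed
next
  case (Suc m)
  \<comment> \<open>One more derivative in the dilation parameter is a directional derivative along
    \<open>(1, 0)\<close>, and these stay holomorphic by \<open>chol_dd\<close>.\<close>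
  have "taylor_fn f (Suc m) = cspace2.dd (1, 0) (taylor_fn f m)"
  proof
    fix q :: "complex \<times> 'a cspace"
    have "cspace2.dd (1, 0) (taylor_fn f m) q = deriv (\<lambda>\<tau>. taylor_fn f m (q + cscale2 \<tau> (1, 0))) 0"
      by (rule cspace2.dd_def)
    also have "\<dots> = deriv (\<lambda>\<tau>. taylor_fn f m (fst q + \<tau>, snd q)) 0"
      by (cases q) (simp only: cscale2_fst fst_conv snd_conv add_Pair add_0_right)
    also have "\<dots> = deriv ((deriv ^^ m) (\<lambda>t. f (dil t (snd q)))) (fst q)"
      using deriv_shift_0[of "(deriv ^^ m) (\<lambda>t. f (dil t (snd q)))" "fst q"]
      by (simp add: taylor_fn_def o_def)
    finally show "taylor_fn f (Suc m) q = cspace2.dd (1, 0) (taylor_fn f m) q"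
      by (simp add: taylor_fn_def)
  qed
  then show ?case using cspace2.chol_dd[OF Suc open_dil_vimage[OF U]] by simp
qed

text \<open>Only the germ of \<open>f\<close> at \<open>(0, 0, \<zeta>)\<close> enters, so this
  makes sense for all \<open>w\<close> and \<open>z\<close> even where \<open>f\<close> does not.
  The value 0 for negative \<open>k\<close> lets the three components of a field, of weights
  \<open>k + 2\<close>, \<open>k + 1\<close>, \<open>k\<close>, be treated uniformly.\<close>

definition wpart :: "int \<Rightarrow> ('m::finite cspace \<Rightarrow> complex) \<Rightarrow> 'm cspace \<Rightarrow> complex" where
  "wpart k f p = (if k < 0 then 0 else (deriv ^^ nat k) (\<lambda>t. f (dil t p)) 0 / fact (nat k))"

definition tube :: "real \<Rightarrow> 'm::finite cspace set" where
  "tube r = {p. norm (snd (snd p)) < r}"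

text \<open>The exclusion of \<open>t = 0\<close> accommodates negative weights.\<close>

definition whom :: "real \<Rightarrow> int \<Rightarrow> ('m::finite cspace \<Rightarrow> complex) \<Rightarrow> bool" where
  "whom r k f \<longleftrightarrow> (\<forall>p\<in>tube r. \<forall>t. t \<noteq> 0 \<longrightarrow> f (dil t p) = t powi k * f p)"

lemma open_tube: "open (tube r)"
  unfolding tube_def by (intro open_Collect_less continuous_intros)

lemma dil_in_tube [simp]: "dil t p \<in> tube r \<longleftrightarrow> p \<in> tube r"
  by (simp add: tube_def dil_def)

lemma dil_zero: "dil 0 p = (0, 0, snd (snd p))"
  by (simp add: dil_def vec_eq_iff)

lemma chol_wpart:
  fixes f :: "'m::finite cspace \<Rightarrow> complex"
  assumes f: "cspace.chol f U" and U: "open U" and r: "\<And>\<zeta>. norm \<zeta> < r \<Longrightarrow> (0, 0, \<zeta>) \<in> U"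
  shows "cspace.chol (wpart k f) (tube r)"
proof (cases "k < 0")
  case True
  then show ?thesis using cspace.chol_const[of 0] by (simp add: wpart_def[abs_def])
next
  case False
  show ?thesis
  proof (rule cspace.cholI)
    fix p :: "'m cspace" assume p: "p \<in> tube r"
    then have q: "(0, p) \<in> {q. dil (fst q) (snd q) \<in> U}" using r by (simp add: dil_zero tube_def)
    note T = cspace2.chol_has_derivative[OF chol_taylor_fn[OF f U, of "nat k"] q]
    let ?D = "\<lambda>v. cspace2.dd (0, v) (taylor_fn f (nat k)) (0, p) / fact (nat k)"
    have "((\<lambda>p. taylor_fn f (nat k) (0, p)) has_derivative (\<lambda>v. cspace2.dd (0, v) (taylor_fn f (nat k)) (0, p))) (at p)"
      using has_derivative_compose[of "\<lambda>p. (0, p)" "\<lambda>v. (0, v)" p UNIV, OF _ T(1)]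
      by (simp add: has_derivative_Pair)
    then have "((\<lambda>p. taylor_fn f (nat k) (0, p) / fact (nat k)) has_derivative ?D) (at p)"
      by (auto intro!: derivative_eq_intros)
    moreover have "wpart k f = (\<lambda>p. taylor_fn f (nat k) (0, p) / fact (nat k))"
      using False by (auto simp: wpart_def taylor_fn_def)
    ultimately show "(wpart k f has_derivative ?D) (at p)" by simp
    show "?D (cscale c v) = c * ?D v" for c v
      using T(2)[of c "(0, v)"] by (simp add: cscale2_def mult.assoc)
  qed
qed

lemma dil_line_holomorphic:
  assumes f: "cspace.chol f U" and U: "open U"
  shows "(\<lambda>t. f (dil t p)) holomorphic_on {t. dil t p \<in> U}"
  unfolding holomorphic_on_open[OF open_dil_param[OF U]]
proof safe
  fix t assume "dil t p \<in> U"
  then have "((\<lambda>\<tau>. taylor_fn f 0 ((0, p) + cscale2 \<tau> (1, 0))) has_field_derivative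
     cspace2.dd (1, 0) (taylor_fn f 0) ((0, p) + cscale2 t (1, 0))) (at t)"
    by (intro cspace2.chol_has_field_derivative[OF chol_taylor_fn[OF f U]])
      (simp add: cscale2_fst)
  then show "\<exists>f'. ((\<lambda>t. f (dil t p)) has_field_derivative f') (at t)"
    by (auto simp: taylor_fn_def cscale2_fst)
qed

lemma whom_wpart:
  assumes f: "cspace.chol f U" and U: "open U" and r: "\<And>\<zeta>. norm \<zeta> < r \<Longrightarrow> (0, 0, \<zeta>) \<in> U"
  shows "whom r k (wpart k f)"
  unfolding whom_def
proof (intro ballI allI impI)
  fix p :: "'a cspace" and s :: complex assume p: "p \<in> tube r" and "s \<noteq> 0"
  have "(deriv ^^ m) (\<lambda>t. f (dil t (dil s p))) 0 = s ^ m * (deriv ^^ m) (\<lambda>t. f (dil t p)) 0" for m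
  proof -
    have "(deriv ^^ m) (\<lambda>t. f (dil (s * t) p)) 0 = s ^ m * (deriv ^^ m) (\<lambda>t. f (dil t p)) (s * 0)"
      by (rule higher_deriv_compose_linear[OF dil_line_holomorphic[OF f U]
            open_dil_param[OF U, of "dil s p"] open_dil_param[OF U]])
        (use p r U in \<open>auto simp: dil_dil mult.commute dil_zero tube_def\<close>)
    then show ?thesis by (simp add: dil_dil mult.commute)
  qed
  then show "wpart k f (dil s p) = s powi k * wpart k f p"
    by (simp add: wpart_def power_int_def)
qed

text \<open>The radius 2 puts \<open>t = 1\<close>, where \<open>dil t p\<close> is
  \<open>p\<close>, inside the disc of convergence.\<close>

lemma wpart_sums:
  assumes f: "cspace.chol f U" and U: "open U" and p: "\<And>t. norm t < 2 \<Longrightarrow> dil t p \<in> U"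
  shows "(\<lambda>m. wpart (int m) f p) sums f p"
proof -
  have "(\<lambda>m. (deriv ^^ m) (\<lambda>t. f (dil t p)) 0 / fact m * (1 - 0) ^ m) sums f (dil 1 p)"
    by (rule holomorphic_power_series[where r = 2])
      (use p in \<open>auto intro: holomorphic_on_subset[OF dil_line_holomorphic[OF f U]]\<close>)
  then show ?thesis by (simp add: wpart_def)
qed

section \<open>Taylor coefficients of an identity between real parts\<close>

lemma higher_deriv_Re_zero:
  assumes "G holomorphic_on ball 0 R" "\<And>x::real. \<bar>x\<bar> < R \<Longrightarrow> Re (G (of_real x)) = 0" "\<bar>x\<bar> < R"
  shows "Re ((deriv ^^ m) G (of_real x)) = 0"
  using assms(3)
proof (induction m arbitrary: x)
  case 0
  then show ?case using assms by simp
next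
  case (Suc m)
  let ?g = "(deriv ^^ m) G"
  have "?g holomorphic_on ball 0 R" by (rule holomorphic_higher_deriv[OF assms(1)]) simp
  then have "(?g has_field_derivative deriv ?g (of_real x)) (at (of_real x))"
    using Suc.prems by (intro holomorphic_derivI[where S = "ball 0 R"]) auto
  then have "((\<lambda>x. ?g (of_real x)) has_vector_derivative deriv ?g (of_real x)) (at x)"
    by (rule has_vector_derivative_real_field)
  then have 1: "((\<lambda>x. Re (?g (of_real x))) has_real_derivative Re (deriv ?g (of_real x))) (at x)"
    unfolding has_real_derivative_iff_has_vector_derivative
    by (auto simp: has_vector_derivative_def dest: has_derivative_Re)
  have 2: "((\<lambda>x. Re (?g (of_real x))) has_real_derivative 0) (at x)"
    by (rule has_field_derivative_transform_within_open[OF DERIV_const[of 0], where S = "{-R<..<R}"])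
      (use Suc in auto)
  show ?case using DERIV_unique[OF 1 2] by simp
qed

lemma has_fps_expansion_sum:
  fixes f :: "'i \<Rightarrow> complex \<Rightarrow> complex"
  assumes "finite K" "\<And>j. j \<in> K \<Longrightarrow> f j has_fps_expansion F j"
  shows "(\<lambda>x. \<Sum>j\<in>K. f j x) has_fps_expansion (\<Sum>j\<in>K. F j)"
  using assms by (induction K rule: finite_induct) (auto intro!: fps_expansion_intros)

text \<open>The difference of the two sides is the real part, on the real axis, of a holomorphic
  function; differentiation along the real axis commutes with \<open>Re\<close>, so its Taylor
  coefficients have real part 0. The factors \<open>x\<close> and \<open>x\<^sup>2\<close> shift the
  index, and the zeros of \<open>cf\<close> at negative indices cover \<open>k + 2 = 0\<close> and
  \<open>k + 2 = 1\<close>.\<close>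

lemma Re_coeff_relation:
  fixes \<alpha> :: "'i \<Rightarrow> real"
  defines "cf \<equiv> \<lambda>k f. if k < 0 then 0 else (deriv ^^ nat k) f 0 / fact (nat k)"
  assumes K: "finite K" and R: "R > 0"
    and A: "A holomorphic_on ball 0 R" and B: "\<And>j. j \<in> K \<Longrightarrow> B j holomorphic_on ball 0 R"
    and C: "C holomorphic_on ball 0 R"
    and eq: "\<And>x::real. \<bar>x\<bar> < R \<Longrightarrow> Re (A (of_real x)) =
      (\<Sum>j\<in>K. \<alpha> j * x * Re (B j (of_real x))) + \<beta> * x\<^sup>2 * Re (C (of_real x))"
  shows "Re (cf (k + 2) A) = (\<Sum>j\<in>K. \<alpha> j * Re (cf (k + 1) (B j))) + \<beta> * Re (cf k C)"
proof (cases "k + 2 < 0")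
  case True
  then show ?thesis by (simp add: cf_def)
next
  case False
  define m where "m = nat (k + 2)"
  define G where "G = (\<lambda>x. A x - (\<Sum>j\<in>K. of_real (\<alpha> j) * (x * B j x)) - of_real \<beta> * (x ^ 2 * C x))"
  define F where "F = fps_expansion A 0 - (\<Sum>j\<in>K. fps_const (of_real (\<alpha> j)) * (fps_X * fps_expansion (B j) 0))
     - fps_const (of_real \<beta>) * (fps_X ^ 2 * fps_expansion C 0)"
  have exp: "f has_fps_expansion fps_expansion f 0" if "f holomorphic_on ball 0 R" for f
    using R by (intro has_fps_expansion_fps_expansion[OF _ _ that]) auto
  have "G has_fps_expansion F"
    unfolding G_def F_def using K
    by (intro has_fps_expansion_diff has_fps_expansion_sum has_fps_expansion_cmult_left
        has_fps_expansion_mult has_fps_expansion_fps_X has_fps_expansion_fps_X_power exp A B C)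
  then have "fps_nth F m = (deriv ^^ m) G 0 / fact m" by (rule fps_nth_fps_expansion)
  moreover have "G holomorphic_on ball 0 R"
    unfolding G_def using A B C by (intro holomorphic_intros) auto
  then have "Re ((deriv ^^ m) G (of_real 0)) = 0"
  proof (rule higher_deriv_Re_zero)
    fix x :: real assume "\<bar>x\<bar> < R"
    from eq[OF this] show "Re (G (of_real x)) = 0"
      unfolding G_def by (simp add: mult.assoc Re_power2)
  qed (use R in simp)
  moreover have "Re (z / fact m) = Re z / fact m" for z
    by (metis Re_divide_of_real of_real_fact)
  ultimately have "Re (fps_nth F m) = 0" by simp
  moreover have "fps_nth F m = cf (k + 2) A - (\<Sum>j\<in>K. of_real (\<alpha> j) * cf (k + 1) (B j)) - of_real \<beta> * cf k C"
  proof -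
    have 0: "fps_nth (fps_expansion f 0) n = cf (int n) f" for f n
      by (simp add: fps_expansion_def cf_def)
    have 1: "fps_nth (fps_X * fps_expansion f 0) m = cf (k + 1) f" for f
    proof -
      have "nat (k + 2) - Suc 0 = nat (k + 1)" by linarith
      then show ?thesis using False by (auto simp: m_def cf_def fps_expansion_def)
    qed
    have 2: "fps_nth (fps_X ^ 2 * fps_expansion f 0) m = cf k f" for f
    proof -
      have "nat (k + 2) - 2 = nat k" by linarith
      then show ?thesis using False by (auto simp: fps_X_power_mult_nth fps_expansion_def cf_def m_def)
    qed
    have 3: "fps_nth (fps_expansion f 0) m = cf (k + 2) f" for f
      using False by (simp add: 0 m_def)
    show ?thesis unfolding F_def by (simp only: fps_sub_nth fps_sum_nth fps_mult_left_const_nth 1 2 3)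
  qed
  ultimately show ?thesis by simp
qed

section \<open>Tangency to the hypersurface\<close>

locale model_hypersurface =
  fixes n :: nat and e :: "nat \<Rightarrow> 'm::finite"
  assumes n_gt: "n > 4" and bij: "bij_betw e {1..n - 1} (UNIV :: 'm set)"
begin

definition K :: "nat set" where "K = {1..n - 1}"

lemma finite_K [simp]: "finite K"
  by (simp add: K_def)

lemma K_iff: "j \<in> K \<longleftrightarrow> 0 < j \<and> j < n"
  using n_gt by (auto simp: K_def)

definition zc :: "nat \<Rightarrow> 'm cspace \<Rightarrow> complex" where
  "zc j p = fst (snd p) $ e j"

definition xr :: "'m cspace \<Rightarrow> nat \<Rightarrow> real" where
  "xr p j = Re (zc j p)"

text \<open>The coefficient of x_j x_k in the defining polynomial. The value 0 beyond
  \<open>j + k = n\<close> lets sums run over the square \<open>K \<times> K\<close> and lets an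
  index be shifted past the boundary.\<close>

definition pc :: "real \<Rightarrow> nat \<Rightarrow> nat \<Rightarrow> real" where
  "pc s j k = (if j + k \<le> n then s ^ (n - j - k) else 0)"

definition pc' :: "real \<Rightarrow> nat \<Rightarrow> nat \<Rightarrow> real" where
  "pc' s j k = (if j + k \<le> n then real (n - j - k) * s ^ (n - j - k - 1) else 0)"

text \<open>\<open>PD x s j\<close> and \<open>PS x s\<close> are the partial derivatives of \<open>PP x s\<close> in \<open>x\<^sub>j\<close> and \<open>s\<close>.\<close>

definition PP :: "(nat \<Rightarrow> real) \<Rightarrow> real \<Rightarrow> real" where
  "PP x s = (\<Sum>j\<in>K. \<Sum>k\<in>K. pc s j k * x j * x k)"

definition PD :: "(nat \<Rightarrow> real) \<Rightarrow> real \<Rightarrow> nat \<Rightarrow> real" where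
  "PD x s j = 2 * (\<Sum>k\<in>K. pc s j k * x k)"

definition PS :: "(nat \<Rightarrow> real) \<Rightarrow> real \<Rightarrow> real" where
  "PS x s = (\<Sum>j\<in>K. \<Sum>k\<in>K. pc' s j k * x j * x k)"

lemma pc_commute: "pc s j k = pc s k j"
  by (simp add: pc_def add.commute diff_right_commute)

lemma pc'_commute: "pc' s j k = pc' s k j"
  by (simp add: pc'_def add.commute diff_right_commute)

lemma M_iff: "p \<in> M\<^sub>0 n e \<longleftrightarrow> Re (fst p) = PP (xr p) (Re (snd (snd p)))"
proof -
  let ?S = "{(j, k). 0 < j \<and> j < j + k \<and> j + k \<le> n}"
  let ?x = "xr p" and ?s = "Re (snd (snd p))"
  have "(\<Sum>(j, k)\<in>?S. ?x j * ?x k * ?s ^ (n - j - k)) = (\<Sum>(j, k)\<in>K \<times> K. pc ?s j k * ?x j * ?x k)"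
    by (rule sum.mono_neutral_cong_left) (auto simp: pc_def K_iff split: if_splits)
  then have "PP ?x ?s = (\<Sum>(j, k)\<in>?S. ?x j * ?x k * ?s ^ (n - j - k))"
    by (simp add: PP_def sum.cartesian_product)
  then show ?thesis
    by (simp add: M\<^sub>0_def case_prod_unfold xr_def zc_def)
qed

definition dPhi :: "'m cspace \<Rightarrow> 'm cspace \<Rightarrow> real" where
  "dPhi p v = Re (fst v) - ((\<Sum>j\<in>K. PD (xr p) (Re (snd (snd p))) j * Re (zc j v)) +
     PS (xr p) (Re (snd (snd p))) * Re (snd (snd v)))"

lemma zc_has_derivative: "(zc j has_derivative zc j) F"
  unfolding zc_def[abs_def]
  by (intro bounded_linear_imp_has_derivative
      bounded_linear_compose[OF bounded_linear_vec_nth] bounded_linear_compose[OF bounded_linear_fst]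
      bounded_linear_snd)

lemma Phi_has_derivative:
  "((\<lambda>q. Re (fst q) - PP (xr q) (Re (snd (snd q)))) has_derivative dPhi p) (at p)"
proof -
  let ?s = "Re (snd (snd p))"
  have pow: "((\<lambda>q. pc (Re (snd (snd q))) j k) has_derivative (\<lambda>v. pc' ?s j k * Re (snd (snd v)))) (at p)" for j k
    unfolding pc_def pc'_def by (auto intro!: derivative_eq_intros)
  have x: "((\<lambda>q. xr q j) has_derivative (\<lambda>v. Re (zc j v))) (at p)" for j
    unfolding xr_def by (intro has_derivative_Re zc_has_derivative)
  have "((\<lambda>q. PP (xr q) (Re (snd (snd q)))) has_derivative
     (\<lambda>v. \<Sum>j\<in>K. \<Sum>k\<in>K. (pc ?s j k * xr p j) * Re (zc k v) +
        (pc ?s j k * Re (zc j v) + pc' ?s j k * Re (snd (snd v)) * xr p j) * xr p k)) (at p)"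
    unfolding PP_def by (intro has_derivative_sum has_derivative_mult pow x)
  moreover have "(\<Sum>j\<in>K. \<Sum>k\<in>K. (pc ?s j k * xr p j) * Re (zc k v) +
        (pc ?s j k * Re (zc j v) + pc' ?s j k * Re (snd (snd v)) * xr p j) * xr p k)
      = (\<Sum>j\<in>K. PD (xr p) ?s j * Re (zc j v)) + PS (xr p) ?s * Re (snd (snd v))" for v
  proof -
    have "(\<Sum>j\<in>K. \<Sum>k\<in>K. (pc ?s j k * xr p j) * Re (zc k v)) = (\<Sum>j\<in>K. \<Sum>k\<in>K. pc ?s j k * xr p k * Re (zc j v))"
      by (subst sum.swap) (simp add: pc_commute)
    then show ?thesis
      by (simp add: PD_def PS_def sum.distrib sum_distrib_left sum_distrib_right algebra_simps)
  qed
  ultimately show ?thesis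
    unfolding dPhi_def by (auto intro!: derivative_eq_intros)
qed

lemma tangent_iff:
  assumes p: "p \<in> M\<^sub>0 n e"
  shows "v \<in> tangent_at (M\<^sub>0 n e) p \<longleftrightarrow> dPhi p v = 0"
proof
  let ?Phi = "\<lambda>q. Re (fst q) - PP (xr q) (Re (snd (snd q)))"
  assume "v \<in> tangent_at (M\<^sub>0 n e) p"
  then obtain \<gamma> where \<gamma>: "\<gamma> (0::real) = p" "\<forall>\<^sub>F t in nhds 0. \<gamma> t \<in> M\<^sub>0 n e" "(\<gamma> has_vector_derivative v) (at 0)"
    unfolding tangent_at_def by blast
  have "((\<lambda>t. ?Phi (\<gamma> t)) has_derivative (\<lambda>t. dPhi p (t *\<^sub>R v))) (at 0)"
    using has_derivative_compose[OF \<gamma>(3)[unfolded has_vector_derivative_def] Phi_has_derivative] \<gamma>(1) by simp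
  moreover have "((\<lambda>t. ?Phi (\<gamma> t)) has_derivative (\<lambda>t. 0)) (at 0)"
  proof (rule has_derivative_transform_eventually[of "\<lambda>_. 0"])
    show "\<forall>\<^sub>F t in at 0. 0 = ?Phi (\<gamma> t)"
      using \<gamma>(2) unfolding eventually_at_filter by (rule eventually_mono) (simp add: M_iff)
    show "0 = ?Phi (\<gamma> 0)" using p \<gamma>(1) by (simp add: M_iff)
  qed auto
  ultimately have "(\<lambda>t. dPhi p (t *\<^sub>R v)) = (\<lambda>t. 0)"
    by (rule has_derivative_unique)
  then show "dPhi p v = 0" by (metis scaleR_one)
next
  let ?Phi = "\<lambda>q. Re (fst q) - PP (xr q) (Re (snd (snd q)))"
  assume v: "dPhi p v = 0"
  \<comment> \<open>The straight line is pushed back to the hypersurface along \<open>Re w\<close>,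
    in which the defining function has slope 1. The correction has derivative
    \<open>dPhi p v = 0\<close> at 0, so the velocity remains \<open>v\<close>.\<close>
  define \<gamma> where "\<gamma> = (\<lambda>t::real. p + t *\<^sub>R v - (of_real (?Phi (p + t *\<^sub>R v)), 0, 0))"
  have "\<gamma> t \<in> M\<^sub>0 n e" for t
    by (simp add: \<gamma>_def M_iff xr_def[abs_def] zc_def)
  moreover have "\<gamma> 0 = p" using p by (simp add: \<gamma>_def M_iff zero_prod_def[symmetric])
  moreover have "(\<gamma> has_vector_derivative v) (at 0)"
  proof -
    have l: "((\<lambda>t. p + t *\<^sub>R v) has_derivative (\<lambda>t. t *\<^sub>R v)) (at 0)"
      by (auto intro!: derivative_eq_intros)
    have "((\<lambda>t. ?Phi (p + t *\<^sub>R v)) has_derivative (\<lambda>t. dPhi p (t *\<^sub>R v))) (at 0)"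
      using has_derivative_compose[OF l Phi_has_derivative] by simp
    moreover have "dPhi p (t *\<^sub>R v) = t * dPhi p v" for t
      by (simp add: dPhi_def zc_def sum_distrib_left algebra_simps)
    ultimately have P: "((\<lambda>t. ?Phi (p + t *\<^sub>R v)) has_derivative (\<lambda>t. 0)) (at 0)" using v by simp
    have "(\<gamma> has_derivative (\<lambda>t. t *\<^sub>R v - (of_real 0, 0, 0))) (at 0)"
      unfolding \<gamma>_def
      by (intro has_derivative_diff l has_derivative_Pair has_derivative_of_real P has_derivative_const)
    then show ?thesis by (simp add: has_vector_derivative_def zero_prod_def[symmetric])
  qed
  ultimately show "v \<in> tangent_at (M\<^sub>0 n e) p"
    unfolding tangent_at_def by (auto intro!: exI[of _ \<gamma>])
qed

text \<open>Since \<open>\<partial>/\<partial>w\<close>, \<open>\<partial>/\<partial>z\<^sub>j\<close>, \<open>\<partial>/\<partial>\<zeta>\<close> have weights -2, -1, 0, the components of a field of weight \<open>k\<close> have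
  weights \<open>k + 2\<close>, \<open>k + 1\<close>, \<open>k\<close>.\<close>

definition graded_symmetry ::
  "real \<Rightarrow> int \<Rightarrow> ('m cspace \<Rightarrow> complex) \<Rightarrow> (nat \<Rightarrow> 'm cspace \<Rightarrow> complex) \<Rightarrow> ('m cspace \<Rightarrow> complex) \<Rightarrow> bool" where
  "graded_symmetry r k a b c \<longleftrightarrow>
     cspace.chol a (tube r) \<and> (\<forall>j\<in>K. cspace.chol (b j) (tube r)) \<and> cspace.chol c (tube r) \<and>
     whom r (k + 2) a \<and> (\<forall>j\<in>K. whom r (k + 1) (b j)) \<and> whom r k c \<and>
     (\<forall>p\<in>M\<^sub>0 n e \<inter> tube r. Re (a p) = (\<Sum>j\<in>K. PD (xr p) (Re (snd (snd p))) j * Re (b j p)) +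
        PS (xr p) (Re (snd (snd p))) * Re (c p))"

section \<open>Homogeneous parts and derivatives of symmetries\<close>

lemma xr_dil: "xr (dil (of_real t) p) j = t * xr p j"
  by (simp add: xr_def zc_def dil_def)

lemma snd_dil [simp]: "snd (snd (dil t p)) = snd (snd p)"
  by (simp add: dil_def)

lemma PP_dil: "PP (xr (dil (of_real t) p)) s = t\<^sup>2 * PP (xr p) s"
  by (simp add: PP_def xr_dil sum_distrib_left power2_eq_square mult_ac)

lemma PD_dil: "PD (xr (dil (of_real t) p)) s j = t * PD (xr p) s j"
  by (simp add: PD_def xr_dil sum_distrib_left mult_ac)

lemma PS_dil: "PS (xr (dil (of_real t) p)) s = t\<^sup>2 * PS (xr p) s"
  by (simp add: PS_def xr_dil sum_distrib_left power2_eq_square mult_ac)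

lemma dil_in_M: "p \<in> M\<^sub>0 n e \<Longrightarrow> dil (of_real t) p \<in> M\<^sub>0 n e"
  by (simp add: M_iff PP_dil) (simp add: dil_def Re_power2)

lemma holomorphic_vf_components:
  assumes X: "holomorphic_vf_on X U"
  shows "cspace.chol (\<lambda>p. fst (X p)) U" "cspace.chol (\<lambda>p. zc j (X p)) U" "cspace.chol (\<lambda>p. snd (snd (X p))) U"
proof -
  have "(\<exists>D. ((\<lambda>p. fst (X p)) has_derivative D) (at p) \<and> (\<forall>c v. D (cscale c v) = c * D v)) \<and>
    (\<exists>D. ((\<lambda>p. zc j (X p)) has_derivative D) (at p) \<and> (\<forall>c v. D (cscale c v) = c * D v)) \<and>
    (\<exists>D. ((\<lambda>p. snd (snd (X p))) has_derivative D) (at p) \<and> (\<forall>c v. D (cscale c v) = c * D v))"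
    if "p \<in> U" for p
  proof -
    from X that obtain D where D: "(X has_derivative D) (at p)" "\<And>c v. D (cscale c v) = cscale c (D v)"
      unfolding holomorphic_vf_on_def by blast
    show ?thesis
    proof (intro conjI exI)
      show "((\<lambda>p. fst (X p)) has_derivative (\<lambda>v. fst (D v))) (at p)"
        by (rule has_derivative_fst[OF D(1)])
      show "((\<lambda>p. zc j (X p)) has_derivative (\<lambda>v. zc j (D v))) (at p)"
        by (rule has_derivative_compose[OF D(1) zc_has_derivative])
      show "((\<lambda>p. snd (snd (X p))) has_derivative (\<lambda>v. snd (snd (D v)))) (at p)"
        by (intro has_derivative_snd D(1))
    qed (simp_all only: D(2), simp_all add: cscale_apply zc_def)
  qed
  then show "cspace.chol (\<lambda>p. fst (X p)) U" "cspace.chol (\<lambda>p. zc j (X p)) U" "cspace.chol (\<lambda>p. snd (snd (X p))) U"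
    unfolding cspace.chol_def by blast+
qed

text \<open>A real dilation maps the hypersurface into itself and scales \<open>PD\<close> by t and
  \<open>PS\<close> by t^2. On the orbit of a fixed point the tangency equation is thus an identity
  in t of the form treated by \<open>Re_coeff_relation\<close>.\<close>

lemma graded_symmetry_wpart:
  assumes X: "holomorphic_vf_on X U" and U: "open U" and r: "\<And>\<zeta>. norm \<zeta> < r \<Longrightarrow> (0, 0, \<zeta>) \<in> U"
    and tan: "\<And>p. p \<in> M\<^sub>0 n e \<inter> U \<Longrightarrow> X p \<in> tangent_at (M\<^sub>0 n e) p"
  shows "graded_symmetry r k (wpart (k + 2) (\<lambda>p. fst (X p))) (\<lambda>j. wpart (k + 1) (\<lambda>p. zc j (X p)))
    (wpart k (\<lambda>p. snd (snd (X p))))"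
proof -
  note C = holomorphic_vf_components[OF X]
  have "Re (wpart (k + 2) (\<lambda>p. fst (X p)) p) =
      (\<Sum>j\<in>K. PD (xr p) (Re (snd (snd p))) j * Re (wpart (k + 1) (\<lambda>p. zc j (X p)) p)) +
        PS (xr p) (Re (snd (snd p))) * Re (wpart k (\<lambda>p. snd (snd (X p))) p)"
    if p: "p \<in> M\<^sub>0 n e" "p \<in> tube r" for p
  proof -
    have "0 \<in> {t. dil t p \<in> U}" using p r by (simp add: dil_zero tube_def)
    then obtain R where R: "R > 0" "ball 0 R \<subseteq> {t. dil t p \<in> U}"
      using open_dil_param[OF U] open_contains_ball by blast
    note hol = holomorphic_on_subset[OF dil_line_holomorphic[OF _ U] R(2)]
    show ?thesis
      unfolding wpart_def
    proof (rule Re_coeff_relation[OF _ R(1) hol[OF C(1)] hol[OF C(2)] hol[OF C(3)]])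
      fix x :: real assume "\<bar>x\<bar> < R"
      then have "complex_of_real x \<in> ball 0 R" by simp
      then have "dil (of_real x) p \<in> U" using R(2) by blast
      then have "dPhi (dil (of_real x) p) (X (dil (of_real x) p)) = 0"
        using tan tangent_iff dil_in_M[OF p(1)] by blast
      then show "Re (fst (X (dil (complex_of_real x) p))) =
         (\<Sum>j\<in>K. PD (xr p) (Re (snd (snd p))) j * x * Re (zc j (X (dil (complex_of_real x) p)))) +
         PS (xr p) (Re (snd (snd p))) * x\<^sup>2 * Re (snd (snd (X (dil (complex_of_real x) p))))"
        by (simp add: dPhi_def PD_dil PS_dil mult_ac)
    qed simp
  qed
  then show ?thesis
    unfolding graded_symmetry_def
    using chol_wpart[OF C(1) U r] chol_wpart[OF C(2) U r] chol_wpart[OF C(3) U r]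
      whom_wpart[OF C(1) U r] whom_wpart[OF C(2) U r] whom_wpart[OF C(3) U r] by blast
qed

text \<open>Dilations multiply the direction \<open>v\<close> by \<open>t ^ m\<close>, which the
  chain rule takes off the weight. Without a \<open>\<zeta>\<close>-component, the complex line
  through \<open>p\<close> stays in the tube.\<close>

lemma whom_dd:
  fixes v :: "'m cspace"
  assumes f: "cspace.chol f (tube r)" "whom r k f"
    and v: "\<And>t. dil t v = cscale (t ^ m) v" "snd (snd v) = 0"
  shows "whom r (k - int m) (cspace.dd v f)"
  unfolding whom_def
proof (intro ballI allI impI)
  fix p :: "'m cspace" and t :: complex assume p: "p \<in> tube r" and t: "t \<noteq> 0"
  have line: "p + cscale \<tau> v \<in> tube r" for \<tau>
    using p v(2) by (simp add: tube_def cscale_apply)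
  have dil_line: "dil t (p + cscale \<tau> v) = dil t p + cscale \<tau> (cscale (t ^ m) v)" for \<tau>
  proof -
    have "dil t (p + cscale \<tau> v) = dil t p + cscale \<tau> (dil t v)"
      using v(2) by (simp add: dil_def cscale_apply vec_eq_iff prod_eq_iff algebra_simps)
    then show ?thesis by (simp add: v(1))
  qed
  have "((\<lambda>\<tau>. f (dil t p + cscale \<tau> (cscale (t ^ m) v))) has_field_derivative
      cspace.dd (cscale (t ^ m) v) f (dil t p + cscale 0 (cscale (t ^ m) v))) (at 0)"
    by (rule cspace.chol_has_field_derivative[OF f(1)]) (use p in simp)
  then have 1: "((\<lambda>\<tau>. f (dil t p + cscale \<tau> (cscale (t ^ m) v))) has_field_derivative
      t ^ m * cspace.dd v f (dil t p)) (at 0)"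
    using cspace.chol_has_derivative(2)[OF f(1)] p by simp
  have "((\<lambda>\<tau>. f (p + cscale \<tau> v)) has_field_derivative cspace.dd v f (p + cscale 0 v)) (at 0)"
    by (rule cspace.chol_has_field_derivative[OF f(1)]) (use p in simp)
  then have 2: "((\<lambda>\<tau>. t powi k * f (p + cscale \<tau> v)) has_field_derivative t powi k * cspace.dd v f p) (at 0)"
    by (auto intro!: derivative_eq_intros)
  have "f (dil t p + cscale \<tau> (cscale (t ^ m) v)) = t powi k * f (p + cscale \<tau> v)" for \<tau>
    using f(2) line t unfolding whom_def by (simp flip: dil_line)
  then have "t ^ m * cspace.dd v f (dil t p) = t powi k * cspace.dd v f p"
    using DERIV_unique[OF 1] 2 by simp
  then show "cspace.dd v f (dil t p) = t powi (k - int m) * cspace.dd v f p"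
    using t by (simp add: power_int_diff field_simps)
qed

text \<open>Translation by real multiples of \<open>v\<close> changes neither the real parts of
  \<open>w\<close> and the \<open>z_j\<close> nor \<open>\<zeta>\<close>, so it preserves the
  hypersurface and the factors \<open>PD\<close> and \<open>PS\<close>. Differentiating the tangency
  equation along it is the bracket with the constant field \<open>v\<close>.\<close>

lemma graded_symmetry_dd:
  assumes X: "graded_symmetry r k a b c"
    and v: "\<And>t. dil t v = cscale (t ^ m) v" "snd (snd v) = 0" "Re (fst v) = 0" "\<And>j. xr v j = 0"
  shows "graded_symmetry r (k - int m) (cspace.dd v a) (\<lambda>j. cspace.dd v (b j)) (cspace.dd v c)"
proof -
  have tan: "\<forall>p\<in>M\<^sub>0 n e \<inter> tube r. Re (a p) = (\<Sum>j\<in>K. PD (xr p) (Re (snd (snd p))) j * Re (b j p)) +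
        PS (xr p) (Re (snd (snd p))) * Re (c p)"
    using X unfolding graded_symmetry_def by blast
  have "Re (cspace.dd v a p) = (\<Sum>j\<in>K. PD (xr p) (Re (snd (snd p))) j * Re (cspace.dd v (b j) p)) +
        PS (xr p) (Re (snd (snd p))) * Re (cspace.dd v c p)" if p: "p \<in> M\<^sub>0 n e" "p \<in> tube r" for p
  proof -
    define q where "q = (\<lambda>\<tau>::real. p + cscale (of_real \<tau>) v)"
    have xr: "xr (q \<tau>) = xr p" for \<tau>
      using v(4) by (auto simp: q_def xr_def zc_def cscale_apply)
    have z: "snd (snd (q \<tau>)) = snd (snd p)" for \<tau>
      using v(2) by (simp add: q_def cscale_apply)
    have tube: "q \<tau> \<in> tube r" for \<tau> using p(2) z by (simp add: tube_def)
    have M: "q \<tau> \<in> M\<^sub>0 n e" for \<tau>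
      using p(1) v(3) by (simp add: M_iff xr z) (simp add: q_def cscale_apply)
    have der: "((\<lambda>\<tau>. Re (f (q \<tau>))) has_real_derivative Re (cspace.dd v f p)) (at 0)"
      if "cspace.chol f (tube r)" for f
    proof -
      have "((\<lambda>\<tau>. f (p + cscale \<tau> v)) has_field_derivative cspace.dd v f (p + cscale 0 v)) (at 0)"
        by (rule cspace.chol_has_field_derivative[OF that]) (use p in simp)
      then have "((\<lambda>\<tau>. f (q \<tau>)) has_vector_derivative cspace.dd v f p) (at 0)"
        unfolding q_def using has_vector_derivative_real_field[of _ _ 0 UNIV] by simp
      then show ?thesis
        unfolding has_real_derivative_iff_has_vector_derivative
        by (auto simp: has_vector_derivative_def dest: has_derivative_Re)
    qed
    let ?s = "Re (snd (snd p))"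
    have 1: "((\<lambda>\<tau>. Re (a (q \<tau>))) has_real_derivative Re (cspace.dd v a p)) (at 0)"
      using der X unfolding graded_symmetry_def by blast
    have 2: "((\<lambda>\<tau>. (\<Sum>j\<in>K. PD (xr p) ?s j * Re (b j (q \<tau>))) + PS (xr p) ?s * Re (c (q \<tau>)))
       has_real_derivative (\<Sum>j\<in>K. PD (xr p) ?s j * Re (cspace.dd v (b j) p)) + PS (xr p) ?s * Re (cspace.dd v c p)) (at 0)"
      using X unfolding graded_symmetry_def
      by (intro DERIV_add DERIV_sum DERIV_cmult der) auto
    have "(\<lambda>\<tau>. Re (a (q \<tau>))) = (\<lambda>\<tau>. (\<Sum>j\<in>K. PD (xr p) ?s j * Re (b j (q \<tau>))) + PS (xr p) ?s * Re (c (q \<tau>)))"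
    proof
      fix \<tau>
      have "q \<tau> \<in> M\<^sub>0 n e \<inter> tube r" using M tube by blast
      then show "Re (a (q \<tau>)) = (\<Sum>j\<in>K. PD (xr p) ?s j * Re (b j (q \<tau>))) + PS (xr p) ?s * Re (c (q \<tau>))"
        unfolding xr[symmetric, of \<tau>] z[symmetric, of \<tau>] by (rule tan[THEN bspec])
    qed
    then show ?thesis using DERIV_unique[OF 1] 2 by simp
  qed
  moreover have eqs: "k - int m + 2 = k + 2 - int m" "k - int m + 1 = k + 1 - int m" by auto
  ultimately show ?thesis
    using X whom_dd[OF _ _ v(1,2)] cspace.chol_dd[OF _ open_tube]
    unfolding graded_symmetry_def eqs by blast
qed

end

section \<open>Symmetries of negative weight\<close>

text \<open>After the affine function is subtracted the real part is 0, so the complex derivative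
  vanishes and an imaginary constant is left.\<close>

lemma affine_if_Re_affine:
  assumes f: "f holomorphic_on ball 0 r" and "r > 0"
    and Re: "\<And>\<zeta>. norm \<zeta> < r \<Longrightarrow> Re (f \<zeta>) = \<alpha> + \<beta> * Re \<zeta>"
  shows "\<exists>\<gamma>::real. \<forall>\<zeta>. norm \<zeta> < r \<longrightarrow> f \<zeta> = of_real \<alpha> + of_real \<beta> * \<zeta> + \<i> * of_real \<gamma>"
proof -
  define g where "g = (\<lambda>\<zeta>. f \<zeta> - of_real \<alpha> - of_real \<beta> * \<zeta>)"
  have Re_g: "Re (g \<zeta>) = 0" if "norm \<zeta> < r" for \<zeta>
    using Re[OF that] by (simp add: g_def)
  have "g holomorphic_on ball 0 r"
    unfolding g_def by (intro holomorphic_intros f)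
  have "(g has_field_derivative 0) (at \<zeta>)" if \<zeta>: "norm \<zeta> < r" for \<zeta>
  proof -
    have D: "(g has_field_derivative deriv g \<zeta>) (at \<zeta>)"
      by (rule holomorphic_derivI[OF \<open>g holomorphic_on ball 0 r\<close>]) (use \<zeta> in auto)
    have "((\<lambda>\<zeta>. Re (g \<zeta>)) has_derivative (\<lambda>v. Re (deriv g \<zeta> * v))) (at \<zeta>)"
      using D unfolding has_field_derivative_def by (rule has_derivative_Re)
    moreover have "((\<lambda>\<zeta>. Re (g \<zeta>)) has_derivative (\<lambda>v. 0)) (at \<zeta>)"
      by (rule has_derivative_transform_within_open[OF has_derivative_const[of 0] open_ball[of 0 r]])
        (use \<zeta> Re_g in auto)
    ultimately have "(\<lambda>v. Re (deriv g \<zeta> * v)) = (\<lambda>v. 0)" by (rule has_derivative_unique)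
    then have "Re (deriv g \<zeta> * v) = 0" for v by meson
    from this[of 1] this[of \<i>] have "deriv g \<zeta> = 0" by (simp add: complex_eq_iff)
    then show ?thesis using D by simp
  qed
  then have "\<exists>c. \<forall>\<zeta>\<in>ball 0 r. g \<zeta> = c"
    by (intro has_field_derivative_zero_constant) (auto intro: has_field_derivative_at_within)
  then obtain c where c: "\<And>\<zeta>. norm \<zeta> < r \<Longrightarrow> g \<zeta> = c" by auto
  have "Re c = 0" using Re_g[of 0] c[of 0] \<open>r > 0\<close> by simp
  then have "c = \<i> * of_real (Im c)" by (simp add: complex_eq_iff)
  then have "f \<zeta> = of_real \<alpha> + of_real \<beta> * \<zeta> + \<i> * of_real (Im c)" if "norm \<zeta> < r" for \<zeta>
    using c[OF that] unfolding g_def by (simp add: algebra_simps)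
  then show ?thesis by blast
qed

text \<open>Both constants are the mixed second derivative. Integrating the first equation in
  \<open>\<tau>\<close> from 0 to 1 and differentiating the result in \<open>\<sigma>\<close> at 0
  compares them using first derivatives only.\<close>

lemma mixed_derivative_coeff:
  fixes \<phi> :: "complex \<Rightarrow> complex \<Rightarrow> complex"
  assumes 1: "\<And>\<tau> \<sigma>. ((\<lambda>\<tau>. \<phi> \<tau> \<sigma>) has_field_derivative \<alpha> + \<beta> * \<tau> + \<kappa> * \<sigma>) (at \<tau>)"
    and 2: "\<And>\<tau> \<sigma>. ((\<lambda>\<sigma>. \<phi> \<tau> \<sigma>) has_field_derivative \<psi> \<sigma> + \<mu> * \<tau>) (at \<sigma>)"
  shows "\<kappa> = \<mu>"
proof -
  define g where "g = (\<lambda>\<tau> \<sigma>. \<phi> \<tau> \<sigma> - (\<alpha> + \<kappa> * \<sigma>) * \<tau> - \<beta> * \<tau>\<^sup>2 / 2)"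
  have "((\<lambda>\<tau>. g \<tau> \<sigma>) has_field_derivative 0) (at \<tau>)" for \<tau> \<sigma>
    unfolding g_def by (auto intro!: derivative_eq_intros 1 simp: algebra_simps)
  then have "\<exists>c. \<forall>\<tau>\<in>UNIV. g \<tau> \<sigma> = c" for \<sigma>
    by (intro has_field_derivative_zero_constant) auto
  then have "g 1 \<sigma> = g 0 \<sigma>" for \<sigma> by (metis UNIV_I)
  then have eq: "\<phi> 1 = (\<lambda>\<sigma>. \<phi> 0 \<sigma> + (\<alpha> + \<kappa> * \<sigma>) + \<beta> / 2)"
    by (auto simp: g_def algebra_simps)
  have "(\<phi> 1 has_field_derivative \<psi> 0 + \<kappa>) (at 0)"
    unfolding eq using 2[of 0 0] by (auto intro!: derivative_eq_intros)
  moreover have "(\<phi> 1 has_field_derivative \<psi> 0 + \<mu>) (at 0)"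
    using 2[of 1 0] by simp
  ultimately show ?thesis using DERIV_unique by fastforce
qed

section \<open>Coordinates and weighted homogeneous functions on a tube\<close>

context model_hypersurface
begin

definition pt :: "complex \<Rightarrow> (nat \<Rightarrow> complex) \<Rightarrow> complex \<Rightarrow> 'm cspace" where
  "pt w z \<zeta> = (w, (\<chi> i. z (inv_into K e i)), \<zeta>)"

lemma bij_K: "inj_on e K" "e ` K = UNIV"
  using bij unfolding K_def[symmetric] by (auto simp: bij_betw_def)

lemma zc_pt [simp]: "j \<in> K \<Longrightarrow> zc j (pt w z \<zeta>) = z j"
  using bij_K by (simp add: pt_def zc_def)

lemma pt_simps [simp]: "fst (pt w z \<zeta>) = w" "snd (snd (pt w z \<zeta>)) = \<zeta>"
  by (simp_all add: pt_def)

lemma e_eq_iff: "j \<in> K \<Longrightarrow> k \<in> K \<Longrightarrow> e j = e k \<longleftrightarrow> j = k"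
  using bij_K by (auto simp: inj_on_def)

lemma cspace_eqI:
  assumes "fst p = fst q" "\<And>j. j \<in> K \<Longrightarrow> zc j p = zc j q" "snd (snd p) = snd (snd q)"
  shows "p = q"
proof -
  have "fst (snd p) $ i = fst (snd q) $ i" for i
    using bij_K(2) assms(2) by (metis UNIV_I imageE zc_def)
  then show ?thesis using assms(1,3) by (simp add: prod_eq_iff vec_eq_iff)
qed

abbreviation Ew :: "'m cspace" where "Ew \<equiv> (1, 0, 0)"
abbreviation Ez :: "nat \<Rightarrow> 'm cspace" where "Ez l \<equiv> (0, axis (e l) 1, 0)"

lemma zc_zero [simp]: "zc j (a, 0, b) = 0" "zc j 0 = 0"
  by (simp_all add: zc_def)

lemma zc_Ez: "j \<in> K \<Longrightarrow> l \<in> K \<Longrightarrow> zc j (Ez l) = (if j = l then 1 else 0)"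
  by (simp add: zc_def axis_def e_eq_iff)

lemma zc_add [simp]: "zc j (p + q) = zc j p + zc j q"
  by (simp add: zc_def)

lemma zc_cscale [simp]: "zc j (cscale c p) = c * zc j p"
  by (simp add: zc_def cscale_apply)

lemma cscale_simps [simp]: "fst (cscale c p) = c * fst p" "snd (snd (cscale c p)) = c * snd (snd p)"
  by (simp_all add: cscale_apply)

lemma zc_sum: "zc j (\<Sum>i\<in>A. f i) = (\<Sum>i\<in>A. zc j (f i))"
  by (induction A rule: infinite_finite_induct) auto

lemma isCont_dil_line:
  assumes "cspace.chol f (tube r)" "p \<in> tube r"
  shows "isCont (\<lambda>t. f (dil t p)) 0"
proof -
  have "(\<lambda>t. f (dil t p)) holomorphic_on UNIV"
    using dil_line_holomorphic[OF assms(1) open_tube, of p] assms(2) by simp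
  then show ?thesis
    by (meson UNIV_I holomorphic_on_imp_continuous_on continuous_on_eq_continuous_at open_UNIV)
qed

text \<open>Off \<open>t = 0\<close>, \<open>t ^ nat (- k) * f (dil t p)\<close> equals
  \<open>f p\<close>, yet it tends to 0: the orbit ends at a point of the tube, where
  \<open>f\<close> is continuous.\<close>

lemma whom_neg_eq_0:
  assumes "cspace.chol f (tube r)" "whom r k f" "k < 0" "p \<in> tube r"
  shows "f p = 0"
proof -
  note isCont_dil_line[OF assms(1,4)]
  moreover have "isCont (\<lambda>t::complex. t ^ nat (- k)) 0" by (intro continuous_intros)
  ultimately have "isCont (\<lambda>t. t ^ nat (- k) * f (dil t p)) 0"
    by (intro continuous_intros)
  then have 1: "((\<lambda>t. t ^ nat (- k) * f (dil t p)) \<longlongrightarrow> 0) (at 0)"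
    using \<open>k < 0\<close> by (simp add: isCont_def zero_power)
  have "t ^ nat (- k) * f (dil t p) = f p" if "t \<noteq> 0" for t
    using assms that by (simp add: whom_def power_int_def flip: power_mult_distrib)
  then have "((\<lambda>t. t ^ nat (- k) * f (dil t p)) \<longlongrightarrow> f p) (at 0)"
    by (intro tendsto_eventually) (auto simp: eventually_at_filter)
  then show ?thesis using 1 tendsto_unique[OF at_neq_bot] by blast
qed

lemma whom_0_eq:
  assumes "cspace.chol f (tube r)" "whom r 0 f" "p \<in> tube r"
  shows "f p = f (0, 0, snd (snd p))"
proof -
  note isCont_dil_line[OF assms(1,3)]
  then have 1: "((\<lambda>t. f (dil t p)) \<longlongrightarrow> f (dil 0 p)) (at 0)"
    by (simp add: isCont_def)
  have "f (dil t p) = f p" if "t \<noteq> 0" for t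
    using assms that by (simp add: whom_def)
  then have "((\<lambda>t. f (dil t p)) \<longlongrightarrow> f p) (at 0)"
    by (intro tendsto_eventually) (auto simp: eventually_at_filter)
  then show ?thesis using 1 tendsto_unique[OF at_neq_bot] dil_zero by metis
qed

lemma dd_linear: "cspace.chol f U \<Longrightarrow> p \<in> U \<Longrightarrow> linear (\<lambda>v. cspace.dd v f p)"
  using cspace.chol_has_derivative(1) has_derivative_linear by blast

text \<open>The derivative of \<open>f (dil t p) = t powi k * f p\<close> at \<open>t = 1\<close>;
  the factor 2 is the weight of \<open>w\<close>. For \<open>k \<noteq> 0\<close> it recovers
  \<open>f\<close> from its derivatives.\<close>

lemma whom_euler:
  assumes f: "cspace.chol f (tube r)" "whom r k f" and p: "p \<in> tube r"
  shows "of_int k * f p = 2 * fst p * cspace.dd Ew f p + (\<Sum>l\<in>K. zc l p * cspace.dd (Ez l) f p)"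
proof -
  note L = dd_linear[OF f(1) p]
  have "((\<lambda>t. dil t p) has_derivative (\<lambda>t. (2 * t * fst p, t *s fst (snd p), 0))) (at 1)"
    unfolding dil_def
    by (intro has_derivative_Pair bounded_linear_imp_has_derivative
       bounded_bilinear.bounded_linear_left[OF bounded_bilinear_vector_smult])
      (auto intro!: derivative_eq_intros)
  then have "((\<lambda>t. f (dil t p)) has_derivative (\<lambda>t. cspace.dd (2 * t * fst p, t *s fst (snd p), 0) f (dil 1 p))) (at 1)"
    by (rule has_derivative_compose) (use cspace.chol_has_derivative(1)[OF f(1), of "dil 1 p"] p in simp)
  moreover have "(2 * t * fst p, t *s fst (snd p), 0) = cscale t (2 * fst p, fst (snd p), 0)" for t
    by (simp add: cscale_apply mult_ac)
  ultimately have "((\<lambda>t. f (dil t p)) has_field_derivative cspace.dd (2 * fst p, fst (snd p), 0) f p) (at 1)"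
    using cspace.chol_has_derivative(2)[OF f(1) p]
    by (simp add: has_field_derivative_def mult.commute[of _ "cspace.dd _ f p"])
  moreover have "((\<lambda>t. t powi k * f p) has_field_derivative of_int k * f p) (at 1)"
    by (auto intro!: derivative_eq_intros)
  then have "((\<lambda>t. f (dil t p)) has_field_derivative of_int k * f p) (at 1)"
    by (rule has_field_derivative_transform_within_open[where S = "- {0}"])
      (use f(2) p in \<open>auto simp: whom_def\<close>)
  ultimately have "of_int k * f p = cspace.dd (2 * fst p, fst (snd p), 0) f p"
    using DERIV_unique by blast
  also have "(2 * fst p, fst (snd p), 0) = cscale (2 * fst p) Ew + (\<Sum>l\<in>K. cscale (zc l p) (Ez l))"
    (is "?u = ?v")
  proof (rule cspace_eqI)
    show "zc j ?u = zc j ?v" if "j \<in> K" for j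
      using that by (simp add: zc_sum zc_Ez if_distrib[of "(*) _"] cong: if_cong) (simp add: zc_def)
  qed (simp_all add: fst_sum snd_sum)
  also have "cspace.dd ?v f p = 2 * fst p * cspace.dd Ew f p + (\<Sum>l\<in>K. zc l p * cspace.dd (Ez l) f p)"
    using cspace.chol_has_derivative(2)[OF f(1) p] by (simp add: linear_add[OF L] linear_sum[OF L])
  finally show ?thesis .
qed

lemma zeta_line_holomorphic:
  assumes "cspace.chol f (tube r)"
  shows "(\<lambda>\<zeta>. f (0, 0, \<zeta>)) holomorphic_on ball 0 r"
  unfolding holomorphic_on_open[OF open_ball]
proof safe
  fix \<zeta> :: complex assume "\<zeta> \<in> ball 0 r"
  have "((\<lambda>\<tau>. f (0 + cscale \<tau> (0, 0, 1))) has_field_derivative cspace.dd (0, 0, 1) f (0 + cscale \<zeta> (0, 0, 1))) (at \<zeta>)"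
    by (rule cspace.chol_has_field_derivative[OF assms]) (use \<open>\<zeta> \<in> ball 0 r\<close> in \<open>simp add: tube_def\<close>)
  then show "\<exists>f'. ((\<lambda>\<zeta>. f (0, 0, \<zeta>)) has_field_derivative f') (at \<zeta>)" by (auto simp: cscale_apply)
qed

lemma mixed_dd_coeff:
  assumes f: "cspace.chol f (tube r)" and "r > 0" and uv: "snd (snd u) = 0" "snd (snd v) = 0"
    and 1: "\<And>\<tau> \<sigma>. cspace.dd u f (cscale \<tau> u + cscale \<sigma> v) = \<alpha> + \<beta> * \<tau> + \<kappa> * \<sigma>"
    and 2: "\<And>\<tau> \<sigma>. cspace.dd v f (cscale \<tau> u + cscale \<sigma> v) = \<psi> \<sigma> + \<mu> * \<tau>"
  shows "\<kappa> = \<mu>"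
proof (rule mixed_derivative_coeff)
  have tube: "cscale \<tau> u + cscale \<sigma> v \<in> tube r" for \<tau> \<sigma> using uv \<open>r > 0\<close> by (simp add: tube_def)
  show "((\<lambda>\<tau>. f (cscale \<tau> u + cscale \<sigma> v)) has_field_derivative \<alpha> + \<beta> * \<tau> + \<kappa> * \<sigma>) (at \<tau>)" for \<tau> \<sigma>
    using cspace.chol_has_field_derivative[OF f, of "cscale \<sigma> v" \<tau> u] tube[of \<tau> \<sigma>] 1[of \<tau> \<sigma>]
    by (simp add: add.commute)
  show "((\<lambda>\<sigma>. f (cscale \<tau> u + cscale \<sigma> v)) has_field_derivative \<psi> \<sigma> + \<mu> * \<tau>) (at \<sigma>)" for \<tau> \<sigma>
    using cspace.chol_has_field_derivative[OF f, of "cscale \<tau> u" \<sigma> v] tube[of \<tau> \<sigma>] 2[of \<tau> \<sigma>]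
    by simp
qed

section \<open>The tangency equation at points with real coordinates\<close>

lemma graded_symmetryD:
  assumes "graded_symmetry r k a b c"
  shows "cspace.chol a (tube r)" "\<And>j. j \<in> K \<Longrightarrow> cspace.chol (b j) (tube r)" "cspace.chol c (tube r)"
    "whom r (k + 2) a" "\<And>j. j \<in> K \<Longrightarrow> whom r (k + 1) (b j)" "whom r k c"
  using assms unfolding graded_symmetry_def by auto

lemma tangency:
  assumes "graded_symmetry r k a b c" "p \<in> M\<^sub>0 n e" "p \<in> tube r"
  shows "Re (a p) = (\<Sum>j\<in>K. PD (xr p) (Re (snd (snd p))) j * Re (b j p)) +
        PS (xr p) (Re (snd (snd p))) * Re (c p)"
  using assms unfolding graded_symmetry_def by blast

lemma PP_cong: "(\<And>j. j \<in> K \<Longrightarrow> x j = y j) \<Longrightarrow> PP x s = PP y s"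
  by (simp add: PP_def cong: sum.cong)

lemma PD_cong: "(\<And>j. j \<in> K \<Longrightarrow> x j = y j) \<Longrightarrow> PD x s = PD y s"
  by (auto simp: PD_def cong: sum.cong)

lemma PS_cong: "(\<And>j. j \<in> K \<Longrightarrow> x j = y j) \<Longrightarrow> PS x s = PS y s"
  by (simp add: PS_def cong: sum.cong)

text \<open>With the imaginary parts of \<open>w\<close> and the \<open>z_j\<close> set to 0, the
  vector \<open>x\<close> and the number \<open>\<zeta>\<close> remain free and \<open>w\<close> is
  dictated by the equation. Each use of tangency in weights -1 to 2 is an instance of this.\<close>

lemma tangency_real:
  fixes x :: "nat \<Rightarrow> real"
  assumes "graded_symmetry r k a b c" "norm \<zeta> < r"
  defines "p \<equiv> pt (of_real (PP x (Re \<zeta>))) (\<lambda>j. of_real (x j)) \<zeta>"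
  shows "Re (a p) = (\<Sum>j\<in>K. PD x (Re \<zeta>) j * Re (b j p)) + PS x (Re \<zeta>) * Re (c p)"
    "p \<in> tube r"
proof -
  have x: "xr p j = x j" if "j \<in> K" for j using that by (simp add: p_def xr_def)
  have z: "snd (snd p) = \<zeta>" by (simp add: p_def)
  show t: "p \<in> tube r" using assms(2) by (simp add: tube_def z)
  have "p \<in> M\<^sub>0 n e" using PP_cong[OF x] by (simp add: M_iff z) (simp add: p_def)
  from tangency[OF assms(1) this t]
  show "Re (a p) = (\<Sum>j\<in>K. PD x (Re \<zeta>) j * Re (b j p)) + PS x (Re \<zeta>) * Re (c p)"
    by (simp add: z PD_cong[OF x] PS_cong[OF x])
qed

lemma graded_symmetry_z:
  assumes "graded_symmetry r k a b c"
  shows "graded_symmetry r (k - 1) (cspace.dd (cscale \<i> (Ez l)) a) (\<lambda>j. cspace.dd (cscale \<i> (Ez l)) (b j))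
     (cspace.dd (cscale \<i> (Ez l)) c)"
  using graded_symmetry_dd[OF assms, of "cscale \<i> (Ez l)" 1]
  by (simp add: dil_def cscale_apply vec_eq_iff xr_def zc_def axis_def)

lemma graded_symmetry_w:
  assumes "graded_symmetry r k a b c"
  shows "graded_symmetry r (k - 2) (cspace.dd (cscale \<i> Ew) a) (\<lambda>j. cspace.dd (cscale \<i> Ew) (b j))
     (cspace.dd (cscale \<i> Ew) c)"
  using graded_symmetry_dd[OF assms, of "cscale \<i> Ew" 2]
  by (simp add: dil_def cscale_apply vec_eq_iff xr_def zc_def)

lemma dd_i: "cspace.chol f (tube r) \<Longrightarrow> p \<in> tube r \<Longrightarrow> cspace.dd (cscale \<i> v) f p = \<i> * cspace.dd v f p"
  by (rule cspace.chol_has_derivative(2))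

lemma dd_eqI:
  assumes "cspace.chol f (tube r)" "p \<in> tube r" "cspace.dd (cscale \<i> v) f p = x"
  shows "cspace.dd v f p = - \<i> * x"
  using dd_i[OF assms(1,2), of v] assms(3) by auto

section \<open>Weights -2 and -1\<close>

lemma graded_minus_2:
  assumes X: "graded_symmetry r (-2) a b c" and r: "r > 0"
  obtains \<alpha> :: real where "\<And>p. p \<in> tube r \<Longrightarrow> a p = \<i> * of_real \<alpha>"
proof -
  note D = graded_symmetryD[OF X]
  \<comment> \<open>The other components have negative weight and vanish, so tangency on the axis
    \<open>w = 0\<close>, \<open>z = 0\<close> reads \<open>Re a = 0\<close>.\<close>
  have "Re (a (0, 0, \<zeta>)) = 0 + 0 * Re \<zeta>" if "norm \<zeta> < r" for \<zeta>
  proof -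
    have p: "(0, 0, \<zeta>) \<in> tube r" using that by (simp add: tube_def)
    have "(0, 0, \<zeta>) \<in> M\<^sub>0 n e" by (simp add: M_iff PP_def xr_def)
    from tangency[OF X this p] show ?thesis
      using whom_neg_eq_0[OF D(2) D(5) _ p] whom_neg_eq_0[OF D(3) D(6) _ p] by simp
  qed
  from affine_if_Re_affine[OF zeta_line_holomorphic[OF D(1)] r this] obtain \<gamma> :: real
    where "\<And>\<zeta>. norm \<zeta> < r \<Longrightarrow> a (0, 0, \<zeta>) = \<i> * of_real \<gamma>" by auto
  then have "a p = \<i> * of_real \<gamma>" if "p \<in> tube r" for p
    using D(4) that by (subst whom_0_eq[OF D(1) _ that]) (auto simp: tube_def)
  then show ?thesis using that by blast
qed

text \<open>For fixed \<open>j\<close> the coefficients form a geometric sequence in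
  \<open>l\<close> that ends with 1 at \<open>j + l = n\<close>; subtracting \<open>s\<close> times
  the next entry leaves only that last one. This inverts the matrix \<open>pc s\<close>.\<close>

lemma pc_telescope: "j \<in> K \<Longrightarrow> l \<in> K \<Longrightarrow> pc s j l - s * pc s j (l + 1) = (if j = n - l then 1 else 0)"
proof (cases "j + l < n")
  case True
  then have "n - j - l = Suc (n - j - (l + 1))" by simp
  then show ?thesis using True by (simp add: pc_def)
qed (auto simp: pc_def K_iff)

lemma pc_sum_telescope:
  assumes "l \<in> K"
  shows "(\<Sum>j\<in>K. pc s j l * g j) - s * (\<Sum>j\<in>K. pc s j (l + 1) * g j) = g (n - l)"
proof -
  have "(\<Sum>j\<in>K. pc s j l * g j) - s * (\<Sum>j\<in>K. pc s j (l + 1) * g j)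
      = (\<Sum>j\<in>K. (pc s j l - s * pc s j (l + 1)) * g j)"
    by (simp add: sum_subtractf sum_distrib_left algebra_simps)
  also have "\<dots> = (\<Sum>j\<in>K. if j = n - l then g j else 0)"
    by (intro sum.cong refl) (simp only: pc_telescope[OF _ assms] if_distribR mult_1 mult_zero_left if_distrib[of "\<lambda>x. x * _"])
  also have "\<dots> = g (n - l)" using assms by (simp add: K_iff)
  finally show ?thesis .
qed

text \<open>\<open>h j\<close> and \<open>\<gamma> j\<close> are the coefficients of
  \<open>X_z n e j\<close> and \<open>Y_z e j\<close>. Tangency at the l-th unit vector says that
  the sum of \<open>pc s j l * Re (b j)\<close> over \<open>j\<close> is \<open>h (n - l)\<close>,
  and telescoping in \<open>l\<close> solves for the \<open>Re (b j)\<close>.\<close>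

lemma graded_minus_1:
  assumes X: "graded_symmetry r (-1) a b c" and r: "r > 0"
  obtains h \<gamma> :: "nat \<Rightarrow> real" where "\<And>j. j \<notin> K \<Longrightarrow> h j = 0"
    "\<And>p. p \<in> tube r \<Longrightarrow> a p = 2 * (\<Sum>l\<in>K. of_real (h (n - l)) * zc l p)"
    "\<And>j p. j \<in> K \<Longrightarrow> p \<in> tube r \<Longrightarrow> b j p = of_real (h j) - snd (snd p) * of_real (h (j - 1)) + \<i> * of_real (\<gamma> j)"
    "\<And>p. p \<in> tube r \<Longrightarrow> c p = 0"
proof -
  note D = graded_symmetryD[OF X]
  have "\<exists>\<alpha>::real. \<forall>p\<in>tube r. cspace.dd (Ez l) a p = of_real \<alpha>" for l
  proof -
    from graded_symmetry_z[OF X, of l] have "graded_symmetry r (-2) (cspace.dd (cscale \<i> (Ez l)) a)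
        (\<lambda>j. cspace.dd (cscale \<i> (Ez l)) (b j)) (cspace.dd (cscale \<i> (Ez l)) c)" by simp
    from graded_minus_2[OF this r] obtain \<alpha> :: real
      where "\<And>p. p \<in> tube r \<Longrightarrow> cspace.dd (cscale \<i> (Ez l)) a p = \<i> * of_real \<alpha>" by blast
    then show ?thesis using dd_i[OF D(1), of _ "Ez l"] by auto
  qed
  then obtain \<alpha>0 :: "nat \<Rightarrow> real" where \<alpha>0: "\<And>l p. p \<in> tube r \<Longrightarrow> cspace.dd (Ez l) a p = of_real (\<alpha>0 l)"
    by metis
  \<comment> \<open>The factor 2 and the reversal \<open>n - j\<close> come from the
    \<open>w\<close>-component of \<open>X_z n e j\<close>. The value 0 off \<open>K\<close> makes
    \<open>h (j - 1)\<close> correct at \<open>j = 1\<close>.\<close>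
  define h where "h j = (if j \<in> K then \<alpha>0 (n - j) / 2 else 0)" for j
  have \<alpha>: "\<alpha>0 l = 2 * h (n - l)" if "l \<in> K" for l using that by (auto simp: h_def K_iff)
  have Dw: "cspace.dd Ew a p = 0" if p: "p \<in> tube r" for p
  proof -
    have "whom r (-1) (cspace.dd Ew a)"
      using whom_dd[OF D(1) D(4), of Ew 2] by (simp add: dil_def cscale_apply)
    then show ?thesis using whom_neg_eq_0[OF cspace.chol_dd[OF D(1) open_tube] _ _ p] by simp
  qed
  have a: "a p = 2 * (\<Sum>l\<in>K. of_real (h (n - l)) * zc l p)" if p: "p \<in> tube r" for p
    using whom_euler[OF D(1) D(4) p] Dw[OF p] \<alpha>0[OF p] \<alpha>
    by (simp add: sum_distrib_left mult_ac cong: sum.cong)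
  have c: "c p = 0" if "p \<in> tube r" for p
    using whom_neg_eq_0[OF D(3) D(6) _ that] by simp
  have b0: "b j p = b j (0, 0, snd (snd p))" if "j \<in> K" "p \<in> tube r" for j p
    using whom_0_eq[OF D(2) _ that(2)] D(5) that by auto
  have Re_b: "Re (b j (0, 0, \<zeta>)) = h j + (- h (j - 1)) * Re \<zeta>" if j: "j \<in> K" and \<zeta>: "norm \<zeta> < r" for j \<zeta>
  proof -
    let ?s = "Re \<zeta>" and ?g = "\<lambda>j. Re (b j (0, 0, \<zeta>))"
    have S: "h (n - l) = (\<Sum>j\<in>K. pc ?s j l * ?g j)" if l: "l \<in> K" for l
    proof -
      let ?x = "\<lambda>j. if j = l then 1 else 0 :: real"
      let ?p = "pt (of_real (PP ?x ?s)) (\<lambda>j. of_real (?x j)) \<zeta>"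
      have PD: "PD ?x ?s j = 2 * pc ?s j l" for j
        using l by (simp add: PD_def if_distrib cong: if_cong)
      note T = tangency_real[OF X \<zeta>, of ?x]
      have "Re (a ?p) = 2 * h (n - l)"
        unfolding a[OF T(2)] using l by (simp add: if_distrib if_distribR cong: if_cong)
      moreover have "Re (b j ?p) = ?g j" if "j \<in> K" for j
        using b0[OF that T(2)] by simp
      ultimately show ?thesis
        using T(1) c[OF T(2)] by (simp add: PD mult.assoc flip: sum_distrib_left cong: sum.cong)
    qed
    define l where "l = n - j"
    have jn: "0 < j" "j < n" using j unfolding K_iff by blast+
    have l: "l \<in> K" "j = n - l" "0 < l" unfolding l_def K_iff using jn by linarith+
    \<comment> \<open>For \<open>l + 1 = n\<close> there is no instance of \<open>S\<close>; both
      sides are then 0.\<close>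
    have S2: "(\<Sum>i\<in>K. pc ?s i (l + 1) * ?g i) = h (j - 1)"
    proof (cases "l + 1 \<in> K")
      case True
      have "n - (l + 1) = j - 1" unfolding l(2) by linarith
      then show ?thesis using S[OF True] by (simp only:)
    next
      case False
      then have "l + 1 = n" using jn l(3) unfolding K_iff l_def by linarith
      then have "j - 1 = 0" unfolding l(2) by linarith
      then have "h (j - 1) = 0" by (simp add: h_def K_iff)
      moreover have "pc ?s i (l + 1) = 0" if "i \<in> K" for i
        using \<open>l + 1 = n\<close> that by (simp add: pc_def K_iff)
      ultimately show ?thesis by simp
    qed
    show ?thesis
      using pc_sum_telescope[OF l(1), of ?s ?g]
      unfolding S[OF l(1), symmetric] S2 l(2)[symmetric] by (simp add: mult.commute)
  qed
  have "\<exists>\<gamma>::real. \<forall>p\<in>tube r. b j p = of_real (h j) - snd (snd p) * of_real (h (j - 1)) + \<i> * of_real \<gamma>"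
    if j: "j \<in> K" for j
  proof -
    from affine_if_Re_affine[OF zeta_line_holomorphic[OF D(2)[OF j]] r Re_b[OF j]]
    obtain \<gamma> :: real where "\<And>\<zeta>. norm \<zeta> < r \<Longrightarrow>
        b j (0, 0, \<zeta>) = of_real (h j) + of_real (- h (j - 1)) * \<zeta> + \<i> * of_real \<gamma>"
      by blast
    then show ?thesis
      by (intro exI[of _ \<gamma>] ballI, subst b0[OF j]) (simp_all add: tube_def mult.commute)
  qed
  then have "\<exists>\<gamma>::nat \<Rightarrow> real. \<forall>j\<in>K. \<forall>p\<in>tube r.
      b j p = of_real (h j) - snd (snd p) * of_real (h (j - 1)) + \<i> * of_real (\<gamma> j)"
    by (intro bchoice ballI)
  then obtain \<gamma> :: "nat \<Rightarrow> real" where "\<forall>j\<in>K. \<forall>p\<in>tube r.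
      b j p = of_real (h j) - snd (snd p) * of_real (h (j - 1)) + \<i> * of_real (\<gamma> j)" ..
  then have b: "b j p = of_real (h j) - snd (snd p) * of_real (h (j - 1)) + \<i> * of_real (\<gamma> j)"
    if "j \<in> K" "p \<in> tube r" for j p
    using that by blast
  show ?thesis
    by (rule that[OF _ a b c]) (simp_all add: h_def)
qed

end

section \<open>Symmetries of weight zero\<close>

lemma bilinear_poly_zero:
  fixes u0 u1 u2 u3 r :: real
  assumes "r > 0" and 0: "\<And>s t. norm (Complex s t) < r \<Longrightarrow> u0 + u1 * s + u2 * t + u3 * (s * t) = 0"
  shows "u0 = 0" "u1 = 0" "u2 = 0" "u3 = 0"
proof -
  define d where "d = r / 3"
  have "d > 0" using \<open>r > 0\<close> by (simp add: d_def)
  have n: "norm (Complex s t) < r" if "\<bar>s\<bar> \<le> d" "\<bar>t\<bar> \<le> d" for s t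
  proof -
    have "norm (Complex s t) \<le> \<bar>s\<bar> + \<bar>t\<bar>" using cmod_le[of "Complex s t"] by simp
    then show ?thesis using that \<open>r > 0\<close> by (simp add: d_def)
  qed
  show u0: "u0 = 0" using 0[OF n[of 0 0]] \<open>d > 0\<close> by simp
  show u1: "u1 = 0" using 0[OF n[of d 0]] \<open>d > 0\<close> u0 by simp
  show u2: "u2 = 0" using 0[OF n[of 0 d]] \<open>d > 0\<close> u0 by simp
  show "u3 = 0" using 0[OF n[of d d]] \<open>d > 0\<close> u0 u1 u2 by simp
qed

text \<open>Polarisation at unit vectors: a quadratic form sees only the symmetric part of its
  matrix.\<close>

lemma quadratic_form_zero:
  fixes T :: "'i \<Rightarrow> 'i \<Rightarrow> real"
  assumes K: "finite K" "j \<in> K" "k \<in> K"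
    and 0: "\<And>x. (\<Sum>j\<in>K. \<Sum>k\<in>K. T j k * x j * x k) = 0"
  shows "T j k + T k j = 0"
proof -
  define B where "B = (\<lambda>x y. \<Sum>j\<in>K. \<Sum>k\<in>K. T j k * x j * y k)"
  define \<delta> where "\<delta> = (\<lambda>i j :: 'i. if j = i then 1 else 0 :: real)"
  have B\<delta>: "B (\<delta> i) (\<delta> l) = T i l" if "i \<in> K" "l \<in> K" for i l
  proof -
    have "B (\<delta> i) (\<delta> l) = (\<Sum>j\<in>K. if j = i then (\<Sum>k\<in>K. if k = l then T j k else 0) else 0)"
      unfolding B_def \<delta>_def by (intro sum.cong refl) (auto intro!: sum.cong)
    then show ?thesis using that K(1) by simp
  qed
  have "B (\<lambda>i. \<delta> j i + \<delta> k i) (\<lambda>i. \<delta> j i + \<delta> k i) = B (\<delta> j) (\<delta> j) + B (\<delta> j) (\<delta> k) + B (\<delta> k) (\<delta> j) + B (\<delta> k) (\<delta> k)"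
    by (simp add: B_def algebra_simps sum.distrib)
  moreover have "B x x = 0" for x using 0 by (simp add: B_def)
  ultimately show ?thesis using B\<delta> K by simp
qed

text \<open>Together the two relations give \<open>d (l + 1) k = d l (k + 1)\<close>, so
  \<open>d\<close> is constant along antidiagonals and hence symmetric; being antisymmetric as well,
  it is 0.\<close>

lemma antisymmetric_shift_zero:
  fixes d :: "nat \<Rightarrow> nat \<Rightarrow> real"
  assumes anti: "\<And>l k. 0 < l \<Longrightarrow> l < n \<Longrightarrow> 0 < k \<Longrightarrow> k < n \<Longrightarrow> d l k + d k l = 0"
    and shift: "\<And>l k. 0 < l \<Longrightarrow> l + 1 < n \<Longrightarrow> 0 < k \<Longrightarrow> k + 1 < n \<Longrightarrow> d l (k + 1) + d k (l + 1) = 0"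
    and "0 < l" "l < n" "0 < k" "k < n"
  shows "d l k = 0"
proof -
  have move: "d (l + i) k = d l (k + i)" if "0 < l" "l + i < n" "0 < k" "k + i < n" for l k i
    using that
  proof (induction i arbitrary: l)
    case (Suc i)
    have "d (l + Suc i) k = d (l + 1) (k + i)" using Suc.IH[of "l + 1"] Suc.prems by simp
    also have "\<dots> = - d (k + i) (l + 1)" using anti[of "l + 1" "k + i"] Suc.prems by simp
    also have "\<dots> = d l (k + Suc i)" using shift[of l "k + i"] Suc.prems by simp
    finally show ?case .
  qed simp
  have "d k l = d l k" if "l \<le> k" "0 < l" "k < n" for l k
    using move[of l "k - l" l] that by simp
  then show ?thesis using anti[of l k] assms(3-) by (cases "l \<le> k") force+
qed

context model_hypersurface
begin

text \<open>With d = n - l - k the entry is d s^(d-1), the derivative of a geometric sequence. One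
  difference in an index leaves a geometric sequence, so the difference is taken in both
  indices.\<close>

lemma pc'_telescope:
  assumes "l \<in> K" "k \<in> K"
  shows "pc' s l k - s * pc' s (l + 1) k - s * pc' s l (k + 1) + s\<^sup>2 * pc' s (l + 1) (k + 1)
    = (if l + k = n - 1 then 1 else 0)"
proof (cases "l + k \<le> n")
  case True
  define d where "d = n - l - k"
  have d: "n - (l + 1) - k = d - 1" "n - l - (k + 1) = d - 1" "n - (l + 1) - (k + 1) = d - 2"
    "l + 1 + k \<le> n \<longleftrightarrow> 1 \<le> d" "l + (k + 1) \<le> n \<longleftrightarrow> 1 \<le> d" "l + 1 + (k + 1) \<le> n \<longleftrightarrow> 2 \<le> d"
    "l + k = n - 1 \<longleftrightarrow> d = 1" "l + k \<le> n \<longleftrightarrow> True"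
    using True n_gt unfolding d_def by auto
  consider "d = 0" | "d = 1" | "d = 2" | m where "d = Suc (Suc (Suc m))"
    by (metis One_nat_def Suc_1 not0_implies_Suc)
  then show ?thesis
    unfolding pc'_def d_def[symmetric] d by cases (simp_all add: power2_eq_square algebra_simps)
next
  case False
  then show ?thesis by (auto simp: pc'_def)
qed

text \<open>The tangency condition is an identity \<open>E l k\<close> between the coefficients of \<open>x\<^sub>l x\<^sub>k\<close>.  The combination
  \<open>E l k - s E (l+1) k - s E l (k+1) + s\<^sup>2 E (l+1) (k+1)\<close> telescopes all higher powers of \<open>s\<close>.\<close>

lemma quadratic_tangency_reduced:
  fixes A C s :: real and M :: "nat \<Rightarrow> nat \<Rightarrow> real"
  assumes eq: "\<And>x. A * PP x s = (\<Sum>j\<in>K. PD x s j * (\<Sum>l\<in>K. x l * M l j)) + PS x s * C"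
    and M: "\<And>l j. l \<notin> K \<Longrightarrow> M l j = 0"
    and lk: "l \<in> K" "k \<in> K"
  shows "A * ((if l + k = n then 1 else 0) - s * (if l + k = n - 1 then 1 else 0)) =
    M k (n - l) - s * M (k + 1) (n - l) + M l (n - k) - s * M (l + 1) (n - k) +
    C * (if l + k = n - 1 then 1 else 0)"
proof -
  \<comment> \<open>\<open>2 * S j k\<close> is the coefficient of x_j x_k in the \<open>PD\<close>
    sum before symmetrisation.\<close>
  define S where "S = (\<lambda>j k. \<Sum>i\<in>K. pc s i j * M k i)"
  have E0: "A * pc s j k = S j k + S k j + C * pc' s j k" if "j \<in> K" "k \<in> K" for j k
  proof -
    define T where "T = (\<lambda>j k. A * pc s j k - 2 * S j k - C * pc' s j k)"
    have "T j k + T k j = 0"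
    proof (rule quadratic_form_zero[OF finite_K that])
      fix x :: "nat \<Rightarrow> real"
      have "(\<Sum>j\<in>K. PD x s j * (\<Sum>l\<in>K. x l * M l j)) = (\<Sum>i\<in>K. \<Sum>j\<in>K. \<Sum>l\<in>K. 2 * pc s i j * M l i * x j * x l)"
        by (simp add: PD_def sum_distrib_left sum_distrib_right mult_ac)
      also have "\<dots> = (\<Sum>j\<in>K. \<Sum>i\<in>K. \<Sum>l\<in>K. 2 * pc s i j * M l i * x j * x l)"
        by (rule sum.swap)
      also have "\<dots> = (\<Sum>j\<in>K. \<Sum>l\<in>K. \<Sum>i\<in>K. 2 * pc s i j * M l i * x j * x l)"
        by (intro sum.cong refl sum.swap)
      also have "\<dots> = (\<Sum>j\<in>K. \<Sum>l\<in>K. 2 * S j l * x j * x l)"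
        by (simp add: S_def sum_distrib_left sum_distrib_right mult_ac)
      finally have "A * PP x s = (\<Sum>j\<in>K. \<Sum>l\<in>K. 2 * S j l * x j * x l) + C * PS x s"
        using eq[of x] by simp
      then show "(\<Sum>j\<in>K. \<Sum>k\<in>K. T j k * x j * x k) = 0"
        by (simp add: T_def PP_def PS_def sum_distrib_left sum_subtractf sum.distrib algebra_simps)
    qed
    then show ?thesis unfolding T_def by (simp add: pc_commute[of s k j] pc'_commute[of s k j])
  qed
  \<comment> \<open>The telescoping reaches the indices \<open>l + 1\<close> and
    \<open>k + 1\<close>, which may equal \<open>n\<close>; there every term vanishes.\<close>
  have E: "A * pc s j k = S j k + S k j + C * pc' s j k" if "0 < j" "j \<le> n" "0 < k" "k \<le> n" for j k
  proof (cases "j \<in> K \<and> k \<in> K")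
    case True
    then show ?thesis using E0 by blast
  next
    case False
    then have jk: "j = n \<or> k = n" using that by (auto simp: K_iff)
    then have z: "pc s j k = 0" "pc' s j k = 0" using that by (auto simp: pc_def pc'_def)
    have "pc s i n = 0" if "i \<in> K" for i using that by (simp add: pc_def K_iff)
    then have "S n i = 0" "S i n = 0" for i
      using M[of n] by (simp_all add: S_def K_iff)
    then show ?thesis using z jk by auto
  qed
  have l: "0 < l" "l < n" and k: "0 < k" "k < n" using lk by (auto simp: K_iff)
  have S: "S l i - s * S (l + 1) i = M i (n - l)" if "l \<in> K" for l i
    unfolding S_def by (rule pc_sum_telescope[OF that])
  have p: "pc s l k - s * pc s (l + 1) k - s * (pc s l (k + 1) - s * pc s (l + 1) (k + 1))
    = (if l + k = n then 1 else 0) - s * (if l + k = n - 1 then 1 else 0)"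
  proof -
    have t: "pc s l i - s * pc s (l + 1) i = (if l + i = n then 1 else 0)" if "0 < i" "i \<le> n" for i
    proof (cases "i \<in> K")
      case True
      then have "i = n - l \<longleftrightarrow> l + i = n" using l by (auto simp: K_iff)
      then show ?thesis using pc_telescope[OF True lk(1), of s]
        by (simp only: pc_commute[of s l i] pc_commute[of s "l + 1" i])
    next
      case False
      then have "i = n" using that by (auto simp: K_iff)
      then show ?thesis using l by (simp add: pc_def)
    qed
    have "l + (k + 1) = n \<longleftrightarrow> l + k = n - 1" using n_gt by auto
    then show ?thesis using t[of k] t[of "k + 1"] k by simp
  qed
  have "A * (pc s l k - s * pc s (l + 1) k - s * (pc s l (k + 1) - s * pc s (l + 1) (k + 1)))
    = (S l k - s * S (l + 1) k) - s * (S l (k + 1) - s * S (l + 1) (k + 1))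
    + (S k l - s * S (k + 1) l) - s * (S k (l + 1) - s * S (k + 1) (l + 1))
    + C * (pc' s l k - s * pc' s (l + 1) k - s * pc' s l (k + 1) + s\<^sup>2 * pc' s (l + 1) (k + 1))"
  proof -
    have "A * (pc s l k - s * pc s (l + 1) k - s * (pc s l (k + 1) - s * pc s (l + 1) (k + 1)))
      = A * pc s l k - s * (A * pc s (l + 1) k) - s * (A * pc s l (k + 1) - s * (A * pc s (l + 1) (k + 1)))"
      by (simp add: algebra_simps)
    moreover have "A * pc s l k = S l k + S k l + C * pc' s l k"
      "A * pc s (l + 1) k = S (l + 1) k + S k (l + 1) + C * pc' s (l + 1) k"
      "A * pc s l (k + 1) = S l (k + 1) + S (k + 1) l + C * pc' s l (k + 1)"
      "A * pc s (l + 1) (k + 1) = S (l + 1) (k + 1) + S (k + 1) (l + 1) + C * pc' s (l + 1) (k + 1)"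
      using l k by (intro E; simp)+
    ultimately show ?thesis by (simp only:) (simp add: algebra_simps power2_eq_square)
  qed
  then show ?thesis
    unfolding p S[OF lk(1)] S[OF lk(2)] pc'_telescope[OF lk] by simp
qed

text \<open>The coefficient of \<open>z\<^sub>l \<partial>/\<partial>z\<^sub>j\<close> in \<open>\<xi> X'\<^sub>-\<^sub>1 + \<upsilon> U\<^sub>0 + v V\<^sub>0 + \<rho> V\<^sub>2\<^sub>-\<^sub>n\<close>.\<close>

definition bm :: "real \<Rightarrow> real \<Rightarrow> real \<Rightarrow> real \<Rightarrow> nat \<Rightarrow> nat \<Rightarrow> complex" where
  "bm \<xi> \<upsilon> v \<rho> j l = of_real ((if l + 1 = j then \<xi> * (2 * real j - 2 - real n) else 0) +
      (if l = j then \<upsilon> * real j + v else 0)) + \<i> * of_real (if j = n - 1 \<and> l = 1 then \<rho> else 0)"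

text \<open>Apart from the unknown \<open>C s t\<close>, the identity \<open>R\<close> is of degree
  at most 1 in each of \<open>s\<close> and \<open>t\<close>. Off the antidiagonal
  \<open>l + k = n - 1\<close>, where \<open>C\<close> does not occur, its four coefficients vanish;
  on it, \<open>C\<close> is eliminated by subtracting the instance (1, n - 2). In the application
  \<open>q\<close> describes the quadratic part of \<open>a\<close>, and \<open>g\<close> the real
  constants in the \<open>b j\<close>.\<close>

lemma quadratic_coeffs_zero:
  fixes q g :: "nat \<Rightarrow> nat \<Rightarrow> real" and A :: real and C :: "real \<Rightarrow> real \<Rightarrow> real"
  assumes r: "r > 0" and sym: "\<And>l k. q l k = q k l" and q0: "\<And>l k. l \<notin> K \<Longrightarrow> q l k = 0"
    and R: "\<And>l k s t. l \<in> K \<Longrightarrow> k \<in> K \<Longrightarrow> norm (Complex s t) < r \<Longrightarrow>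
      A * ((if l + k = n then 1 else 0) - s * (if l + k = n - 1 then 1 else 0)) =
      (g l k - t * q k (l + 1)) - s * (g l (k + 1) - t * q (k + 1) (l + 1)) +
      (g k l - t * q l (k + 1)) - s * (g k (l + 1) - t * q (l + 1) (k + 1)) +
      C s t * (if l + k = n - 1 then 1 else 0)"
  obtains "\<And>l k. l \<noteq> 1 \<or> k \<noteq> 1 \<Longrightarrow> q l k = 0"
    "\<And>s t. norm (Complex s t) < r \<Longrightarrow> C s t = - (g 1 (n - 2) + g (n - 2) 1) + (g 1 (n - 1) + g (n - 2) 2 - A) * s"
    "\<And>l k. l \<in> K \<Longrightarrow> k \<in> K \<Longrightarrow> l + k \<noteq> n - 1 \<Longrightarrow> g l k + g k l = (if l + k = n then A else 0)"
    "\<And>l k. l \<in> K \<Longrightarrow> k \<in> K \<Longrightarrow> l + k \<noteq> n - 1 \<Longrightarrow> g l (k + 1) + g k (l + 1) = 0"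
    "\<And>l k. l \<in> K \<Longrightarrow> k \<in> K \<Longrightarrow> l + k = n - 1 \<Longrightarrow> g l k + g k l = g 1 (n - 2) + g (n - 2) 1"
    "\<And>l k. l \<in> K \<Longrightarrow> k \<in> K \<Longrightarrow> l + k = n - 1 \<Longrightarrow> g l (k + 1) + g k (l + 1) = g 1 (n - 1) + g (n - 2) 2"
proof -
  have ne: "g l k + g k l = (if l + k = n then A else 0) \<and> g l (k + 1) + g k (l + 1) = 0 \<and>
      q k (l + 1) + q l (k + 1) = 0 \<and> q (k + 1) (l + 1) = 0"
    if lk: "l \<in> K" "k \<in> K" "l + k \<noteq> n - 1" for l k
  proof -
    let ?u0 = "g l k + g k l - (if l + k = n then A else 0)" and ?u1 = "- (g l (k + 1) + g k (l + 1))"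
    let ?u2 = "- (q k (l + 1) + q l (k + 1))" and ?u3 = "2 * q (k + 1) (l + 1)"
    have "?u0 + ?u1 * s + ?u2 * t + ?u3 * (s * t) = 0" if "norm (Complex s t) < r" for s t
      using R[OF lk(1,2) that] lk(3) sym[of "l + 1" "k + 1"] by (auto simp: algebra_simps)
    from bilinear_poly_zero[OF r this] show ?thesis by simp
  qed
  have n2: "1 \<in> K" "n - 2 \<in> K" "1 + (n - 2) = n - 1" "n - 2 + 1 = n - 1" using n_gt by (auto simp: K_iff)
  have n1: "n - 1 \<noteq> n" "n - Suc 0 \<noteq> n" using n_gt by auto
  have R0: "A * (0 - s) = (g 1 (n - 2) - t * q (n - 2) 2) - s * (g 1 (n - 1) - t * q (n - 1) 2) +
      (g (n - 2) 1 - t * q 1 (n - 1)) - s * (g (n - 2) 2 - t * q 2 (n - 1)) + C s t"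
    if "norm (Complex s t) < r" for s t
    using R[OF n2(1,2) that] n1 unfolding n2(3,4) one_add_one by simp
  have eq: "g l k + g k l = g 1 (n - 2) + g (n - 2) 1 \<and>
      g l (k + 1) + g k (l + 1) = g 1 (n - 1) + g (n - 2) 2 \<and>
      q k (l + 1) + q l (k + 1) = q (n - 2) 2 + q 1 (n - 1) \<and> q (k + 1) (l + 1) = q (n - 1) 2"
    if lk: "l \<in> K" "k \<in> K" "l + k = n - 1" for l k
  proof -
    let ?u0 = "g l k + g k l - (g 1 (n - 2) + g (n - 2) 1)"
    let ?u1 = "- (g l (k + 1) + g k (l + 1)) + (g 1 (n - 1) + g (n - 2) 2)"
    let ?u2 = "- (q k (l + 1) + q l (k + 1)) + (q (n - 2) 2 + q 1 (n - 1))"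
    let ?u3 = "2 * q (k + 1) (l + 1) - 2 * q (n - 1) 2"
    have "?u0 + ?u1 * s + ?u2 * t + ?u3 * (s * t) = 0" if "norm (Complex s t) < r" for s t
      using R[OF lk(1,2) that] R0[OF that]
      unfolding lk(3) sym[of "l + 1" "k + 1"] sym[of 2 "n - 1"] by (simp add: n1 algebra_simps)
    from bilinear_poly_zero[OF r this] show ?thesis by simp
  qed
  have q21: "q (n - 1) 2 = 0"
  proof -
    \<comment> \<open>For the pair (n - 1, 1) the companion term is \<open>q 1 n\<close>, which is 0
      because \<open>n\<close> is not in \<open>K\<close>.\<close>
    have "n - 1 + 1 = n" "n - 1 \<in> K" "n \<noteq> n - 1" using n_gt by (auto simp: K_iff)
    then show ?thesis
      using ne[of "n - 1" 1] n2(1) q0[of n 1] sym[of n 1] unfolding one_add_one by (simp add: K_iff)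
  qed
  have q_ge2: "q a b = 0" if "a \<ge> 2" "b \<ge> 2" for a b
  proof (cases "a \<in> K \<and> b \<in> K")
    case True
    then have K: "b - 1 \<in> K" "a - 1 \<in> K" using that by (auto simp: K_iff)
    have ab: "a - 1 + 1 = a" "b - 1 + 1 = b" using that by auto
    show ?thesis
    proof (cases "b - 1 + (a - 1) = n - 1")
      case True
      then show ?thesis using eq[OF K True] q21 unfolding ab by simp
    next
      case False
      then show ?thesis using ne[OF K False] unfolding ab by simp
    qed
  next
    case False
    then show ?thesis using q0[of a b] q0[of b a] sym[of a b] by auto
  qed
  have q1n: "q 1 (n - 1) = 0"
  proof -
    \<comment> \<open>A second pair on the antidiagonal. As n > 4, its entries of \<open>q\<close>
      have both indices at least 2 and vanish, which isolates \<open>q 1 (n - 1)\<close>; for n = 4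
      it would be the reference pair with the indices exchanged.\<close>
    have K: "2 \<in> K" "n - 3 \<in> K" "2 + (n - 3) = n - 1" and n3: "n - 3 + 1 = n - 2"
      using n_gt by (auto simp: K_iff)
    have "q (n - 3) (2 + 1) + q 2 (n - 2) = q (n - 2) 2 + q 1 (n - 1)"
      using eq[OF K] unfolding n3 by blast
    moreover have "q (n - 3) (2 + 1) = 0" "q 2 (n - 2) = 0" "q (n - 2) 2 = 0"
      using n_gt by (intro q_ge2; simp)+
    ultimately show ?thesis by simp
  qed
  have q1: "q 1 b = 0" if "b \<noteq> 1" for b
  proof (cases "b \<in> K \<and> b \<noteq> n - 1")
    case True
    then have b: "2 \<le> b" "b - 1 \<in> K" "b - 1 + 1 = b" "b - 1 + 1 \<noteq> n - 1" using that by (auto simp: K_iff)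
    have "q 1 b + q (b - 1) 2 = 0"
      using ne[OF b(2) n2(1) b(4)] unfolding b(3) one_add_one by blast
    moreover have "q (b - 1) 2 = 0" if "b \<noteq> 2"
      using b(1) that by (intro q_ge2) auto
    ultimately show ?thesis by (cases "b = 2") simp_all
  next
    case False
    then show ?thesis using q1n q0[of b 1] sym[of 1 b] by auto
  qed
  have q: "q l k = 0" if "l \<noteq> 1 \<or> k \<noteq> 1" for l k
  proof -
    have "l = 1 \<and> k \<noteq> 1 \<or> k = 1 \<and> l \<noteq> 1 \<or> l \<ge> 2 \<and> k \<ge> 2 \<or> l = 0 \<or> k = 0" using that by arith
    then show ?thesis
    proof (elim disjE conjE)
      assume "l = 1" "k \<noteq> 1"
      then show ?thesis using q1[of k] by simp
    next
      assume "k = 1" "l \<noteq> 1"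
      then show ?thesis using q1[of l] sym[of l k] by simp
    next
      assume "k = 0"
      then show ?thesis using q0[of 0 l] sym[of l k] by (simp add: K_iff)
    qed (simp_all add: q_ge2 q0 K_iff)
  qed
  have C: "C s t = - (g 1 (n - 2) + g (n - 2) 1) + (g 1 (n - 1) + g (n - 2) 2 - A) * s"
    if "norm (Complex s t) < r" for s t
  proof -
    have "(2::nat) \<noteq> 1" by simp
    then have z: "q i 2 = 0" "q 2 i = 0" for i
      using q by blast+
    have "q 1 (n - 1) = 0" by (rule q1n)
    show ?thesis
      using R0[OF that] unfolding z q1n by (simp add: algebra_simps)
  qed
  have F: "g l k + g k l = (if l + k = n then A else 0)" "g l (k + 1) + g k (l + 1) = 0"
    if "l \<in> K" "k \<in> K" "l + k \<noteq> n - 1" for l k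
    using ne[OF that] by blast+
  have G: "g l k + g k l = g 1 (n - 2) + g (n - 2) 1" "g l (k + 1) + g k (l + 1) = g 1 (n - 1) + g (n - 2) 2"
    if "l \<in> K" "k \<in> K" "l + k = n - 1" for l k
    using eq[OF that] by blast+
  show ?thesis
    by (rule that; (rule q C F(1) F(2) G(1) G(2); assumption))
qed

lemma sum_zc_two:
  assumes "l \<in> K" "m \<in> K"
  shows "(\<Sum>k\<in>K. f k * zc k (cscale \<tau> (Ez l) + cscale \<sigma> (Ez m))) = f l * \<tau> + f m * \<sigma>"
proof -
  have "(\<Sum>k\<in>K. f k * zc k (cscale \<tau> (Ez l) + cscale \<sigma> (Ez m)))
      = (\<Sum>k\<in>K. (if k = l then f k * \<tau> else 0) + (if k = m then f k * \<sigma> else 0))"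
    using assms by (intro sum.cong refl) (simp add: zc_Ez distrib_left)
  then show ?thesis using assms by (simp add: sum.distrib)
qed

lemma sum_zc_one:
  assumes "m \<in> K"
  shows "(\<Sum>k\<in>K. f k * zc k (cscale \<tau> Ew + cscale \<sigma> (Ez m))) = f m * \<sigma>"
proof -
  have "(\<Sum>k\<in>K. f k * zc k (cscale \<tau> Ew + cscale \<sigma> (Ez m)))
      = (\<Sum>k\<in>K. (if k = m then f k * \<sigma> else 0))"
    using assms by (intro sum.cong refl) (simp add: zc_Ez)
  then show ?thesis using assms by simp
qed

lemma dd_Ew_zero:
  assumes "cspace.chol f (tube r)" "whom r k f" "k < 2" "p \<in> tube r"
  shows "cspace.dd Ew f p = 0"
proof -
  have "whom r (k - 2) (cspace.dd Ew f)"
    using whom_dd[OF assms(1,2), of Ew 2] by (simp add: dil_def cscale_apply)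
  then show ?thesis
    using whom_neg_eq_0[OF cspace.chol_dd[OF assms(1) open_tube] _ _ assms(4)] assms(3) by simp
qed

lemma in_tube_line: "r > 0 \<Longrightarrow> snd (snd u) = 0 \<Longrightarrow> snd (snd v) = 0 \<Longrightarrow> cscale \<tau> u + cscale \<sigma> v \<in> tube r"
  by (simp add: tube_def)

text \<open>The parameters are, in order, the coefficients of \<open>X_\<zeta>\<close>,
  \<open>U\<^sub>0\<close>, \<open>V\<^sub>0\<close>, \<open>Y_\<zeta>\<close> and
  \<open>V_neg\<close>. Euler's identity recovers \<open>a\<close> and the \<open>b j\<close> from
  derivatives of weights -1 and -2; \<open>c\<close> has weight 0 and is reached only through
  tangency.\<close>

lemma graded_0:
  assumes X: "graded_symmetry r 0 a b c" and r: "r > 0"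
  obtains \<xi> \<upsilon> v \<gamma> \<rho> :: real where
    "\<And>p. p \<in> tube r \<Longrightarrow> a p = of_real (real n * \<upsilon> + 2 * v) * fst p + \<i> * of_real \<rho> * (zc 1 p)\<^sup>2"
    "\<And>j p. j \<in> K \<Longrightarrow> p \<in> tube r \<Longrightarrow> b j p = (\<Sum>l\<in>K. bm \<xi> \<upsilon> v \<rho> j l * zc l p)"
    "\<And>p. p \<in> tube r \<Longrightarrow> c p = of_real (2 * \<xi>) + \<i> * of_real \<gamma> + of_real \<upsilon> * snd (snd p)"
proof -
  note D = graded_symmetryD[OF X]
  define P where "P l h \<gamma> \<longleftrightarrow> (\<forall>j. j \<notin> K \<longrightarrow> h j = 0) \<and>
      (\<forall>p\<in>tube r. cspace.dd (cscale \<i> (Ez l)) a p = 2 * (\<Sum>m\<in>K. of_real (h (n - m)) * zc m p)) \<and>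
      (\<forall>j\<in>K. \<forall>p\<in>tube r. cspace.dd (cscale \<i> (Ez l)) (b j) p =
        of_real (h j) - snd (snd p) * of_real (h (j - 1)) + \<i> * of_real (\<gamma> j))" for l and h \<gamma> :: "nat \<Rightarrow> real"
  have "\<exists>h \<gamma>. P l h \<gamma>" for l
  proof -
    from graded_symmetry_z[OF X, of l] have "graded_symmetry r (-1) (cspace.dd (cscale \<i> (Ez l)) a)
      (\<lambda>j. cspace.dd (cscale \<i> (Ez l)) (b j)) (cspace.dd (cscale \<i> (Ez l)) c)" by simp
    from this r show ?thesis
      by (rule graded_minus_1) (auto simp: P_def)
  qed
  then obtain H G where "\<And>l. P l (H l) (G l)" by metis
  then have H0: "\<And>l j. j \<notin> K \<Longrightarrow> H l j = 0"
    and Dia: "\<And>l p. p \<in> tube r \<Longrightarrow> cspace.dd (cscale \<i> (Ez l)) a p = 2 * (\<Sum>m\<in>K. of_real (H l (n - m)) * zc m p)"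
    and Dib: "\<And>l j p. j \<in> K \<Longrightarrow> p \<in> tube r \<Longrightarrow> cspace.dd (cscale \<i> (Ez l)) (b j) p =
        of_real (H l j) - snd (snd p) * of_real (H l (j - 1)) + \<i> * of_real (G l j)"
    unfolding P_def by blast+
  note Da = dd_eqI[OF D(1) _ Dia] and Db = dd_eqI[OF D(2) _ Dib]
  from graded_symmetry_w[OF X] have "graded_symmetry r (-2) (cspace.dd (cscale \<i> Ew) a)
      (\<lambda>j. cspace.dd (cscale \<i> Ew) (b j)) (cspace.dd (cscale \<i> Ew) c)" by simp
  from graded_minus_2[OF this r] obtain A :: real
    where A: "\<And>p. p \<in> tube r \<Longrightarrow> cspace.dd (cscale \<i> Ew) a p = \<i> * of_real A" by blast
  have Dwa: "cspace.dd Ew a p = of_real A" if "p \<in> tube r" for p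
    using dd_eqI[OF D(1) that A[OF that]] by simp
  have a: "a p = of_real A * fst p - \<i> * (\<Sum>l\<in>K. \<Sum>m\<in>K. of_real (H l (n - m)) * zc l p * zc m p)"
    if p: "p \<in> tube r" for p
  proof -
    have "2 * a p = 2 * fst p * of_real A + (\<Sum>l\<in>K. zc l p * (- \<i> * (2 * (\<Sum>m\<in>K. of_real (H l (n - m)) * zc m p))))"
      using whom_euler[OF D(1) D(4) p] by (simp add: Dwa[OF p] Da[OF p p])
    also have "\<dots> = 2 * (of_real A * fst p - \<i> * (\<Sum>l\<in>K. \<Sum>m\<in>K. of_real (H l (n - m)) * zc l p * zc m p))"
      by (simp add: sum_distrib_left sum_negf algebra_simps)
    finally show ?thesis unfolding mult_cancel_left by simp
  qed
  have b: "b j p = (\<Sum>l\<in>K. zc l p * (- \<i> * (of_real (H l j) - snd (snd p) * of_real (H l (j - 1)) + \<i> * of_real (G l j))))"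
    if j: "j \<in> K" and p: "p \<in> tube r" for j p
    using whom_euler[OF D(2)[OF j] D(5)[OF j] p] dd_Ew_zero[OF D(2)[OF j] D(5)[OF j] _ p]
    by (simp add: Db[OF j p j p])
  \<comment> \<open>Up to the factor \<open>- \<i>\<close>, the matrix of the quadratic part of
    \<open>a\<close>; equality of mixed derivatives makes it symmetric.\<close>
  define q where "q l m = (if l \<in> K \<and> m \<in> K then H l (n - m) else 0)" for l m
  have qH: "q l m = H l (n - m)" if "l \<in> K" "0 < m" for l m
    using that H0[of 0 l] by (auto simp: q_def K_iff)
  have q_sym: "q l m = q m l" for l m
  proof (cases "l \<in> K \<and> m \<in> K")
    case True
    then have lm: "l \<in> K" "m \<in> K" by auto
    have "- \<i> * (2 * of_real (H l (n - m))) = - \<i> * (2 * of_real (H m (n - l)))"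
    proof (rule mixed_dd_coeff[OF D(1) r, of "Ez l" "Ez m" 0 _ _ "\<lambda>\<sigma>. - \<i> * (2 * of_real (H m (n - m))) * \<sigma>"])
      fix \<tau> \<sigma> :: complex
      let ?p = "cscale \<tau> (Ez l) + cscale \<sigma> (Ez m)"
      have p: "?p \<in> tube r" by (rule in_tube_line[OF r]) simp_all
      show "cspace.dd (Ez l) a ?p = 0 + (- \<i> * (2 * of_real (H l (n - l)))) * \<tau> + (- \<i> * (2 * of_real (H l (n - m)))) * \<sigma>"
        unfolding Da[OF p p] sum_zc_two[OF lm] by (simp add: algebra_simps)
      show "cspace.dd (Ez m) a ?p = - \<i> * (2 * of_real (H m (n - m))) * \<sigma> + (- \<i> * (2 * of_real (H m (n - l)))) * \<tau>"
        unfolding Da[OF p p] sum_zc_two[OF lm] by (simp add: algebra_simps)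
    qed simp_all
    then show ?thesis using lm by (simp add: q_def)
  qed (auto simp: q_def)
  \<comment> \<open>The real constant in the coefficient of \<open>z_k\<close> in
    \<open>b (n - l)\<close>. Reversing one index makes the tangency identities symmetric in
    \<open>l\<close> and \<open>k\<close>.\<close>
  define g where "g l k = (if k \<in> K then G k (n - l) else 0)" for l k
  define C where "C s t = Re (c (0, 0, Complex s t))" for s t
  have R: "A * ((if l + k = n then 1 else 0) - s * (if l + k = n - 1 then 1 else 0)) =
      (g l k - t * q k (l + 1)) - s * (g l (k + 1) - t * q (k + 1) (l + 1)) +
      (g k l - t * q l (k + 1)) - s * (g k (l + 1) - t * q (l + 1) (k + 1)) +
      C s t * (if l + k = n - 1 then 1 else 0)"
    if lk: "l \<in> K" "k \<in> K" and st: "norm (Complex s t) < r" for l k s t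
  proof -
    \<comment> \<open>The real part of the coefficient of \<open>z_l\<close> in \<open>b j\<close>;
      the \<open>t\<close> is the imaginary part of \<open>\<zeta>\<close>, multiplied by
      \<open>\<i>\<close>.\<close>
    define M where "M l j = (if l \<in> K then G l j - t * H l (j - 1) else 0)" for l j
    have Mg: "M i (n - m) = g m i - t * q i (m + 1)" for m i
      by (cases "i \<in> K") (simp_all add: M_def g_def qH, simp add: q_def)
    have "A * PP x s = (\<Sum>j\<in>K. PD x s j * (\<Sum>l\<in>K. x l * M l j)) + PS x s * C s t" for x
    proof -
      let ?p = "pt (of_real (PP x (Re (Complex s t)))) (\<lambda>j. of_real (x j)) (Complex s t)"
      note T = tangency_real[OF X st, of x]
      have "(\<Sum>l\<in>K. \<Sum>m\<in>K. of_real (H l (n - m)) * zc l ?p * zc m ?p)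
          = of_real (\<Sum>l\<in>K. \<Sum>m\<in>K. H l (n - m) * x l * x m)"
        by simp
      then have "Re (a ?p) = A * PP x s"
        unfolding a[OF T(2)] by (simp del: of_real_sum)
      moreover have "Re (b j ?p) = (\<Sum>l\<in>K. x l * M l j)" if "j \<in> K" for j
        unfolding b[OF that T(2)] Re_sum by (intro sum.cong refl) (simp add: M_def algebra_simps)
      moreover have "c ?p = c (0, 0, Complex s t)"
        using whom_0_eq[OF D(3) D(6) T(2)] by simp
      ultimately show ?thesis using T(1) by (simp add: C_def)
    qed
    from quadratic_tangency_reduced[OF this _ lk] show ?thesis
      unfolding Mg by (simp add: M_def)
  qed
  show thesis
  proof (rule quadratic_coeffs_zero[OF r q_sym _ R])
    show "q l k = 0" if "l \<notin> K" for l k using that by (simp add: q_def)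
  next
    assume q: "\<And>l k. l \<noteq> 1 \<or> k \<noteq> 1 \<Longrightarrow> q l k = 0"
      and Cst: "\<And>s t. norm (Complex s t) < r \<Longrightarrow> C s t = - (g 1 (n - 2) + g (n - 2) 1) + (g 1 (n - 1) + g (n - 2) 2 - A) * s"
      and F1: "\<And>l k. l \<in> K \<Longrightarrow> k \<in> K \<Longrightarrow> l + k \<noteq> n - 1 \<Longrightarrow> g l k + g k l = (if l + k = n then A else 0)"
      and F2: "\<And>l k. l \<in> K \<Longrightarrow> k \<in> K \<Longrightarrow> l + k \<noteq> n - 1 \<Longrightarrow> g l (k + 1) + g k (l + 1) = 0"
      and F3: "\<And>l k. l \<in> K \<Longrightarrow> k \<in> K \<Longrightarrow> l + k = n - 1 \<Longrightarrow> g l k + g k l = g 1 (n - 2) + g (n - 2) 1"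
      and F4: "\<And>l k. l \<in> K \<Longrightarrow> k \<in> K \<Longrightarrow> l + k = n - 1 \<Longrightarrow> g l (k + 1) + g k (l + 1) = g 1 (n - 1) + g (n - 2) 2"
    \<comment> \<open>Matching with the generators: the \<open>\<zeta>\<close>-components of
      \<open>X_\<zeta>\<close> and \<open>U\<^sub>0\<close> are 2 and \<open>\<zeta>\<close>, which
      gives \<open>\<xi>\<close> and \<open>\<upsilon>\<close> from \<open>C\<close>; the
      \<open>w\<close>-components of \<open>U\<^sub>0\<close> and \<open>V\<^sub>0\<close> give
      \<open>A = n * \<upsilon> + 2 * v\<close>.\<close>
    define \<upsilon> where "\<upsilon> = g 1 (n - 1) + g (n - 2) 2 - A"
    define \<xi> where "\<xi> = - (g 1 (n - 2) + g (n - 2) 1) / 2"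
    define v where "v = (A - real n * \<upsilon>) / 2"
    define \<rho> where "\<rho> = - q 1 1"
    have v2: "2 * v = A - \<upsilon> * real n" and \<xi>2: "2 * \<xi> = - (g 1 (n - 2) + g (n - 2) 1)"
      by (simp_all add: v_def \<xi>_def)
    have "Re (c (0, 0, \<zeta>)) = 2 * \<xi> + \<upsilon> * Re \<zeta>" if "norm \<zeta> < r" for \<zeta>
      using Cst[of "Re \<zeta>" "Im \<zeta>"] that by (simp add: C_def \<xi>_def \<upsilon>_def)
    from affine_if_Re_affine[OF zeta_line_holomorphic[OF D(3)] r this] obtain \<gamma> :: real
      where \<gamma>: "\<And>\<zeta>. norm \<zeta> < r \<Longrightarrow> c (0, 0, \<zeta>) = of_real (2 * \<xi>) + of_real \<upsilon> * \<zeta> + \<i> * of_real \<gamma>" by blast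
    have c: "c p = of_real (2 * \<xi>) + \<i> * of_real \<gamma> + of_real \<upsilon> * snd (snd p)" if "p \<in> tube r" for p
      using \<gamma>[of "snd (snd p)"] that by (subst whom_0_eq[OF D(3) D(6) that]) (simp add: tube_def)
    \<comment> \<open>The real part of \<open>bm \<xi> \<upsilon> v \<rho> (n - l) k\<close>, in the
      indexing of \<open>g\<close>.\<close>
    define model where "model l k = (if l + k = n - 1 then \<xi> * (real n - 2 * real l - 2) else 0) +
        (if l + k = n then \<upsilon> * (real n - real l) + v else 0)" for l k
    have g: "g l k = model l k" if lk: "l \<in> K" "k \<in> K" for l k
    proof -
      have "g l k - model l k = 0"
      \<comment> \<open>\<open>model\<close> satisfies the same inhomogeneous relations
        \<open>F1\<close> to \<open>F4\<close> as \<open>g\<close>, so the difference satisfies the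
        homogeneous ones.\<close>
      proof (rule antisymmetric_shift_zero[where n = n and d = "\<lambda>l k. g l k - model l k"])
        fix l k assume lk: "0 < l" "l < n" "0 < k" "k < n"
        then have K: "l \<in> K" "k \<in> K" by (auto simp: K_iff)
        have "model l k + model k l = g l k + g k l"
        proof -
          consider (1) "l + k = n - 1" "l + k \<noteq> n" "real l + real k = real n - 1"
            | (2) "l + k = n" "l + k \<noteq> n - 1" "real l + real k = real n" | (3) "l + k \<noteq> n - 1" "l + k \<noteq> n"
            using n_gt by (cases "l + k = n - 1"; cases "l + k = n") auto
          then show ?thesis
          proof cases
            case 1
            have kl: "k + l = n - 1" "k + l \<noteq> n" using 1(1,2) by simp_all
            have "model l k + model k l = \<xi> * (2 * real n - 2 * (real l + real k) - 4)"
              unfolding model_def using 1(1,2) kl by (simp add: algebra_simps)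
            then show ?thesis using F3[OF K 1(1)] \<xi>2 unfolding 1(3) by (simp add: algebra_simps)
          next
            case 2
            have kl: "k + l = n" "k + l \<noteq> n - 1" using 2(1,2) by simp_all
            have "model l k + model k l = \<upsilon> * (2 * real n - (real l + real k)) + 2 * v"
              unfolding model_def using 2(1,2) kl by (simp add: algebra_simps)
            then show ?thesis using F1[OF K 2(2)] 2(1) unfolding 2(3) v2 by (simp add: algebra_simps)
          next
            case 3
            then have kl: "k + l \<noteq> n" "k + l \<noteq> n - 1" by simp_all
            show ?thesis using F1[OF K 3(1)] 3 kl unfolding model_def by simp
          qed
        qed
        then show "(g l k - model l k) + (g k l - model k l) = 0" by simp
      next
        fix l k assume lk: "0 < l" "l + 1 < n" "0 < k" "k + 1 < n"
        then have K: "l \<in> K" "k \<in> K" by (auto simp: K_iff)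
        have "model l (k + 1) + model k (l + 1) = g l (k + 1) + g k (l + 1)"
        proof -
          consider (1) "l + k = n - 1" "l + (k + 1) = n" "l + (k + 1) \<noteq> n - 1" "real l + real k = real n - 1"
            | (2) "l + k \<noteq> n - 1" "l + (k + 1) = n - 1" "l + (k + 1) \<noteq> n" "real l + real k = real n - 2"
            | (3) "l + k \<noteq> n - 1" "l + (k + 1) \<noteq> n - 1" "l + (k + 1) \<noteq> n"
            using n_gt by (cases "l + k = n - 1"; cases "l + (k + 1) = n - 1") auto
          then show ?thesis
          proof cases
            case 1
            have kl: "k + (l + 1) = n" "k + (l + 1) \<noteq> n - 1" using 1(2,3) by simp_all
            have "model l (k + 1) + model k (l + 1) = \<upsilon> * (2 * real n - (real l + real k)) + 2 * v"
              unfolding model_def using 1(2,3) kl by (simp add: algebra_simps)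
            then show ?thesis using F4[OF K 1(1)] unfolding 1(4) v2 by (simp add: \<upsilon>_def algebra_simps)
          next
            case 2
            have kl: "k + (l + 1) = n - 1" "k + (l + 1) \<noteq> n" using 2(2,3) by simp_all
            have "model l (k + 1) + model k (l + 1) = \<xi> * (2 * real n - 2 * (real l + real k) - 4)"
              unfolding model_def using 2(2,3) kl by (simp add: algebra_simps)
            then show ?thesis using F2[OF K 2(1)] unfolding 2(4) by (simp add: algebra_simps)
          next
            case 3
            then have kl: "k + (l + 1) \<noteq> n - 1" "k + (l + 1) \<noteq> n" by simp_all
            show ?thesis using F2[OF K 3(1)] 3(2,3) kl unfolding model_def by simp
          qed
        qed
        then show "(g l (k + 1) - model l (k + 1)) + (g k (l + 1) - model k (l + 1)) = 0" by simp
      qed (use lk in \<open>auto simp: K_iff\<close>)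
      then show ?thesis by simp
    qed
    have G: "G l j = (if l + 1 = j then \<xi> * (2 * real j - 2 - real n) else 0) + (if l = j then \<upsilon> * real j + v else 0)"
      if lj: "l \<in> K" "j \<in> K" for l j
    proof -
      have j: "0 < j" "j < n" using lj by (auto simp: K_iff)
      have "G l j = g (n - j) l" using lj j by (simp add: g_def)
      also have "\<dots> = model (n - j) l" by (rule g) (use lj j in \<open>auto simp: K_iff\<close>)
      also have "model (n - j) l = (if l + 1 = j then \<xi> * (2 * real j - 2 - real n) else 0) + (if l = j then \<upsilon> * real j + v else 0)"
      proof -
        have "n - j + l = n - 1 \<longleftrightarrow> l + 1 = j" "n - j + l = n \<longleftrightarrow> l = j" using j by auto
        then show ?thesis using j unfolding model_def by (simp add: of_nat_diff algebra_simps)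
      qed
      finally show ?thesis .
    qed
    have HR: "H l j = (if j = n - 1 \<and> l = 1 then - \<rho> else 0)" "H l (j - 1) = 0" if lj: "l \<in> K" "j \<in> K" for l j
    proof -
      have j: "0 < j" "j < n" using lj by (auto simp: K_iff)
      have "q l (n - j) = H l j" using qH[OF lj(1), of "n - j"] j by simp
      moreover have "n - j = 1 \<longleftrightarrow> j = n - 1" using j by auto
      ultimately show "H l j = (if j = n - 1 \<and> l = 1 then - \<rho> else 0)"
        using q[of l "n - j"] by (auto simp: \<rho>_def)
      have "q l (n - (j - 1)) = H l (j - 1)" using qH[OF lj(1), of "n - (j - 1)"] j by simp
      moreover have "n - (j - 1) \<noteq> 1" using j by auto
      ultimately show "H l (j - 1) = 0" using q[of l "n - (j - 1)"] by simp
    qed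
    have b': "b j p = (\<Sum>l\<in>K. bm \<xi> \<upsilon> v \<rho> j l * zc l p)" if j: "j \<in> K" and p: "p \<in> tube r" for j p
      unfolding b[OF j p]
    proof (intro sum.cong refl)
      fix l assume l: "l \<in> K"
      have "- \<i> * (of_real (H l j) - snd (snd p) * of_real (H l (j - 1)) + \<i> * of_real (G l j))
         = of_real (G l j) + \<i> * of_real (- H l j)"
        unfolding HR(2)[OF l j] by (simp add: algebra_simps)
      also have "\<dots> = bm \<xi> \<upsilon> v \<rho> j l" unfolding HR(1)[OF l j] G[OF l j] bm_def by simp
      finally show "zc l p * (- \<i> * (of_real (H l j) - snd (snd p) * of_real (H l (j - 1)) + \<i> * of_real (G l j)))
         = bm \<xi> \<upsilon> v \<rho> j l * zc l p" by simp
    qed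
    have a': "a p = of_real (real n * \<upsilon> + 2 * v) * fst p + \<i> * of_real \<rho> * (zc 1 p)\<^sup>2" if p: "p \<in> tube r" for p
    proof -
      have "(\<Sum>l\<in>K. \<Sum>m\<in>K. of_real (H l (n - m)) * zc l p * zc m p)
         = (\<Sum>l\<in>K. if l = 1 then (\<Sum>m\<in>K. if m = 1 then - of_real \<rho> * zc l p * zc m p else 0) else 0)"
      proof (intro sum.cong refl)
        fix l assume l: "l \<in> K"
        have "of_real (H l (n - m)) * zc l p * zc m p
            = (if l = 1 \<and> m = 1 then - of_real \<rho> * zc l p * zc m p else 0)" if "m \<in> K" for m
          using qH[OF l, of m] q[of l m] that by (auto simp: \<rho>_def K_iff)
        then have "(\<Sum>m\<in>K. of_real (H l (n - m)) * zc l p * zc m p)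
            = (\<Sum>m\<in>K. if l = 1 \<and> m = 1 then - of_real \<rho> * zc l p * zc m p else 0)"
          by (intro sum.cong refl)
        then show "(\<Sum>m\<in>K. of_real (H l (n - m)) * zc l p * zc m p)
            = (if l = 1 then (\<Sum>m\<in>K. if m = 1 then - of_real \<rho> * zc l p * zc m p else 0) else 0)"
          by (cases "l = 1") simp_all
      qed
      also have "\<dots> = - of_real \<rho> * (zc 1 p)\<^sup>2"
        using n_gt by (simp add: K_iff power2_eq_square)
      finally show ?thesis
        unfolding a[OF p] v2 by simp
    qed
    show thesis by (rule that[OF a' b' c])
  qed
qed

section \<open>Symmetries of positive weight\<close>

lemma small_in_K: "1 \<in> K" "2 \<in> K" "3 \<in> K" "4 \<in> K" "n - 1 \<in> K" "n - 2 \<in> K" "n - 3 \<in> K"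
  using n_gt by (auto simp: K_iff)

lemma pc_zero: "j \<in> K \<Longrightarrow> k \<in> K \<Longrightarrow> pc 0 j k = (if k = n - j then 1 else 0)"
  by (auto simp: pc_def K_iff)

lemma PD_zero: "j \<in> K \<Longrightarrow> PD x 0 j = 2 * x (n - j)"
proof -
  assume j: "j \<in> K"
  have "(\<Sum>k\<in>K. pc 0 j k * x k) = (\<Sum>k\<in>K. if k = n - j then x k else 0)"
    by (intro sum.cong refl) (simp add: pc_zero[OF j])
  then show ?thesis using j by (simp add: PD_def K_iff)
qed

lemma PP_zero: "PP x 0 = (\<Sum>j\<in>K. x j * x (n - j))"
proof -
  have "(\<Sum>k\<in>K. pc 0 j k * x j * x k) = x j * x (n - j)" if j: "j \<in> K" for j
  proof -
    have "(\<Sum>k\<in>K. pc 0 j k * x j * x k) = (\<Sum>k\<in>K. if k = n - j then x j * x k else 0)"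
      by (intro sum.cong refl) (simp add: pc_zero[OF j])
    then show ?thesis using j by (simp add: K_iff)
  qed
  then show ?thesis by (simp add: PP_def)
qed

lemma PS_zero: "PS x 0 = (\<Sum>j\<in>K. if j < n - 1 then x j * x (n - 1 - j) else 0)"
proof -
  have "(\<Sum>k\<in>K. pc' 0 j k * x j * x k) = (if j < n - 1 then x j * x (n - 1 - j) else 0)" if j: "j \<in> K" for j
  proof -
    have "pc' 0 j k = (if k = n - 1 - j then 1 else 0)" if k: "k \<in> K" for k
    proof (cases "j + k < n - 1")
      case True
      then have "n - j - k - 1 \<noteq> 0" by linarith
      then show ?thesis using True by (simp add: pc'_def)
    next
      case False
      then have "k = n - 1 - j \<longleftrightarrow> j + k = n - 1" using j k by (auto simp: K_iff)
      moreover have "pc' 0 j k = (if j + k = n - 1 then 1 else 0)"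
        using False n_gt j k by (cases "j + k = n - 1"; cases "j + k = n") (auto simp: pc'_def K_iff)
      ultimately show ?thesis by simp
    qed
    then have "(\<Sum>k\<in>K. pc' 0 j k * x j * x k) = (\<Sum>k\<in>K. if k = n - 1 - j then x j * x k else 0)"
      by (intro sum.cong refl) simp
    then show ?thesis using j by (auto simp: K_iff)
  qed
  then show ?thesis by (simp add: PS_def)
qed

lemma PS_zero_pos:
  assumes "\<And>i. x i \<ge> 0" "j \<in> K" "j < n - 1" "x j > 0" "x (n - 1 - j) > 0"
  shows "PS x 0 > 0"
proof -
  let ?f = "\<lambda>j. if j < n - 1 then x j * x (n - 1 - j) else 0"
  have "0 < ?f j" using assms(3-5) by simp
  also have "\<dots> \<le> (\<Sum>j\<in>K. ?f j)"
    by (rule member_le_sum[OF assms(2)]) (use assms(1) in auto)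
  finally show ?thesis by (simp add: PS_zero)
qed

text \<open>\<open>PS x 0\<close> does not contain x_(n-1), and \<open>PP x 0\<close> contains it
  only in the term 2 x_1 x_(n-1). Comparing the identity at \<open>y\<close> and at \<open>y\<close>
  plus the last unit vector gives \<open>key\<close>; test vectors do the rest.\<close>

lemma cubic_zero:
  assumes eq: "\<And>x. 2 * PP x 0 * (\<Sum>j\<in>K. g j * x j) + PS x 0 * (\<Sum>j\<in>K. h j * x j) = 0"
    and i: "i \<in> K"
  shows "g i = 0" "h i = 0"
proof -
  define \<delta> where "\<delta> = (\<lambda>i j :: nat. if j = i then 1 else 0 :: real)"
  define L where "L = (\<lambda>(f :: nat \<Rightarrow> real) x. \<Sum>j\<in>K. f j * x j)"
  have L_add: "L f (\<lambda>i. x i + t * y i) = L f x + t * L f y" for f x y t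
    by (simp add: L_def algebra_simps sum.distrib sum_distrib_left)
  have L_\<delta>: "L f (\<delta> i) = f i" if "i \<in> K" for f i
  proof -
    have "L f (\<delta> i) = (\<Sum>j\<in>K. if j = i then f j else 0)"
      unfolding L_def \<delta>_def by (intro sum.cong refl) simp
    then show ?thesis using that by simp
  qed
  have eqL: "2 * PP x 0 * L g x + PS x 0 * L h x = 0" for x
    using eq[of x] by (simp add: L_def)
  have key: "4 * y 1 * L g y + 4 * y 1 * g (n - 1) + PS y 0 * h (n - 1)
      + 2 * PP y 0 * g (n - 1) = 0"
    if y: "y (n - 1) = 0" for y
  proof -
    have PS: "PS (\<lambda>i. y i + t * \<delta> (n - 1) i) 0 = PS y 0" for t
      unfolding PS_zero by (intro sum.cong refl) (auto simp: \<delta>_def K_iff)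
    have PP: "PP (\<lambda>i. y i + t * \<delta> (n - 1) i) 0 = PP y 0 + 2 * t * y 1" for t
    proof -
      have "(y j + t * \<delta> (n - 1) j) * (y (n - j) + t * \<delta> (n - 1) (n - j)) =
          y j * y (n - j) + (if j = n - 1 then t * y 1 else 0) + (if j = 1 then t * y 1 else 0)" if "j \<in> K" for j
      proof -
        have "n - j = n - 1 \<longleftrightarrow> j = 1" "j = n - 1 \<Longrightarrow> n - j = 1" "1 \<noteq> n - 1" using that n_gt by (auto simp: K_iff)
        then show ?thesis using y by (auto simp: \<delta>_def algebra_simps)
      qed
      then have "PP (\<lambda>i. y i + t * \<delta> (n - 1) i) 0
          = (\<Sum>j\<in>K. y j * y (n - j) + (if j = n - 1 then t * y 1 else 0) + (if j = 1 then t * y 1 else 0))"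
        unfolding PP_zero by (intro sum.cong refl)
      then show ?thesis using small_in_K by (simp add: sum.distrib PP_zero)
    qed
    have e: "2 * (PP y 0 + 2 * t * y 1) * (L g y + t * g (n - 1)) + PS y 0 * (L h y + t * h (n - 1)) = 0" for t
    proof -
      have "L f (\<lambda>i. y i + t * \<delta> (n - 1) i) = L f y + t * f (n - 1)" for f
        using L_add[of f y t "\<delta> (n - 1)"] L_\<delta>[OF small_in_K(5), of f] by simp
      then show ?thesis
        using eqL[of "\<lambda>i. y i + t * \<delta> (n - 1) i"] PS[of t] PP[of t] by simp
    qed
    show ?thesis using e[of 0] e[of 1] by (simp add: algebra_simps)
  qed
  have PP_\<delta>1: "PP (\<delta> 1) 0 = 0" "PS (\<delta> 1) 0 = 0"
    unfolding PP_zero PS_zero using n_gt by (auto intro!: sum.neutral simp: \<delta>_def K_iff)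
  have gn: "g (n - 1) = 0"
  proof -
    have "(n - 1 = 1) = False" using n_gt by auto
    then have 0: "\<delta> 1 (n - 1) = 0" "2 * \<delta> 1 (n - 1) = 0" by (simp_all add: \<delta>_def)
    have 1: "4 * g 1 + 4 * g (n - 1) = 0"
      using key[of "\<delta> 1", OF 0(1)] PP_\<delta>1 L_\<delta>[OF small_in_K(1)] by (simp add: \<delta>_def)
    have "L g (\<lambda>i. 0 + 2 * \<delta> 1 i) = 2 * g 1"
      unfolding L_add L_\<delta>[OF small_in_K(1)] by (simp add: L_def)
    moreover have "PP (\<lambda>i. 2 * \<delta> 1 i) 0 = 0" "PS (\<lambda>i. 2 * \<delta> 1 i) 0 = 0"
      unfolding PP_zero PS_zero using n_gt by (auto intro!: sum.neutral simp: \<delta>_def K_iff)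
    \<comment> \<open>\<open>key\<close> mixes terms of degrees 1 and 2 in \<open>y\<close>, so the
      first unit vector and its double give independent equations.\<close>
    ultimately have 2: "16 * g 1 + 8 * g (n - 1) = 0"
      using key[of "\<lambda>i. 2 * \<delta> 1 i", OF 0(2)] by (simp add: \<delta>_def)
    show ?thesis using 1 2 by simp
  qed
  have key': "4 * y 1 * L g y + PS y 0 * h (n - 1) = 0" if "y (n - 1) = 0" for y
    using key[of y] that gn by simp
  have hn: "h (n - 1) = 0"
  proof -
    \<comment> \<open>The indices 2 and n - 3 add up to n - 1, so \<open>PS\<close> is positive; n >
      4 keeps n - 3 away from 1, so the term with \<open>y 1\<close> drops out.\<close>
    let ?y = "\<lambda>i. \<delta> 2 i + 1 * \<delta> (n - 3) i"
    have "PS ?y 0 > 0"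
      by (rule PS_zero_pos[of _ 2]) (use small_in_K n_gt in \<open>auto simp: \<delta>_def\<close>)
    moreover have "?y (n - 1) = 0" "?y 1 = 0" using n_gt by (auto simp: \<delta>_def)
    ultimately show ?thesis using key'[of ?y] by simp
  qed
  have g: "g k = 0" if k: "k \<in> K" for k
  proof -
    have g1: "g 1 = 0"
      using key'[of "\<delta> 1"] hn n_gt L_\<delta>[OF small_in_K(1)] by (simp add: \<delta>_def)
    show ?thesis
    proof (cases "k = n - 1 \<or> k = 1")
      case True
      then show ?thesis using g1 gn by auto
    next
      case False
      let ?y = "\<lambda>i. \<delta> 1 i + 1 * \<delta> k i"
      have "?y (n - 1) = 0" "?y 1 = 1" using n_gt False by (auto simp: \<delta>_def)
      then show ?thesis
        using key'[of ?y] hn g1 unfolding L_add L_\<delta>[OF small_in_K(1)] L_\<delta>[OF k] by simp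
    qed
  qed
  have h0: "PS x 0 * L h x = 0" for x
  proof -
    have "(\<Sum>j\<in>K. g j * x j) = 0" by (intro sum.neutral ballI) (simp add: g)
    then show ?thesis using eqL[of x] by (simp add: L_def)
  qed
  have h: "h k = 0" if k: "k \<in> K" for k
  proof -
    \<comment> \<open>As 1 + (n - 2) = n - 1, \<open>PS\<close> is positive with or without the k-th
      unit vector added; the linear form vanishes at both points.\<close>
    let ?y = "\<lambda>i. \<delta> 1 i + 1 * \<delta> (n - 2) i"
    have "PS ?y 0 > 0"
      by (rule PS_zero_pos[of _ 1]) (use small_in_K n_gt in \<open>auto simp: \<delta>_def\<close>)
    then have 1: "L h ?y = 0" using h0[of ?y] by simp
    have "PS (\<lambda>i. ?y i + 1 * \<delta> k i) 0 > 0"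
      by (rule PS_zero_pos[of _ 1]) (use small_in_K n_gt in \<open>auto simp: \<delta>_def\<close>)
    then have "L h (\<lambda>i. ?y i + 1 * \<delta> k i) = 0" using h0[of "\<lambda>i. ?y i + 1 * \<delta> k i"] by simp
    then show ?thesis using 1 unfolding L_add[of h ?y] L_\<delta>[OF k] by simp
  qed
  show "g i = 0" "h i = 0" using g h i by auto
qed

lemma Re_bm: "Re (bm \<xi> \<upsilon> v \<rho> j l) = (if l + 1 = j then \<xi> * (2 * real j - 2 - real n) else 0) +
      (if l = j then \<upsilon> * real j + v else 0)"
  and Im_bm: "Im (bm \<xi> \<upsilon> v \<rho> j l) = (if j = n - 1 \<and> l = 1 then \<rho> else 0)"
  by (simp_all add: bm_def)

text \<open>Symmetry of \<open>bm\<close> in \<open>k, l\<close> is the integrability condition for the \<open>b\<^sub>j\<close> of a weight 1 field,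
  whose \<open>z\<^sub>k\<close>-derivatives have weight 0.\<close>

lemma bm_integrable:
  fixes \<xi> \<upsilon> v \<rho> :: "nat \<Rightarrow> real"
  assumes sym: "\<And>j k l. j \<in> K \<Longrightarrow> k \<in> K \<Longrightarrow> l \<in> K \<Longrightarrow>
      bm (\<xi> k) (\<upsilon> k) (v k) (\<rho> k) j l = bm (\<xi> l) (\<upsilon> l) (v l) (\<rho> l) j k"
    and l: "l \<in> K"
  shows "\<xi> l = 0" "\<upsilon> l = 0" "v l = 0" "l \<noteq> 1 \<Longrightarrow> \<rho> l = 0"
proof -
  have uv: "\<upsilon> k * real j + v k = 0" if "k \<in> K" "j \<in> K" "j \<noteq> k" "j \<noteq> k + 1" for k j
    using arg_cong[OF sym[OF that(2,1,2)], of Re] that(3,4) unfolding Re_bm by simp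
  have uv0: "\<upsilon> k = 0 \<and> v k = 0" if k: "k \<in> K" for k
  proof -
    \<comment> \<open>By \<open>uv\<close> an affine function of the index vanishes outside {k, k +
      1}; two such indices force it to be 0, and they exist because \<open>K\<close> has at least
      four elements.\<close>
    have "\<exists>i\<in>K. \<exists>j\<in>K. i < j \<and> i \<noteq> k \<and> i \<noteq> k + 1 \<and> j \<noteq> k \<and> j \<noteq> k + 1"
    proof -
      consider "k = 1" | "k = 2" | "k \<ge> 3" using k by (force simp: K_iff)
      then show ?thesis
      proof cases
        case 1
        then show ?thesis using small_in_K by (intro bexI[of _ 3] bexI[of _ 4]) auto
      next
        case 2
        then show ?thesis using small_in_K by (intro bexI[of _ 1] bexI[of _ 4]) auto
      next
        case 3
        then show ?thesis using small_in_K by (intro bexI[of _ 1] bexI[of _ 2]) auto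
      qed
    qed
    then obtain i j where ij: "i \<in> K" "j \<in> K" "i < j" "i \<noteq> k" "i \<noteq> k + 1" "j \<noteq> k" "j \<noteq> k + 1"
      by blast
    have "\<upsilon> k * (real j - real i) = 0"
      using uv[OF k ij(1,4,5)] uv[OF k ij(2,6,7)] unfolding right_diff_distrib by linarith
    then have "\<upsilon> k = 0" using ij(3) by simp
    then show ?thesis using uv[OF k ij(1,4,5)] by simp
  qed
  show "\<upsilon> l = 0" "v l = 0" using uv0[OF l] by auto
  show "\<rho> l = 0" if "l \<noteq> 1"
    using arg_cong[OF sym[OF small_in_K(5) l small_in_K(1)], of Im] that unfolding Im_bm by simp
  have x: "\<xi> l * (2 * real j - 2 - real n) = 0" if j: "j \<in> K" "j \<ge> 2" "j \<noteq> l + 1" for j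
  proof -
    have K: "j - 1 \<in> K" and j1: "j - 1 + 1 = j" "j - 1 \<noteq> j" "l \<noteq> j - 1" "l + 1 \<noteq> j" using j by (auto simp: K_iff)
    show ?thesis
      using arg_cong[OF sym[OF j(1) l K], of Re] uv0[OF K] uv0[OF l] j1 unfolding Re_bm by simp
  qed
  \<comment> \<open>The factors are 4 - n for \<open>j = 3\<close> and 2 - n for
    \<open>j = 2\<close>; both are nonzero as n > 4.\<close>
  show "\<xi> l = 0"
  proof (cases "l = 1")
    case True
    then show ?thesis using x[of 3] small_in_K n_gt by simp
  next
    case False
    then show ?thesis using x[of 2] small_in_K n_gt by simp
  qed
qed

lemma graded_1:
  assumes X: "graded_symmetry r 1 a b c" and r: "r > 0"
  shows "\<forall>p\<in>tube r. a p = 0 \<and> (\<forall>j\<in>K. b j p = 0) \<and> c p = 0"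
proof -
  note D = graded_symmetryD[OF X]
  define P where "P l \<xi> \<upsilon> v \<gamma> \<rho> \<longleftrightarrow>
      (\<forall>p\<in>tube r. cspace.dd (cscale \<i> (Ez l)) a p = of_real (real n * \<upsilon> + 2 * v) * fst p + \<i> * of_real \<rho> * (zc 1 p)\<^sup>2) \<and>
      (\<forall>j\<in>K. \<forall>p\<in>tube r. cspace.dd (cscale \<i> (Ez l)) (b j) p = (\<Sum>m\<in>K. bm \<xi> \<upsilon> v \<rho> j m * zc m p)) \<and>
      (\<forall>p\<in>tube r. cspace.dd (cscale \<i> (Ez l)) c p = of_real (2 * \<xi>) + \<i> * of_real \<gamma> + of_real \<upsilon> * snd (snd p))"
    for l \<xi> \<upsilon> v \<gamma> \<rho>
  have "\<exists>\<xi> \<upsilon> v \<gamma> \<rho>. P l \<xi> \<upsilon> v \<gamma> \<rho>" for l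
  proof -
    from graded_symmetry_z[OF X, of l] have "graded_symmetry r 0 (cspace.dd (cscale \<i> (Ez l)) a)
      (\<lambda>j. cspace.dd (cscale \<i> (Ez l)) (b j)) (cspace.dd (cscale \<i> (Ez l)) c)" by simp
    then show ?thesis
    proof (rule graded_0[OF _ r])
      fix \<xi> \<upsilon> v \<gamma> \<rho> :: real
      assume "\<And>p. p \<in> tube r \<Longrightarrow> cspace.dd (cscale \<i> (Ez l)) a p =
          of_real (real n * \<upsilon> + 2 * v) * fst p + \<i> * of_real \<rho> * (zc 1 p)\<^sup>2"
        "\<And>j p. j \<in> K \<Longrightarrow> p \<in> tube r \<Longrightarrow> cspace.dd (cscale \<i> (Ez l)) (b j) p = (\<Sum>m\<in>K. bm \<xi> \<upsilon> v \<rho> j m * zc m p)"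
        "\<And>p. p \<in> tube r \<Longrightarrow> cspace.dd (cscale \<i> (Ez l)) c p = of_real (2 * \<xi>) + \<i> * of_real \<gamma> + of_real \<upsilon> * snd (snd p)"
      then have "P l \<xi> \<upsilon> v \<gamma> \<rho>" unfolding P_def by blast
      then show ?thesis by blast
    qed
  qed
  then obtain \<xi> \<upsilon> v \<gamma> \<rho> where P: "\<And>l. P l (\<xi> l) (\<upsilon> l) (v l) (\<gamma> l) (\<rho> l)" by metis
  then have Dia: "\<And>l p. p \<in> tube r \<Longrightarrow> cspace.dd (cscale \<i> (Ez l)) a p =
        of_real (real n * \<upsilon> l + 2 * v l) * fst p + \<i> * of_real (\<rho> l) * (zc 1 p)\<^sup>2"
    and Dib: "\<And>l j p. j \<in> K \<Longrightarrow> p \<in> tube r \<Longrightarrow> cspace.dd (cscale \<i> (Ez l)) (b j) p =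
        (\<Sum>m\<in>K. bm (\<xi> l) (\<upsilon> l) (v l) (\<rho> l) j m * zc m p)"
    and Dic: "\<And>l p. p \<in> tube r \<Longrightarrow> cspace.dd (cscale \<i> (Ez l)) c p =
        of_real (2 * \<xi> l) + \<i> * of_real (\<gamma> l) + of_real (\<upsilon> l) * snd (snd p)"
    unfolding P_def by blast+
  note Da = dd_eqI[OF D(1) _ Dia] and Db = dd_eqI[OF D(2) _ Dib] and Dc = dd_eqI[OF D(3) _ Dic]
  let ?B = "\<lambda>l. bm (\<xi> l) (\<upsilon> l) (v l) (\<rho> l)"
  have B_sym: "?B k j l = ?B l j k" if j: "j \<in> K" and kl: "k \<in> K" "l \<in> K" for j k l
  proof -
    have "- \<i> * ?B k j l = - \<i> * ?B l j k"
    proof (rule mixed_dd_coeff[OF D(2)[OF j] r, of "Ez k" "Ez l" 0 "- \<i> * ?B k j k" _ "\<lambda>\<sigma>. - \<i> * ?B l j l * \<sigma>"])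
      fix \<tau> \<sigma> :: complex
      let ?p = "cscale \<tau> (Ez k) + cscale \<sigma> (Ez l)"
      have p: "?p \<in> tube r" by (rule in_tube_line[OF r]) simp_all
      show "cspace.dd (Ez k) (b j) ?p = 0 + (- \<i> * ?B k j k) * \<tau> + (- \<i> * ?B k j l) * \<sigma>"
        unfolding Db[OF j p j p] sum_zc_two[OF kl] by (simp add: algebra_simps)
      show "cspace.dd (Ez l) (b j) ?p = - \<i> * ?B l j l * \<sigma> + (- \<i> * ?B l j k) * \<tau>"
        unfolding Db[OF j p j p] sum_zc_two[OF kl] by (simp add: algebra_simps)
    qed simp_all
    then show ?thesis by simp
  qed
  have params: "\<xi> l = 0" "\<upsilon> l = 0" "v l = 0" "l \<noteq> 1 \<Longrightarrow> \<rho> l = 0" if "l \<in> K" for l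
  proof -
    show "\<xi> l = 0" "\<upsilon> l = 0" "v l = 0"
      by (rule bm_integrable(1-3)[of \<xi> \<upsilon> v \<rho>], rule B_sym, assumption+, rule that)+
    show "\<rho> l = 0" if "l \<noteq> 1"
      by (rule bm_integrable(4)[of \<xi> \<upsilon> v \<rho>], rule B_sym, assumption+, rule \<open>l \<in> K\<close>, rule that)
  qed
  \<comment> \<open>Only \<open>\<rho> 1\<close> survives integrability; tangency will exclude
    it.\<close>
  have \<rho>: "\<rho> l = (if l = 1 then \<rho> 1 else 0)" if "l \<in> K" for l
    using params(4)[OF that] by simp
  have Db': "cspace.dd (Ez l) (b j) p = (if l = 1 \<and> j = n - 1 then of_real (\<rho> 1) * zc 1 p else 0)"
    if l: "l \<in> K" and j: "j \<in> K" and p: "p \<in> tube r" for l j p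
  proof -
    have "(\<Sum>m\<in>K. ?B l j m * zc m p) = (\<Sum>m\<in>K. if m = 1 then (if l = 1 \<and> j = n - 1 then \<i> * of_real (\<rho> 1) * zc 1 p else 0) else 0)"
      by (intro sum.cong refl) (simp add: bm_def params(1-3)[OF l] \<rho>[OF l])
    then show ?thesis unfolding Db[OF j p j p] using small_in_K(1) by (simp add: mult.assoc)
  qed
  have Da': "cspace.dd (Ez l) a p = (if l = 1 then of_real (\<rho> 1) * (zc 1 p)\<^sup>2 else 0)"
    if l: "l \<in> K" and p: "p \<in> tube r" for l p
    unfolding Da[OF p p] using params(2,3)[OF l] \<rho>[OF l] by (simp add: mult.assoc)
  have Dc': "cspace.dd (Ez l) c p = of_real (\<gamma> l)" if l: "l \<in> K" and p: "p \<in> tube r" for l p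
    unfolding Dc[OF p p] using params(1,2)[OF l] by simp
  from graded_symmetry_w[OF X] have W: "graded_symmetry r (-1) (cspace.dd (cscale \<i> Ew) a)
      (\<lambda>j. cspace.dd (cscale \<i> Ew) (b j)) (cspace.dd (cscale \<i> Ew) c)" by simp
  obtain h g where h0: "\<And>j. j \<notin> K \<Longrightarrow> h j = 0"
    and Wia: "\<And>p. p \<in> tube r \<Longrightarrow> cspace.dd (cscale \<i> Ew) a p = 2 * (\<Sum>l\<in>K. of_real (h (n - l)) * zc l p)"
    and Wib: "\<And>j p. j \<in> K \<Longrightarrow> p \<in> tube r \<Longrightarrow> cspace.dd (cscale \<i> Ew) (b j) p =
        of_real (h j) - snd (snd p) * of_real (h (j - 1)) + \<i> * of_real (g j)"
    by (rule graded_minus_1[OF W r]) (rule that, assumption+)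
  note Wa = dd_eqI[OF D(1) _ Wia] and Wb = dd_eqI[OF D(2) _ Wib]
  have h: "h j = 0" for j
  proof (cases "j \<in> K")
    case True
    define k where "k = n - j"
    have k: "k \<in> K" "n - k = j" using True by (auto simp: k_def K_iff)
    \<comment> \<open>The \<open>z_k\<close>-derivative of \<open>a\<close> is independent of
      \<open>w\<close>, so the mixed derivative in \<open>w\<close> and \<open>z_k\<close> is
      0.\<close>
    have "- \<i> * (2 * of_real (h j)) = (0::complex)"
    proof (rule mixed_dd_coeff[OF D(1) r, of Ew "Ez k" 0 0 _ "\<lambda>\<sigma>. if k = 1 then of_real (\<rho> 1) * \<sigma>\<^sup>2 else 0"])
      fix \<tau> \<sigma> :: complex
      let ?p = "cscale \<tau> Ew + cscale \<sigma> (Ez k)"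
      have p: "?p \<in> tube r" by (rule in_tube_line[OF r]) simp_all
      show "cspace.dd Ew a ?p = 0 + 0 * \<tau> + (- \<i> * (2 * of_real (h j))) * \<sigma>"
        unfolding Wa[OF p p] sum_zc_one[OF k(1)] k(2) by simp
      show "cspace.dd (Ez k) a ?p = (if k = 1 then of_real (\<rho> 1) * \<sigma>\<^sup>2 else 0) + 0 * \<tau>"
        unfolding Da'[OF k(1) p] using small_in_K(1) by (simp add: zc_Ez)
    qed simp_all
    then show ?thesis by simp
  qed (rule h0)
  have Wa': "cspace.dd Ew a p = 0" if "p \<in> tube r" for p unfolding Wa[OF that that] by (simp add: h)
  have Wb': "cspace.dd Ew (b j) p = of_real (g j)" if "j \<in> K" "p \<in> tube r" for j p
    unfolding Wb[OF that that] by (simp add: h)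
  have a: "3 * a p = of_real (\<rho> 1) * (zc 1 p) ^ 3" if p: "p \<in> tube r" for p
  proof -
    have "(\<Sum>l\<in>K. zc l p * cspace.dd (Ez l) a p) = (\<Sum>l\<in>K. if l = 1 then of_real (\<rho> 1) * (zc 1 p) ^ 3 else 0)"
      by (intro sum.cong refl) (simp add: Da'[OF _ p] power2_eq_square power3_eq_cube)
    then show ?thesis
      using whom_euler[OF D(1) D(4) p] small_in_K(1) by (simp add: Wa'[OF p])
  qed
  have b: "2 * b j p = 2 * fst p * of_real (g j) + (if j = n - 1 then of_real (\<rho> 1) * (zc 1 p)\<^sup>2 else 0)"
    if j: "j \<in> K" and p: "p \<in> tube r" for j p
  proof -
    have "(\<Sum>l\<in>K. zc l p * cspace.dd (Ez l) (b j) p)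
        = (\<Sum>l\<in>K. if l = 1 then (if j = n - 1 then of_real (\<rho> 1) * (zc 1 p)\<^sup>2 else 0) else 0)"
      by (intro sum.cong refl) (simp add: Db'[OF _ j p] power2_eq_square)
    then show ?thesis
      using whom_euler[OF D(2)[OF j] D(5)[OF j] p] small_in_K(1) by (simp add: Wb'[OF j p])
  qed
  have c: "c p = (\<Sum>l\<in>K. of_real (\<gamma> l) * zc l p)" if p: "p \<in> tube r" for p
    using whom_euler[OF D(3) D(6) p] dd_Ew_zero[OF D(3) D(6) _ p]
    by (simp add: Dc'[OF _ p] mult.commute cong: sum.cong)
  \<comment> \<open>What is left is a = \<rho> z_1^3 / 3, b_j = g_j w with \<rho> z_1^2 / 2 added
    for j = n - 1, and c the linear form with coefficients \<gamma>_l. At \<open>\<zeta> = 0\<close>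
    tangency becomes a cubic identity in \<open>x\<close>.\<close>
  have T: "\<rho> 1 * x 1 ^ 3 / 3 = 2 * PP x 0 * (\<Sum>j\<in>K. g (n - j) * x j) + \<rho> 1 * x 1 ^ 3 + PS x 0 * (\<Sum>l\<in>K. \<gamma> l * x l)" for x
  proof -
    have z: "norm (0::complex) < r" using r by simp
    let ?p = "pt (of_real (PP x 0)) (\<lambda>j. of_real (x j)) 0"
    note T = tangency_real[OF X z, of x, unfolded zero_complex.simps]
    have "3 * Re (a ?p) = \<rho> 1 * x 1 ^ 3"
      using arg_cong[OF a[OF T(2)], of Re] small_in_K(1) by (simp flip: of_real_power)
    moreover have "Re (b j ?p) = PP x 0 * g j + (if j = n - 1 then \<rho> 1 * (x 1)\<^sup>2 / 2 else 0)" if "j \<in> K" for j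
      using arg_cong[OF b[OF that T(2)], of Re] small_in_K(1) by (simp flip: of_real_power split: if_splits)
    moreover have "Re (c ?p) = (\<Sum>l\<in>K. \<gamma> l * x l)"
      unfolding c[OF T(2)] Re_sum by (intro sum.cong refl) simp
    ultimately have "\<rho> 1 * x 1 ^ 3 / 3 = (\<Sum>j\<in>K. 2 * x (n - j) * (PP x 0 * g j + (if j = n - 1 then \<rho> 1 * (x 1)\<^sup>2 / 2 else 0)))
        + PS x 0 * (\<Sum>l\<in>K. \<gamma> l * x l)"
      using T(1) by (simp add: PD_zero cong: sum.cong)
    also have "(\<Sum>j\<in>K. 2 * x (n - j) * (PP x 0 * g j + (if j = n - 1 then \<rho> 1 * (x 1)\<^sup>2 / 2 else 0)))
        = 2 * PP x 0 * (\<Sum>j\<in>K. g j * x (n - j)) + (\<Sum>j\<in>K. if j = n - 1 then x (n - j) * (\<rho> 1 * (x 1)\<^sup>2) else 0)"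
      unfolding sum_distrib_left sum.distrib[symmetric] by (intro sum.cong refl) (simp add: algebra_simps)
    also have "(\<Sum>j\<in>K. if j = n - 1 then x (n - j) * (\<rho> 1 * (x 1)\<^sup>2) else 0) = \<rho> 1 * x 1 ^ 3"
      using small_in_K(5) n_gt by (simp add: power2_eq_square power3_eq_cube)
    also have "(\<Sum>j\<in>K. g j * x (n - j)) = (\<Sum>j\<in>K. g (n - j) * x j)"
      by (rule sum.reindex_bij_witness[where i = "\<lambda>j. n - j" and j = "\<lambda>j. n - j"]) (auto simp: K_iff)
    finally show ?thesis .
  qed
  have \<rho>1: "\<rho> 1 = 0"
  proof -
    \<comment> \<open>Both quadratic forms vanish at the first unit vector, where the identity reads
      \<rho> / 3 = \<rho>.\<close>
    let ?x = "\<lambda>j :: nat. if j = 1 then 1 else 0 :: real"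
    have "PP ?x 0 = 0" "PS ?x 0 = 0"
      unfolding PP_zero PS_zero using n_gt by (auto intro!: sum.neutral simp: K_iff)
    then show ?thesis using T[of ?x] by simp
  qed
  have "2 * PP x 0 * (\<Sum>j\<in>K. g (n - j) * x j) + PS x 0 * (\<Sum>j\<in>K. \<gamma> j * x j) = 0" for x
    using T[of x] unfolding \<rho>1 by simp
  note Z = cubic_zero[OF this]
  have g: "g j = 0" if "j \<in> K" for j
    using Z(1)[of "n - j"] that by (simp add: K_iff)
  show ?thesis
  proof (intro ballI conjI)
    fix p :: "'m cspace" assume p: "p \<in> tube r"
    show "a p = 0" using a[OF p] unfolding \<rho>1 by simp
    show "b j p = 0" if "j \<in> K" for j using b[OF that p] g[OF that] unfolding \<rho>1 by (simp split: if_splits)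
    show "c p = 0" unfolding c[OF p] by (intro sum.neutral ballI) (simp add: Z(2))
  qed
qed

text \<open>The \<open>z\<close>-derivatives have weight 1 and vanish, so everything depends on
  \<open>w\<close> and \<open>\<zeta>\<close> alone. Equality of mixed derivatives leaves only
  \<open>c = \<gamma> * w\<close>, which tangency at x = (1, ..., 1) excludes because
  \<open>PP\<close> and \<open>PS\<close> are positive there.\<close>

lemma graded_2:
  assumes X: "graded_symmetry r 2 a b c" and r: "r > 0"
  shows "\<forall>p\<in>tube r. a p = 0 \<and> (\<forall>j\<in>K. b j p = 0) \<and> c p = 0"
proof -
  note D = graded_symmetryD[OF X]
  have Z: "cspace.dd (Ez l) a p = 0" "j \<in> K \<Longrightarrow> cspace.dd (Ez l) (b j) p = 0" "cspace.dd (Ez l) c p = 0"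
    if p: "p \<in> tube r" for l j p
  proof -
    from graded_symmetry_z[OF X, of l] have "graded_symmetry r 1 (cspace.dd (cscale \<i> (Ez l)) a)
      (\<lambda>j. cspace.dd (cscale \<i> (Ez l)) (b j)) (cspace.dd (cscale \<i> (Ez l)) c)" by simp
    note Z = bspec[OF graded_1[OF this r] p]
    show "cspace.dd (Ez l) a p = 0" using Z dd_i[OF D(1) p, of "Ez l"] by simp
    show "cspace.dd (Ez l) (b j) p = 0" if "j \<in> K" using Z dd_i[OF D(2)[OF that] p, of "Ez l"] that by simp
    show "cspace.dd (Ez l) c p = 0" using Z dd_i[OF D(3) p, of "Ez l"] by simp
  qed
  from graded_symmetry_w[OF X] have W: "graded_symmetry r 0 (cspace.dd (cscale \<i> Ew) a)
      (\<lambda>j. cspace.dd (cscale \<i> Ew) (b j)) (cspace.dd (cscale \<i> Ew) c)" by simp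
  obtain \<xi> \<upsilon> v \<gamma> \<rho> where
    Wia: "\<And>p. p \<in> tube r \<Longrightarrow> cspace.dd (cscale \<i> Ew) a p = of_real (real n * \<upsilon> + 2 * v) * fst p + \<i> * of_real \<rho> * (zc 1 p)\<^sup>2"
    and Wib: "\<And>j p. j \<in> K \<Longrightarrow> p \<in> tube r \<Longrightarrow> cspace.dd (cscale \<i> Ew) (b j) p = (\<Sum>l\<in>K. bm \<xi> \<upsilon> v \<rho> j l * zc l p)"
    and Wic: "\<And>p. p \<in> tube r \<Longrightarrow> cspace.dd (cscale \<i> Ew) c p = of_real (2 * \<xi>) + \<i> * of_real \<gamma> + of_real \<upsilon> * snd (snd p)"
    by (rule graded_0[OF W r]) (rule that, assumption+)
  note Wa = dd_eqI[OF D(1) _ Wia] and Wb = dd_eqI[OF D(2) _ Wib] and Wc = dd_eqI[OF D(3) _ Wic]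
  have bm0: "bm \<xi> \<upsilon> v \<rho> j l = 0" if j: "j \<in> K" and l: "l \<in> K" for j l
  proof -
    have "- \<i> * bm \<xi> \<upsilon> v \<rho> j l = 0"
    proof (rule mixed_dd_coeff[OF D(2)[OF j] r, of Ew "Ez l" 0 0 _ "\<lambda>_. 0"])
      fix \<tau> \<sigma> :: complex
      let ?p = "cscale \<tau> Ew + cscale \<sigma> (Ez l)"
      have p: "?p \<in> tube r" by (rule in_tube_line[OF r]) simp_all
      show "cspace.dd Ew (b j) ?p = 0 + 0 * \<tau> + (- \<i> * bm \<xi> \<upsilon> v \<rho> j l) * \<sigma>"
        unfolding Wb[OF j p j p] sum_zc_one[OF l] by simp
      show "cspace.dd (Ez l) (b j) ?p = 0 + 0 * \<tau>" using Z(2)[OF p j] by simp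
    qed simp_all
    then show ?thesis by simp
  qed
  have "\<upsilon> + v = 0" "\<upsilon> * 2 + v = 0" "\<xi> * (2 - real n) = 0"
    using arg_cong[OF bm0[OF small_in_K(1,1)], of Re] arg_cong[OF bm0[OF small_in_K(2,2)], of Re]
      arg_cong[OF bm0[OF small_in_K(2,1)], of Re] unfolding Re_bm by simp_all
  then have uvx: "\<upsilon> = 0" "v = 0" "\<xi> = 0" using n_gt by simp_all
  have \<rho>: "\<rho> = 0" using arg_cong[OF bm0[OF small_in_K(5,1)], of Im] unfolding Im_bm by simp
  have a: "a p = 0" if p: "p \<in> tube r" for p
    using whom_euler[OF D(1) D(4) p] by (simp add: Wa[OF p p] Z[OF p] uvx \<rho>)
  have b: "b j p = 0" if j: "j \<in> K" and p: "p \<in> tube r" for j p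
    using whom_euler[OF D(2)[OF j] D(5)[OF j] p] by (simp add: Wb[OF j p j p] Z(2)[OF p j] bm0[OF j])
  have c: "c p = fst p * of_real \<gamma>" if p: "p \<in> tube r" for p
    using whom_euler[OF D(3) D(6) p] by (simp add: Wc[OF p p] Z[OF p] uvx)
  have "\<gamma> = 0"
  proof -
    have z: "norm (0::complex) < r" using r by simp
    note T = tangency_real[OF X z, of "\<lambda>_. 1", unfolded zero_complex.simps]
    have "PS (\<lambda>_. 1) 0 > 0"
      by (rule PS_zero_pos[of _ 1]) (use small_in_K n_gt in auto)
    moreover have "PP (\<lambda>_. 1) 0 > 0" unfolding PP_zero using small_in_K(1) by (auto simp: card_gt_0_iff)
    ultimately show ?thesis using T(1) a[OF T(2)] b[OF _ T(2)] c[OF T(2)] by simp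
  qed
  then show ?thesis using a b c by simp
qed

text \<open>Differentiation lowers the weight by 1 or 2, hence the two base cases. All weights in
  Euler's identity are positive, so vanishing derivatives force the field to vanish.\<close>

lemma graded_ge_1:
  assumes "graded_symmetry r k a b c" "r > 0" "k \<ge> 1"
  shows "\<forall>p\<in>tube r. a p = 0 \<and> (\<forall>j\<in>K. b j p = 0) \<and> c p = 0"
proof -
  have "\<forall>a b c. graded_symmetry r (int m + 1) a b c \<longrightarrow> (\<forall>p\<in>tube r. a p = 0 \<and> (\<forall>j\<in>K. b j p = 0) \<and> c p = 0)" for m
  proof (induction m rule: less_induct)
    case (less m)
    show ?case
    proof (intro allI impI)
      fix a b c assume X: "graded_symmetry r (int m + 1) a b c"
      note D = graded_symmetryD[OF X]
      consider "m = 0" | "m = 1" | "m \<ge> 2" by linarith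
      then show "\<forall>p\<in>tube r. a p = 0 \<and> (\<forall>j\<in>K. b j p = 0) \<and> c p = 0"
      proof cases
        case 1
        then show ?thesis using graded_1 X assms(2) by simp
      next
        case 2
        then show ?thesis using graded_2 X assms(2) by simp
      next
        case 3
        have Z: "cspace.dd (Ez l) a p = 0 \<and> (\<forall>j\<in>K. cspace.dd (Ez l) (b j) p = 0) \<and> cspace.dd (Ez l) c p = 0"
          if p: "p \<in> tube r" for l p
        proof -
          have eq: "int m + 1 - 1 = int (m - 1) + 1" using 3 by simp
          note gs = graded_symmetry_z[OF X, of l, unfolded eq]
          have lt: "m - 1 < m" using 3 by simp
          note less[OF lt, rule_format, OF _ p]
          note this[OF gs]
          then show ?thesis using dd_i[OF D(1) p, of "Ez l"] dd_i[OF D(2) p, of _ "Ez l"] dd_i[OF D(3) p, of "Ez l"] by simp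
        qed
        have W: "cspace.dd Ew a p = 0 \<and> (\<forall>j\<in>K. cspace.dd Ew (b j) p = 0) \<and> cspace.dd Ew c p = 0"
          if p: "p \<in> tube r" for p
        proof -
          have eq: "int m + 1 - 2 = int (m - 2) + 1" using 3 by simp
          note gs = graded_symmetry_w[OF X, unfolded eq]
          have lt: "m - 2 < m" using 3 by simp
          note less[OF lt, rule_format, OF _ p]
          note this[OF gs]
          then show ?thesis using dd_i[OF D(1) p, of Ew] dd_i[OF D(2) p, of _ Ew] dd_i[OF D(3) p, of Ew] by simp
        qed
        have nz: "(of_int i :: complex) \<noteq> 0" if "i > 0" for i using that by simp
        show ?thesis
        proof (intro ballI conjI)
          fix p :: "'m cspace" assume p: "p \<in> tube r"
          have "of_int (int m + 1 + 2) * a p = 0"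
            using whom_euler[OF D(1) D(4) p] Z[OF p] W[OF p] by (simp del: of_int_add)
          then show "a p = 0" using nz[of "int m + 1 + 2"] by (simp del: of_int_add)
          have "of_int (int m + 1) * c p = 0"
            using whom_euler[OF D(3) D(6) p] Z[OF p] W[OF p] by (simp del: of_int_add)
          then show "c p = 0" using nz[of "int m + 1"] by (simp del: of_int_add)
          fix j assume j: "j \<in> K"
          have "of_int (int m + 1 + 1) * b j p = 0"
            using whom_euler[OF D(2)[OF j] D(5)[OF j] p] Z[OF p] W[OF p] j by (simp del: of_int_add)
          then show "b j p = 0" using nz[of "int m + 1 + 1"] by (simp del: of_int_add)
        qed
      qed
    qed
  qed
  from this[of "nat (k - 1)"] show ?thesis using assms by simp
qed

end

section \<open>The symmetry algebra\<close>

lemma germ_eq_iff: "germ f = germ g \<longleftrightarrow> (\<forall>\<^sub>F p in nhds 0. f p = g p)"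
  by (rule germ.abs_eq_iff)

lemma germ_sum: "(\<Sum>i\<in>A. germ (f i)) = germ (\<lambda>p. \<Sum>i\<in>A. f i p)"
  by (induction A rule: infinite_finite_induct) (simp_all add: zero_germ.abs_eq plus_germ.abs_eq)

text \<open>Turns a factor depending on one index into one depending on both, as is needed to
  compare it with the exponent n - i - l.\<close>

lemma sum_symmetrize:
  fixes c x :: "nat \<Rightarrow> real" and S :: "nat \<Rightarrow> nat \<Rightarrow> real"
  assumes "\<And>i l. S i l = S l i"
  shows "2 * (\<Sum>i\<in>K. \<Sum>l\<in>K. c i * (S i l * x i * x l)) = (\<Sum>i\<in>K. \<Sum>l\<in>K. (c i + c l) * (S i l * x i * x l))"
proof -
  have "(\<Sum>i\<in>K. \<Sum>l\<in>K. c i * (S i l * x i * x l)) = (\<Sum>i\<in>K. \<Sum>l\<in>K. c l * (S i l * x i * x l))"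
    by (subst sum.swap) (simp add: assms mult_ac)
  then show ?thesis by (simp add: distrib_right sum.distrib)
qed

context model_hypersurface
begin

lemma holomorphic_vf_onI:
  assumes "cspace.chol (\<lambda>p. fst (X p)) U" "\<And>j. j \<in> K \<Longrightarrow> cspace.chol (\<lambda>p. zc j (X p)) U"
    "cspace.chol (\<lambda>p. snd (snd (X p))) U"
  shows "holomorphic_vf_on X U"
  unfolding holomorphic_vf_on_def
proof
  fix p assume p: "p \<in> U"
  define axes where "axes g = (\<Sum>j\<in>K. axis (e j) (g j))" for g :: "nat \<Rightarrow> complex"
  have axes: "zc k (a, axes g, b) = g k" if "k \<in> K" for k g a b
  proof -
    have "zc k (a, axes g, b) = (\<Sum>j\<in>K. if j = k then g j else 0)"
      unfolding zc_def axes_def using that by (simp add: axis_def e_eq_iff)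
    then show ?thesis using that by simp
  qed
  have X: "X = (\<lambda>p. (fst (X p), axes (\<lambda>j. zc j (X p)), snd (snd (X p))))"
    by (intro ext cspace_eqI) (simp_all add: axes)
  have ax: "bounded_linear (axis i :: complex \<Rightarrow> complex ^ 'm)" for i
    by (rule linear_conv_bounded_linear[THEN iffD1], rule linearI) (simp_all add: vec_eq_iff axis_def)
  let ?D = "\<lambda>v. (cspace.dd v (\<lambda>p. fst (X p)) p, axes (\<lambda>j. cspace.dd v (\<lambda>p. zc j (X p)) p),
     cspace.dd v (\<lambda>p. snd (snd (X p))) p)"
  have "((\<lambda>p. (fst (X p), axes (\<lambda>j. zc j (X p)), snd (snd (X p)))) has_derivative ?D) (at p)"
    unfolding axes_def
    by (intro has_derivative_Pair has_derivative_sum bounded_linear.has_derivative[OF ax]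
        cspace.chol_has_derivative(1)[OF _ p] assms)
  moreover have "?D (cscale c v) = cscale c (?D v)" for c v
    by (rule cspace_eqI)
      (simp_all add: axes cspace.chol_has_derivative(2)[OF assms(1) p]
        cspace.chol_has_derivative(2)[OF assms(2) p] cspace.chol_has_derivative(2)[OF assms(3) p])
  ultimately show "\<exists>D. (X has_derivative D) (at p) \<and> (\<forall>c v. D (cscale c v) = cscale c (D v))"
    using X by (intro exI[of _ ?D]) simp
qed

section \<open>The symmetries form a real subspace\<close>

lemma holI:
  assumes "open U" "0 \<in> U" "holomorphic_vf_on X U" "\<And>p. p \<in> M\<^sub>0 n e \<Longrightarrow> p \<in> U \<Longrightarrow> dPhi p (X p) = 0"
  shows "germ X \<in> hol (M\<^sub>0 n e)"
  unfolding hol_def using assms tangent_iff by blast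

lemma dPhi_add: "dPhi p (u + v) = dPhi p u + dPhi p v"
  by (simp add: dPhi_def distrib_left sum.distrib)

lemma dPhi_scaleR: "dPhi p (c *\<^sub>R v) = c * dPhi p v"
  by (simp add: dPhi_def zc_def sum_distrib_left algebra_simps)

lemma subspace_hol: "subspace (hol (M\<^sub>0 n e))"
proof (rule subspaceI)
  show "0 \<in> hol (M\<^sub>0 n e)"
    unfolding zero_germ.abs_eq
  proof (rule holI)
    show "holomorphic_vf_on (\<lambda>_. 0 :: 'm cspace) UNIV"
      by (rule holomorphic_vf_onI) (simp_all add: cspace.chol_const)
    show "dPhi p 0 = 0" for p using dPhi_scaleR[of p 0 0] by simp
  qed auto
next
  fix x y assume "x \<in> hol (M\<^sub>0 n e)" "y \<in> hol (M\<^sub>0 n e)"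
  then obtain X U Y V where
    X: "x = germ X" "open U" "0 \<in> U" "holomorphic_vf_on X U" "\<forall>p\<in>M\<^sub>0 n e \<inter> U. X p \<in> tangent_at (M\<^sub>0 n e) p" and
    Y: "y = germ Y" "open V" "0 \<in> V" "holomorphic_vf_on Y V" "\<forall>p\<in>M\<^sub>0 n e \<inter> V. Y p \<in> tangent_at (M\<^sub>0 n e) p"
    unfolding hol_def by blast
  have "germ (\<lambda>p. X p + Y p) \<in> hol (M\<^sub>0 n e)"
  proof (rule holI[of "U \<inter> V"])
    show "holomorphic_vf_on (\<lambda>p. X p + Y p) (U \<inter> V)"
    proof (rule holomorphic_vf_onI)
      note cX = holomorphic_vf_components[OF X(4), THEN cspace.chol_subset, OF Int_lower1]
      note cY = holomorphic_vf_components[OF Y(4), THEN cspace.chol_subset, OF Int_lower2]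
      show "cspace.chol (\<lambda>p. fst (X p + Y p)) (U \<inter> V)"
        unfolding fst_add by (rule cspace.chol_add[OF cX(1) cY(1)])
      show "cspace.chol (\<lambda>p. zc j (X p + Y p)) (U \<inter> V)" for j
        unfolding zc_add by (rule cspace.chol_add[OF cX(2) cY(2)])
      show "cspace.chol (\<lambda>p. snd (snd (X p + Y p))) (U \<inter> V)"
        unfolding snd_add by (rule cspace.chol_add[OF cX(3) cY(3)])
    qed
    show "dPhi p (X p + Y p) = 0" if "p \<in> M\<^sub>0 n e" "p \<in> U \<inter> V" for p
    proof -
      have "dPhi p (X p) = 0" "dPhi p (Y p) = 0"
        using X(5) Y(5) that tangent_iff[OF that(1)] by blast+
      then show ?thesis by (simp add: dPhi_add)
    qed
  qed (use X Y in auto)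
  then show "x + y \<in> hol (M\<^sub>0 n e)" by (simp add: X(1) Y(1) plus_germ.abs_eq)
next
  fix c :: real and x assume "x \<in> hol (M\<^sub>0 n e)"
  then obtain X U where
    X: "x = germ X" "open U" "0 \<in> U" "holomorphic_vf_on X U" "\<forall>p\<in>M\<^sub>0 n e \<inter> U. X p \<in> tangent_at (M\<^sub>0 n e) p"
    unfolding hol_def by blast
  have "germ (\<lambda>p. c *\<^sub>R X p) \<in> hol (M\<^sub>0 n e)"
  proof (rule holI[OF X(2,3)])
    note cX = cspace.chol_mult[OF cspace.chol_const[of "of_real c"]] 
    have s: "fst (c *\<^sub>R v) = of_real c * fst v" "zc j (c *\<^sub>R v) = of_real c * zc j v"
      "snd (snd (c *\<^sub>R v)) = of_real c * snd (snd v)" for v :: "'m cspace" and j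
      by (simp_all add: zc_def complex_eq_iff)
    show "holomorphic_vf_on (\<lambda>p. c *\<^sub>R X p) U"
      by (rule holomorphic_vf_onI; unfold s; rule cX; rule holomorphic_vf_components[OF X(4)])
    show "dPhi p (c *\<^sub>R X p) = 0" if "p \<in> M\<^sub>0 n e" "p \<in> U" for p
    proof -
      have "dPhi p (X p) = 0" using X(5) that tangent_iff[OF that(1)] by blast
      then show ?thesis by (simp add: dPhi_scaleR)
    qed
  qed
  then show "c *\<^sub>R x \<in> hol (M\<^sub>0 n e)" by (simp add: X(1) scaleR_germ.abs_eq)
qed

section \<open>Components of the generators\<close>

lemma Y_w_simps [simp]: "fst (Y_w p) = \<i>" "zc k (Y_w p) = 0" "snd (snd (Y_w p)) = 0"
  by (simp_all add: Y_w_def case_prod_unfold)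

lemma Y_zeta_simps [simp]: "fst (Y_\<zeta> p) = 0" "zc k (Y_\<zeta> p) = 0" "snd (snd (Y_\<zeta> p)) = \<i>"
  by (simp_all add: Y_\<zeta>_def case_prod_unfold)

lemma Y_z_simps:
  assumes "j \<in> K"
  shows "fst (Y_z e j p) = 0" "k \<in> K \<Longrightarrow> zc k (Y_z e j p) = (if k = j then \<i> else 0)" "snd (snd (Y_z e j p)) = 0"
  using assms by (auto simp: Y_z_def case_prod_unfold zc_def axis_def e_eq_iff)

lemma X_z_simps:
  assumes "j \<in> K"
  shows "fst (X_z n e j p) = 2 * zc (n - j) p"
    "k \<in> K \<Longrightarrow> zc k (X_z n e j p) = (if k = j then 1 else 0) - (if k = j + 1 then snd (snd p) else 0)"
    "snd (snd (X_z n e j p)) = 0"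
proof -
  have "n - (n - 1) = 1" using n_gt by simp
  then show "fst (X_z n e j p) = 2 * zc (n - j) p"
    by (auto simp: X_z_def case_prod_unfold zc_def)
  show "snd (snd (X_z n e j p)) = 0" by (simp add: X_z_def case_prod_unfold)
  assume k: "k \<in> K"
  show "zc k (X_z n e j p) = (if k = j then 1 else 0) - (if k = j + 1 then snd (snd p) else 0)"
  proof (cases "j = n - 1")
    case True
    then have "k \<noteq> j + 1" using k by (auto simp: K_iff)
    then show ?thesis using True k small_in_K(5)
      by (simp add: X_z_def case_prod_unfold zc_def axis_def e_eq_iff)
  next
    case False
    then have "j + 1 \<in> K" using assms by (auto simp: K_iff)
    then show ?thesis using False k assms e_eq_iff[OF k \<open>j + 1 \<in> K\<close>] e_eq_iff[OF k assms]
      by (auto simp: X_z_def case_prod_unfold zc_def axis_def)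
  qed
qed

lemma zc_axes:
  assumes "k \<in> K" "A \<subseteq> K"
  shows "zc k (a, \<Sum>j\<in>A. axis (e j) (g j), b) = (if k \<in> A then g k else 0)"
proof -
  have "finite A" using assms(2) finite_subset finite_K by blast
  have "zc k (a, \<Sum>j\<in>A. axis (e j) (g j), b) = (\<Sum>j\<in>A. if j = k then g j else 0)"
    unfolding zc_def using assms by (simp add: axis_def) (auto intro!: sum.cong simp: e_eq_iff subset_iff)
  then show ?thesis using \<open>finite A\<close> by simp
qed

lemma X_zeta_simps:
  shows "fst (X_\<zeta> n e p) = 0"
    "k \<in> K \<Longrightarrow> zc k (X_\<zeta> n e p) = (if 2 \<le> k then of_real (2 * real k - 2 - real n) * zc (k - 1) p else 0)"
    "snd (snd (X_\<zeta> n e p)) = 2"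
proof -
  assume k: "k \<in> K"
  have "{2..n - 1} \<subseteq> K" "k \<in> {2..n - 1} \<longleftrightarrow> 2 \<le> k" using k n_gt by (auto simp: K_iff)
  then show "zc k (X_\<zeta> n e p) = (if 2 \<le> k then of_real (2 * real k - 2 - real n) * zc (k - 1) p else 0)"
    unfolding X_\<zeta>_def case_prod_unfold zc_axes[OF k \<open>{2..n - 1} \<subseteq> K\<close>] by (simp add: zc_def)
qed (simp_all add: X_\<zeta>_def case_prod_unfold)

lemma U_0_simps:
  shows "fst (U\<^sub>0 n e p) = of_nat n * fst p" "k \<in> K \<Longrightarrow> zc k (U\<^sub>0 n e p) = of_nat k * zc k p"
    "snd (snd (U\<^sub>0 n e p)) = snd (snd p)"
  unfolding U\<^sub>0_def case_prod_unfold K_def[symmetric] by (simp_all add: zc_axes) (simp add: zc_def)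

lemma V_0_simps:
  shows "fst (V\<^sub>0 n e p) = 2 * fst p" "k \<in> K \<Longrightarrow> zc k (V\<^sub>0 n e p) = zc k p" "snd (snd (V\<^sub>0 n e p)) = 0"
  unfolding V\<^sub>0_def case_prod_unfold K_def[symmetric] by (simp_all add: zc_axes) (simp add: zc_def)

lemma V_neg_simps:
  shows "fst (V_neg n e p) = \<i> * (zc 1 p)\<^sup>2" "k \<in> K \<Longrightarrow> zc k (V_neg n e p) = (if k = n - 1 then \<i> * zc 1 p else 0)"
    "snd (snd (V_neg n e p)) = 0"
  using small_in_K(5) by (auto simp: V_neg_def case_prod_unfold zc_def axis_def e_eq_iff)

lemma chol_fst: "cspace.chol fst U"
  by (rule cspace.cholI[where D = "\<lambda>_. fst"]) (auto intro!: derivative_eq_intros)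

lemma chol_zc: "cspace.chol (zc j) U"
  by (rule cspace.cholI[where D = "\<lambda>_. zc j"]) (auto intro!: zc_has_derivative)

lemma chol_zeta: "cspace.chol (\<lambda>p. snd (snd p)) U"
  by (rule cspace.cholI[where D = "\<lambda>_ v. snd (snd v)"]) (auto intro!: derivative_eq_intros)

section \<open>Tangency of the generators\<close>

lemma PD_telescope:
  assumes "j \<in> K"
  shows "PD x s j - s * PD x s (j + 1) = 2 * x (n - j)"
  using pc_sum_telescope[OF assms, of s x]
  by (simp add: PD_def pc_commute[of s j] pc_commute[of s "Suc j"])

lemma PD_n: "PD x s n = 0"
  unfolding PD_def by (simp add: pc_def K_iff sum.neutral)

lemma euler_V: "(\<Sum>j\<in>K. PD x s j * x j) = 2 * PP x s"
  by (simp add: PD_def PP_def sum_distrib_left sum_distrib_right mult_ac)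

text \<open>Each monomial s^(n-j-k) x_j x_k has degree n when x_j has weight j and s has weight
  1.\<close>

lemma euler_U: "(\<Sum>j\<in>K. PD x s j * (real j * x j)) + PS x s * s = real n * PP x s"
proof -
  have PD: "(\<Sum>j\<in>K. PD x s j * (real j * x j)) = 2 * (\<Sum>j\<in>K. \<Sum>k\<in>K. real j * (pc s j k * x j * x k))"
    by (simp add: PD_def sum_distrib_left sum_distrib_right mult_ac)
  have "(\<Sum>j\<in>K. PD x s j * (real j * x j)) + PS x s * s
      = (\<Sum>j\<in>K. \<Sum>k\<in>K. (real j + real k) * (pc s j k * x j * x k)) + PS x s * s"
    unfolding PD sum_symmetrize[OF pc_commute] ..
  also have "\<dots> = (\<Sum>j\<in>K. \<Sum>k\<in>K. (real j + real k) * (pc s j k * x j * x k) + pc' s j k * x j * x k * s)"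
    by (simp add: PS_def sum_distrib_right sum.distrib)
  also have "\<dots> = (\<Sum>j\<in>K. \<Sum>k\<in>K. real n * (pc s j k * x j * x k))"
  proof (intro sum.cong refl)
    fix j k
    have pc's: "pc' s j k * s = (real n - real j - real k) * pc s j k"
    proof (cases "j + k < n")
      case True
      then have "n - j - k \<noteq> 0" by linarith
      then obtain m where m: "n - j - k = Suc m" by (auto simp only: gr0_conv_Suc neq0_conv)
      then have r: "real n - real j - real k = real (Suc m)" using True by linarith
      show ?thesis using True unfolding pc_def pc'_def m r by simp
    qed (auto simp: pc_def pc'_def)
    have "(real j + real k) * (pc s j k * x j * x k) + pc' s j k * x j * x k * s
        = ((real j + real k) * pc s j k + pc' s j k * s) * (x j * x k)" by (simp add: algebra_simps)
    then show "(real j + real k) * (pc s j k * x j * x k) + pc' s j k * x j * x k * s = real n * (pc s j k * x j * x k)"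
      unfolding pc's by (simp add: algebra_simps)
  qed
  finally show ?thesis by (simp add: PP_def sum_distrib_left)
qed

text \<open>With i = j - 1 the factor is 2i - n, and raising the index turns \<open>pc s i l\<close>
  into \<open>pc s (i + 1) l\<close>. Symmetrised, the factor becomes 2(i + l - n), which is -2
  times the exponent of s, so the sum is that of \<open>-2 * pc'\<close>. This is the origin of the
  numbers 2j - 2 - n.\<close>

lemma euler_X:
  "(\<Sum>j\<in>K. PD x s j * (if 2 \<le> j then (2 * real j - 2 - real n) * x (j - 1) else 0)) + PS x s * 2 = 0"
proof -
  have "(\<Sum>j\<in>K. PD x s j * (if 2 \<le> j then (2 * real j - 2 - real n) * x (j - 1) else 0))
      = (\<Sum>i\<in>{1..<n - 1}. PD x s (i + 1) * ((2 * real i - real n) * x i))"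
  proof (rule sum.mono_neutral_cong_right[of K "(+) 1 ` {1..<n - 1}", THEN trans])
    show "(\<Sum>j\<in>(+) 1 ` {1..<n - 1}. PD x s j * ((2 * real j - 2 - real n) * x (j - 1)))
      = (\<Sum>i\<in>{1..<n - 1}. PD x s (i + 1) * ((2 * real i - real n) * x i))"
      by (subst sum.reindex) (auto intro!: sum.cong simp: algebra_simps)
    show "\<forall>j\<in>K - (+) 1 ` {1..<n - 1}. PD x s j * (if 2 \<le> j then (2 * real j - 2 - real n) * x (j - 1) else 0) = 0"
    proof
      fix j assume j: "j \<in> K - (+) 1 ` {1..<n - 1}"
      have "j \<in> (+) 1 ` {1..<n - 1}" if "2 \<le> j"
        using that j by (intro image_eqI[of _ _ "j - 1"]) (auto simp: K_iff)
      then show "PD x s j * (if 2 \<le> j then (2 * real j - 2 - real n) * x (j - 1) else 0) = 0" using j by auto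
    qed
  qed (auto simp: K_iff)
  also have "\<dots> = (\<Sum>i\<in>K. PD x s (i + 1) * ((2 * real i - real n) * x i))"
  proof (rule sum.mono_neutral_left)
    \<comment> \<open>The added index \<open>i = n - 1\<close> is shifted to \<open>n\<close>, where
      \<open>PD\<close> is 0.\<close>
    show "\<forall>i\<in>K - {1..<n - 1}. PD x s (i + 1) * ((2 * real i - real n) * x i) = 0"
    proof
      fix i assume "i \<in> K - {1..<n - 1}"
      then have "i + 1 = n" by (auto simp: K_iff)
      then show "PD x s (i + 1) * ((2 * real i - real n) * x i) = 0" by (simp only: PD_n mult_zero_left)
    qed
  qed (auto simp: K_iff)
  also have "\<dots> = 2 * (\<Sum>i\<in>K. \<Sum>l\<in>K. (2 * real i - real n) * (pc s (i + 1) l * x i * x l))"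
    by (simp add: PD_def sum_distrib_left sum_distrib_right mult_ac)
  also have "\<dots> = (\<Sum>i\<in>K. \<Sum>l\<in>K. (2 * real i - real n + (2 * real l - real n)) * (pc s (i + 1) l * x i * x l))"
    by (rule sum_symmetrize) (simp add: pc_def add.commute diff_right_commute)
  also have "\<dots> = - (PS x s * 2)"
  proof -
    have "(2 * real i - real n + (2 * real l - real n)) * pc s (i + 1) l = - 2 * pc' s i l" for i l
    proof (cases "i + l \<le> n")
      case True
      then have "real (n - i - l) = real n - real i - real l" by simp
      moreover have "n - (i + 1) - l = n - i - l - 1" by simp
      moreover have "i + l = n \<or> i + 1 + l \<le> n" using True by linarith
      ultimately show ?thesis using True by (auto simp: pc_def pc'_def algebra_simps)
    qed (simp add: pc_def pc'_def)
    then have "(2 * real i - real n + (2 * real l - real n)) * (pc s (i + 1) l * x i * x l) = - 2 * pc' s i l * x i * x l" for i l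
      by (simp flip: mult.assoc)
    then show ?thesis by (simp add: PS_def sum_distrib_left sum_negf mult_ac)
  qed
  finally show ?thesis by simp
qed

lemma sum_PD_cong: "(\<And>j. j \<in> K \<Longrightarrow> f j = g j) \<Longrightarrow> (\<Sum>j\<in>K. PD x s j * f j) = (\<Sum>j\<in>K. PD x s j * g j)"
  by simp

lemmas chol_intros = cspace.chol_const cspace.chol_add cspace.chol_mult cspace.chol_minus
  cspace.chol_diff chol_fst chol_zc chol_zeta

lemma in_hol:
  assumes "cspace.chol (\<lambda>p. fst (X p)) UNIV" "\<And>j. j \<in> K \<Longrightarrow> cspace.chol (\<lambda>p. zc j (X p)) UNIV"
    "cspace.chol (\<lambda>p. snd (snd (X p))) UNIV"
    and "\<And>p x s. p \<in> M\<^sub>0 n e \<Longrightarrow> x = xr p \<Longrightarrow> s = Re (snd (snd p)) \<Longrightarrow>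
      Re (fst (X p)) = (\<Sum>j\<in>K. PD x s j * Re (zc j (X p))) + PS x s * Re (snd (snd (X p)))"
  shows "germ X \<in> hol (M\<^sub>0 n e)"
  by (rule holI[OF open_UNIV UNIV_I holomorphic_vf_onI[OF assms(1-3)]]) (simp_all add: dPhi_def assms(4))

lemma generators_in_hol:
  "germ ` ({Y_w} \<union> X_z n e ` K \<union> Y_z e ` K \<union> {X_\<zeta> n e, Y_\<zeta>, U\<^sub>0 n e, V\<^sub>0 n e, V_neg n e}) \<subseteq> hol (M\<^sub>0 n e)"
proof -
  have "germ Y_w \<in> hol (M\<^sub>0 n e)" "germ Y_\<zeta> \<in> hol (M\<^sub>0 n e)"
    by (rule in_hol; simp add: chol_intros)+
  moreover have "germ (Y_z e j) \<in> hol (M\<^sub>0 n e)" if j: "j \<in> K" for j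
    by (rule in_hol) (simp_all add: Y_z_simps[OF j] chol_intros sum.neutral)
  moreover have "germ (X_z n e j) \<in> hol (M\<^sub>0 n e)" if j: "j \<in> K" for j
  proof (rule in_hol)
    show "cspace.chol (\<lambda>p. zc k (X_z n e j p)) UNIV" if "k \<in> K" for k
      unfolding X_z_simps(2)[OF j that]
      by (cases "k = j + 1") (simp_all add: chol_intros)
    fix p x s assume x: "x = xr p" and s: "s = Re (snd (snd p))"
    have "(\<Sum>k\<in>K. PD x s k * Re (zc k (X_z n e j p)))
        = (\<Sum>k\<in>K. (if k = j then PD x s k else 0) - (if k = j + 1 then s * PD x s k else 0))"
      by (intro sum.cong refl) (simp add: X_z_simps(2)[OF j] s)
    also have "\<dots> = PD x s j - s * PD x s (j + 1)"
    proof (cases "j + 1 \<in> K")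
      case False
      then have "j + 1 = n" using j by (auto simp: K_iff)
      moreover have "(\<Sum>k\<in>K. if k = n then s * PD x s k else 0) = 0" by (intro sum.neutral) (auto simp: K_iff)
      ultimately show ?thesis using j by (simp add: sum_subtractf PD_n)
    qed (use j in \<open>simp add: sum_subtractf\<close>)
    finally show "Re (fst (X_z n e j p)) = (\<Sum>k\<in>K. PD x s k * Re (zc k (X_z n e j p))) + PS x s * Re (snd (snd (X_z n e j p)))"
      using PD_telescope[OF j, of x s] by (simp add: X_z_simps(1,3)[OF j] x xr_def)
  qed (simp_all add: X_z_simps(1,3)[OF j] chol_intros)
  moreover have "germ (X_\<zeta> n e) \<in> hol (M\<^sub>0 n e)"
  proof (rule in_hol)
    show "cspace.chol (\<lambda>p. zc k (X_\<zeta> n e p)) UNIV" if "k \<in> K" for k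
      unfolding X_zeta_simps(2)[OF that] by (cases "2 \<le> k") (simp_all add: chol_intros del: of_real_diff)
    fix p x s assume x: "x = xr p"
    have "(\<Sum>j\<in>K. PD x s j * Re (zc j (X_\<zeta> n e p)))
      = (\<Sum>j\<in>K. PD x s j * (if 2 \<le> j then (2 * real j - 2 - real n) * x (j - 1) else 0))"
      by (intro sum_PD_cong) (simp add: X_zeta_simps(2) x xr_def)
    then show "Re (fst (X_\<zeta> n e p)) = (\<Sum>j\<in>K. PD x s j * Re (zc j (X_\<zeta> n e p))) + PS x s * Re (snd (snd (X_\<zeta> n e p)))"
      using euler_X[of x s] by (simp add: X_zeta_simps(1,3))
  qed (simp_all add: X_zeta_simps(1,3) chol_intros)
  moreover have "germ (U\<^sub>0 n e) \<in> hol (M\<^sub>0 n e)"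
  proof (rule in_hol)
    fix p x s assume p: "p \<in> M\<^sub>0 n e" and x: "x = xr p" and s: "s = Re (snd (snd p))"
    have "(\<Sum>j\<in>K. PD x s j * Re (zc j (U\<^sub>0 n e p))) = (\<Sum>j\<in>K. PD x s j * (real j * x j))"
      by (intro sum_PD_cong) (simp add: U_0_simps(2) x xr_def)
    then show "Re (fst (U\<^sub>0 n e p)) = (\<Sum>j\<in>K. PD x s j * Re (zc j (U\<^sub>0 n e p))) + PS x s * Re (snd (snd (U\<^sub>0 n e p)))"
      using euler_U[of x s] p by (simp add: U_0_simps(1,3) M_iff x s)
  qed (simp_all add: U_0_simps chol_intros)
  moreover have "germ (V\<^sub>0 n e) \<in> hol (M\<^sub>0 n e)"
  proof (rule in_hol)
    fix p x s assume p: "p \<in> M\<^sub>0 n e" and x: "x = xr p" and s: "s = Re (snd (snd p))"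
    have "(\<Sum>j\<in>K. PD x s j * Re (zc j (V\<^sub>0 n e p))) = (\<Sum>j\<in>K. PD x s j * x j)"
      by (intro sum_PD_cong) (simp add: V_0_simps(2) x xr_def)
    then show "Re (fst (V\<^sub>0 n e p)) = (\<Sum>j\<in>K. PD x s j * Re (zc j (V\<^sub>0 n e p))) + PS x s * Re (snd (snd (V\<^sub>0 n e p)))"
      using euler_V[of x s] p by (simp add: V_0_simps(1,3) M_iff x s)
  qed (simp_all add: V_0_simps chol_intros)
  moreover have "germ (V_neg n e) \<in> hol (M\<^sub>0 n e)"
  proof (rule in_hol)
    show "cspace.chol (\<lambda>p. zc k (V_neg n e p)) UNIV" if "k \<in> K" for k
      unfolding V_neg_simps(2)[OF that] by (cases "k = n - 1") (simp_all add: chol_intros)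
    fix p x s assume x: "x = xr p"
    have "(\<Sum>j\<in>K. PD x s j * Re (zc j (V_neg n e p))) = (\<Sum>j\<in>K. if j = n - 1 then PD x s j * - Im (zc 1 p) else 0)"
      by (intro sum.cong refl) (simp add: V_neg_simps(2))
    also have "\<dots> = - Im (zc 1 p) * PD x s (n - 1)" using small_in_K(5) by simp
    also have "PD x s (n - 1) = 2 * Re (zc 1 p)"
    proof -
      have "n - 1 + 1 = n" "n - (n - 1) = 1" using n_gt by auto
      then show ?thesis using PD_telescope[OF small_in_K(5), of x s] PD_n x by (simp add: xr_def)
    qed
    finally show "Re (fst (V_neg n e p)) = (\<Sum>j\<in>K. PD x s j * Re (zc j (V_neg n e p))) + PS x s * Re (snd (snd (V_neg n e p)))"
      by (simp add: V_neg_simps(1,3) power2_eq_square)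
  qed (simp_all add: V_neg_simps(1,3) power2_eq_square chol_intros)
  ultimately show ?thesis by auto
qed

section \<open>Expansion of an arbitrary symmetry in the generators\<close>

lemma bm_sum:
  assumes "k \<in> K"
  shows "(\<Sum>l\<in>K. bm \<xi> \<upsilon> v \<rho> k l * zc l p) =
    (if 2 \<le> k then of_real (\<xi> * (2 * real k - 2 - real n)) * zc (k - 1) p else 0) +
    of_real (\<upsilon> * real k + v) * zc k p + (if k = n - 1 then \<i> * of_real \<rho> * zc 1 p else 0)"
proof -
  have "(\<Sum>l\<in>K. bm \<xi> \<upsilon> v \<rho> k l * zc l p) =
      (\<Sum>l\<in>K. (if l = k - 1 then of_real (\<xi> * (2 * real k - 2 - real n)) * zc l p else 0) +
        (if l = k then of_real (\<upsilon> * real k + v) * zc l p else 0) +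
        (if l = 1 then (if k = n - 1 then \<i> * of_real \<rho> * zc l p else 0) else 0))"
  proof (intro sum.cong refl)
    fix l assume l: "l \<in> K"
    have "l + 1 = k \<longleftrightarrow> l = k - 1" using assms l by (auto simp: K_iff)
    then show "bm \<xi> \<upsilon> v \<rho> k l * zc l p = (if l = k - 1 then of_real (\<xi> * (2 * real k - 2 - real n)) * zc l p else 0) +
        (if l = k then of_real (\<upsilon> * real k + v) * zc l p else 0) +
        (if l = 1 then (if k = n - 1 then \<i> * of_real \<rho> * zc l p else 0) else 0)"
      unfolding bm_def by (simp add: distrib_right)
  qed
  also have "\<dots> = (if k - 1 \<in> K then of_real (\<xi> * (2 * real k - 2 - real n)) * zc (k - 1) p else 0) +
      of_real (\<upsilon> * real k + v) * zc k p + (if k = n - 1 then \<i> * of_real \<rho> * zc 1 p else 0)"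
    using assms small_in_K(1) by (simp add: sum.distrib)
  also have "k - 1 \<in> K \<longleftrightarrow> 2 \<le> k" using assms by (auto simp: K_iff)
  finally show ?thesis .
qed

lemma zc_scaleR: "zc k (c *\<^sub>R p) = of_real c * zc k p"
  by (simp add: zc_def complex_eq_iff)

lemma fst_sum_pairs: "fst (\<Sum>i\<in>A. f i) = (\<Sum>i\<in>A. fst (f i))"
  "snd (snd (\<Sum>i\<in>A. f i)) = (\<Sum>i\<in>A. snd (snd (f i)))"
  by (simp_all add: fst_sum snd_sum)

lemma dil_in_ball:
  fixes p :: "'m cspace"
  assumes "p \<in> ball 0 (d / 8)" "norm t < 2"
  shows "dil t p \<in> ball 0 d"
proof -
  have p: "norm p < d / 8" using assms(1) by simp
  then have "d > 0" using norm_ge_zero[of p] by linarith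
  have n: "norm (fst p) \<le> norm p" "norm (fst (snd p)) \<le> norm p" "norm (snd (snd p)) \<le> norm p"
    using norm_fst_le[of "fst p" "snd p"] norm_snd_le[of "snd p" "fst p"]
      norm_fst_le[of "fst (snd p)" "snd (snd p)"] norm_snd_le[of "snd (snd p)" "fst (snd p)"]
    by simp_all
  have t2: "norm t ^ 2 \<le> 4" using assms(2) power_mono[of "norm t" 2 2] by simp
  have ns: "norm (t *s z) = norm t * norm z" for z :: "complex ^ 'm"
    by (simp add: norm_vec_def norm_mult L2_set_right_distrib)
  have "norm (dil t p) \<le> norm (t\<^sup>2 * fst p) + (norm (t *s fst (snd p)) + norm (snd (snd p)))"
    unfolding dil_def by (intro order_trans[OF norm_Pair_le] add_left_mono) simp
  also have "\<dots> = norm t ^ 2 * norm (fst p) + (norm t * norm (fst (snd p)) + norm (snd (snd p)))"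
    by (simp add: norm_mult norm_power ns)
  \<comment> \<open>The dilation stretches the three coordinates by at most 4, 2 and 1, in total 7 <
    8; hence the radius \<open>d / 8\<close>.\<close>
  also have "\<dots> \<le> 4 * norm p + (2 * norm p + norm p)"
    using n t2 assms(2) by (intro add_mono mult_mono) auto
  also have "\<dots> < d" using p \<open>d > 0\<close> by linarith
  finally show ?thesis by simp
qed

text \<open>Near 0 the expansion along the dilation orbit converges at \<open>t = 1\<close>, and
  since positive weights vanish it stops: three terms of the \<open>w\<close>-component, two of each
  \<open>z_j\<close>-component and one of the \<open>\<zeta>\<close>-component. These are the ones
  computed for weights -2, -1 and 0.\<close>

lemma hol_explicit:
  assumes X: "germ X \<in> hol (M\<^sub>0 n e)"
  obtains \<alpha> \<xi> \<gamma>0 \<upsilon> v \<rho> :: real and h \<gamma> :: "nat \<Rightarrow> real" where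
    "germ X = germ (\<lambda>p. \<alpha> *\<^sub>R Y_w p + (\<Sum>j\<in>K. h j *\<^sub>R X_z n e j p) + (\<Sum>j\<in>K. \<gamma> j *\<^sub>R Y_z e j p) +
      \<xi> *\<^sub>R X_\<zeta> n e p + \<gamma>0 *\<^sub>R Y_\<zeta> p + \<upsilon> *\<^sub>R U\<^sub>0 n e p + v *\<^sub>R V\<^sub>0 n e p + \<rho> *\<^sub>R V_neg n e p)"
proof -
  from X obtain Y U where Y: "germ X = germ Y" "open U" "0 \<in> U" "holomorphic_vf_on Y U"
    "\<And>p. p \<in> M\<^sub>0 n e \<inter> U \<Longrightarrow> Y p \<in> tangent_at (M\<^sub>0 n e) p"
    unfolding hol_def by blast
  obtain d where d: "d > 0" "ball 0 d \<subseteq> U" using Y(2,3) open_contains_ball by blast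
  have line: "(0, 0, \<zeta>) \<in> U" if "norm \<zeta> < d" for \<zeta>
    using that d(2) by (auto simp: norm_Pair)
  let ?a = "\<lambda>p. fst (Y p)" and ?b = "\<lambda>j p. zc j (Y p)" and ?c = "\<lambda>p. snd (snd (Y p))"
  have graded: "graded_symmetry d k (wpart (k + 2) ?a) (\<lambda>j. wpart (k + 1) (?b j)) (wpart k ?c)" for k
    by (rule graded_symmetry_wpart[OF Y(4,2) line Y(5)])
  from graded[of "-2"] obtain \<alpha> :: real where a0: "\<And>p. p \<in> tube d \<Longrightarrow> wpart 0 ?a p = \<i> * of_real \<alpha>"
    using graded_minus_2[OF _ d(1)] by (metis (no_types, lifting) add.left_inverse)
  have g1: "graded_symmetry d (-1) (wpart 1 ?a) (\<lambda>j. wpart 0 (?b j)) (wpart (-1) ?c)"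
    using graded[of "-1"] by simp
  obtain h \<gamma> where h: "\<And>j. j \<notin> K \<Longrightarrow> h j = 0"
    and a1: "\<And>p. p \<in> tube d \<Longrightarrow> wpart 1 ?a p = 2 * (\<Sum>l\<in>K. of_real (h (n - l)) * zc l p)"
    and b0: "\<And>j p. j \<in> K \<Longrightarrow> p \<in> tube d \<Longrightarrow> wpart 0 (?b j) p = of_real (h j) - snd (snd p) * of_real (h (j - 1)) + \<i> * of_real (\<gamma> j)"
    by (rule graded_minus_1[OF g1 d(1)]) (rule that, assumption+)
  have g0: "graded_symmetry d 0 (wpart 2 ?a) (\<lambda>j. wpart 1 (?b j)) (wpart 0 ?c)"
    using graded[of 0] by simp
  obtain \<xi>' \<upsilon> v \<gamma>0 \<rho> where
    a2: "\<And>p. p \<in> tube d \<Longrightarrow> wpart 2 ?a p = of_real (real n * \<upsilon> + 2 * v) * fst p + \<i> * of_real \<rho> * (zc 1 p)\<^sup>2"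
    and b1: "\<And>j p. j \<in> K \<Longrightarrow> p \<in> tube d \<Longrightarrow> wpart 1 (?b j) p = (\<Sum>l\<in>K. bm \<xi>' \<upsilon> v \<rho> j l * zc l p)"
    and c0: "\<And>p. p \<in> tube d \<Longrightarrow> wpart 0 ?c p = of_real (2 * \<xi>') + \<i> * of_real \<gamma>0 + of_real \<upsilon> * snd (snd p)"
    by (rule graded_0[OF g0 d(1)]) (rule that, assumption+)
  have Z: "wpart (k + 2) ?a p = 0" "j \<in> K \<Longrightarrow> wpart (k + 1) (?b j) p = 0" "wpart k ?c p = 0"
    if "k \<ge> 1" "p \<in> tube d" for k j p
    using graded_ge_1[OF graded d(1) that(1)] that(2) by blast+
  define R where "R p = \<alpha> *\<^sub>R Y_w p + (\<Sum>j\<in>K. h j *\<^sub>R X_z n e j p) + (\<Sum>j\<in>K. \<gamma> j *\<^sub>R Y_z e j p) +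
      \<xi>' *\<^sub>R X_\<zeta> n e p + \<gamma>0 *\<^sub>R Y_\<zeta> p + \<upsilon> *\<^sub>R U\<^sub>0 n e p + v *\<^sub>R V\<^sub>0 n e p + \<rho> *\<^sub>R V_neg n e p" for p
  have YR: "Y p = R p" if p: "p \<in> ball 0 (d / 8)" for p
  proof -
    have U: "dil t p \<in> U" if "norm t < 2" for t
      using dil_in_ball[OF p that] d(2) by blast
    have "norm (snd (snd p)) \<le> norm p"
      using norm_snd_le[of "snd p" "fst p"] norm_snd_le[of "snd (snd p)" "fst (snd p)"] by simp
    then have t: "p \<in> tube d" using p d(1) by (simp add: tube_def)
    have expand: "f p = (\<Sum>m<N. wpart (int m) f p)"
      if "cspace.chol f U" "\<And>m. m \<ge> N \<Longrightarrow> wpart (int m) f p = 0" for f N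
      using sums_unique2[OF wpart_sums[OF that(1) Y(2) U] sums_finite[of "{..<N}"]] that(2) by auto
    note C = holomorphic_vf_components[OF Y(4)]
    have a: "?a p = wpart 0 ?a p + wpart 1 ?a p + wpart 2 ?a p"
    proof -
      have "wpart (int m) ?a p = 0" if "m \<ge> 3" for m
        using Z(1)[of "int m - 2" p] that t by simp
      from expand[OF C(1) this] show ?thesis by (simp add: eval_nat_numeral)
    qed
    have b: "?b j p = wpart 0 (?b j) p + wpart 1 (?b j) p" if "j \<in> K" for j
    proof -
      have "wpart (int m) (?b j) p = 0" if "m \<ge> 2" for m
        using Z(2)[of "int m - 1" p j] that t \<open>j \<in> K\<close> by simp
      from expand[OF C(2) this] show ?thesis by (simp add: eval_nat_numeral)
    qed
    have c: "?c p = wpart 0 ?c p"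
    proof -
      have "wpart (int m) ?c p = 0" if "m \<ge> 1" for m
        using Z(3)[of "int m" p] that t by simp
      from expand[OF C(3) this] show ?thesis by simp
    qed
    show ?thesis
    proof (rule cspace_eqI)
      \<comment> \<open>The fields \<open>X_z n e j\<close> carry \<open>z_(n-j)\<close> in their
        \<open>w\<close>-component, so the sum has to be reversed to match the formula for weight
        -1.\<close>
      have "(\<Sum>j\<in>K. of_real (h j) * (2 * zc (n - j) p)) = 2 * (\<Sum>l\<in>K. of_real (h (n - l)) * zc l p)"
        unfolding sum_distrib_left
        by (rule sum.reindex_bij_witness[where i = "\<lambda>j. n - j" and j = "\<lambda>j. n - j"]) (auto simp: K_iff)
      then have "fst (R p) = of_real \<alpha> * \<i> + 2 * (\<Sum>l\<in>K. of_real (h (n - l)) * zc l p) +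
          of_real \<upsilon> * (of_nat n * fst p) + of_real v * (2 * fst p) + of_real \<rho> * (\<i> * (zc 1 p)\<^sup>2)"
        unfolding R_def
        by (simp add: fst_sum_pairs X_z_simps Y_z_simps X_zeta_simps U_0_simps V_0_simps V_neg_simps scaleR_conv_of_real
            cong: sum.cong)
      then show "fst (Y p) = fst (R p)"
        unfolding a a0[OF t] a1[OF t] a2[OF t] by (simp add: algebra_simps)
      have "snd (snd (R p)) = of_real \<xi>' * 2 + of_real \<gamma>0 * \<i> + of_real \<upsilon> * snd (snd p)"
        unfolding R_def
        by (simp add: fst_sum_pairs X_z_simps Y_z_simps X_zeta_simps U_0_simps V_0_simps V_neg_simps scaleR_conv_of_real
            cong: sum.cong)
      then show "snd (snd (Y p)) = snd (snd (R p))"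
        unfolding c c0[OF t] by (simp add: algebra_simps)
      fix k assume k: "k \<in> K"
      have X: "(\<Sum>j\<in>K. of_real (h j) * zc k (X_z n e j p)) = of_real (h k) - snd (snd p) * of_real (h (k - 1))"
      proof -
        have "(\<Sum>j\<in>K. of_real (h j) * zc k (X_z n e j p))
           = (\<Sum>j\<in>K. (if j = k then of_real (h j) else 0) - (if j = k - 1 then snd (snd p) * of_real (h j) else 0))"
        proof (intro sum.cong refl)
          fix j assume j: "j \<in> K"
          have "k = j + 1 \<longleftrightarrow> j = k - 1" using j k by (auto simp: K_iff)
          then show "of_real (h j) * zc k (X_z n e j p) = (if j = k then of_real (h j) else 0) - (if j = k - 1 then snd (snd p) * of_real (h j) else 0)"
            unfolding X_z_simps(2)[OF j k] by (simp add: algebra_simps)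
        qed
        then show ?thesis using k h[of "k - 1"] by (simp add: sum_subtractf)
      qed
      have Yz: "(\<Sum>j\<in>K. of_real (\<gamma> j) * zc k (Y_z e j p)) = of_real (\<gamma> k) * \<i>"
      proof -
        have "(\<Sum>j\<in>K. of_real (\<gamma> j) * zc k (Y_z e j p)) = (\<Sum>j\<in>K. if j = k then of_real (\<gamma> j) * \<i> else 0)"
          using k by (intro sum.cong refl) (simp add: Y_z_simps(2))
        then show ?thesis using k by simp
      qed
      have "zc k (R p) = (of_real (h k) - snd (snd p) * of_real (h (k - 1))) + of_real (\<gamma> k) * \<i> +
          of_real \<xi>' * zc k (X_\<zeta> n e p) + of_real \<upsilon> * zc k (U\<^sub>0 n e p) + of_real v * zc k (V\<^sub>0 n e p) + of_real \<rho> * zc k (V_neg n e p)"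
        unfolding R_def zc_add zc_sum zc_scaleR X Yz by simp
      then show "zc k (Y p) = zc k (R p)"
        unfolding b[OF k] b0[OF k t] b1[OF k t] bm_sum[OF k] X_zeta_simps(2)[OF k] U_0_simps(2)[OF k]
          V_0_simps(2)[OF k] V_neg_simps(2)[OF k]
        by (auto simp: algebra_simps)
    qed
  qed
  have "germ Y = germ R"
    unfolding germ_eq_iff eventually_nhds using d(1) YR by (intro exI[of _ "ball 0 (d / 8)"]) auto
  then have "germ X = germ R" using Y(1) by simp
  then show ?thesis unfolding R_def[abs_def] by (rule that)
qed

lemma hol_M_eq_span:
  "hol (M\<^sub>0 n e) = span (germ ` ({Y_w} \<union> X_z n e ` K \<union> Y_z e ` K \<union> {X_\<zeta> n e, Y_\<zeta>, U\<^sub>0 n e, V\<^sub>0 n e, V_neg n e}))"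
  (is "_ = span (germ ` ?G)")
proof
  show "span (germ ` ?G) \<subseteq> hol (M\<^sub>0 n e)"
    by (rule span_minimal[OF generators_in_hol subspace_hol])
  show "hol (M\<^sub>0 n e) \<subseteq> span (germ ` ?G)"
  proof
    fix x assume x: "x \<in> hol (M\<^sub>0 n e)"
    then obtain X where X: "x = germ X" unfolding hol_def by blast
    from x[unfolded X] show "x \<in> span (germ ` ?G)"
    proof (rule hol_explicit)
      fix \<alpha> \<xi> \<gamma>0 \<upsilon> v \<rho> :: real and h \<gamma> :: "nat \<Rightarrow> real"
      assume "germ X = germ (\<lambda>p. \<alpha> *\<^sub>R Y_w p + (\<Sum>j\<in>K. h j *\<^sub>R X_z n e j p) + (\<Sum>j\<in>K. \<gamma> j *\<^sub>R Y_z e j p) +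
        \<xi> *\<^sub>R X_\<zeta> n e p + \<gamma>0 *\<^sub>R Y_\<zeta> p + \<upsilon> *\<^sub>R U\<^sub>0 n e p + v *\<^sub>R V\<^sub>0 n e p + \<rho> *\<^sub>R V_neg n e p)"
      also have "\<dots> = \<alpha> *\<^sub>R germ Y_w + (\<Sum>j\<in>K. h j *\<^sub>R germ (X_z n e j)) + (\<Sum>j\<in>K. \<gamma> j *\<^sub>R germ (Y_z e j)) +
        \<xi> *\<^sub>R germ (X_\<zeta> n e) + \<gamma>0 *\<^sub>R germ Y_\<zeta> + \<upsilon> *\<^sub>R germ (U\<^sub>0 n e) + v *\<^sub>R germ (V\<^sub>0 n e) + \<rho> *\<^sub>R germ (V_neg n e)"
        by (simp add: plus_germ.abs_eq scaleR_germ.abs_eq germ_sum)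
      also have "\<dots> \<in> span (germ ` ?G)"
        by (intro span_add span_sum span_scale span_base imageI) auto
      finally show ?thesis unfolding X .
    qed
  qed
qed

end

theorem theorem6p4:
  fixes n :: nat and e :: "nat \<Rightarrow> 'm::finite"
  assumes "n > 4" and "bij_betw e {1..n - 1} (UNIV :: 'm set)"
  shows "hol (M\<^sub>0 n e) =
    span (germ ` ({Y_w} \<union> X_z n e ` {1..n - 1} \<union> Y_z e ` {1..n - 1} \<union>
                  {X_\<zeta> n e, Y_\<zeta>, U\<^sub>0 n e, V\<^sub>0 n e, V_neg n e}))"
proof -
  interpret model_hypersurface n e
    by unfold_locales (fact assms)+
  show ?thesis using hol_M_eq_span unfolding K_def .
qed

end
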